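(* Let $n\ge3$. Let $\Gamma\subset\mathbb R^n$ be an open convex symmetric cone with vertex at the origin such that $\Gamma_n\subset\Gamma\subset\Gamma_1$, and let $f\in C^1(\Gamma)$ be symmetric in $\Gamma$ with $f>0$ and $f_{\lambda_i}:=\partial f/\partial\lambda_i>0$ in $\Gamma$ for every $i$. Let $\mathbb S^n_+:=\{\theta\in\mathbb S^n:\theta_1\ge0\}$. Assume that $K>0$, $K\in C^1(\mathbb S^n_+)$ and $H\in C^1(\partial\mathbb S^n_+)$ are such that $\nabla_{\frac{\partial}{\partial\theta_{n+1}}}K\ge0$ on $\mathbb S^n_+$, $\nabla_{\frac{\partial}{\partial\theta_{n+1}}}H\ge0$ on $\partial\mathbb S^n_+$, and at least one of these two inequalities is strict somewhere. Then the problem $$\begin{cases} f\left(\lambda(A_{v^{\frac4{n-2}}g_0})\right)=K(\theta),\quad \lambda(A_{v^{\frac4{n-2}}g_0})\in\Gamma\ \text{ and }\ v>0 & \text{on }\mathbb S^n_+,\\[4pt] \dfrac{\partial v}{\partial\nu}=H(\theta)v^{\frac n{n-2}} & \text{on }\partial\mathbb S^n_+\end{cases}$$ has no positive solution $v\in C^2(\mathbb S^n_+)$.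
   Context: $\mathbb S^n\subset\mathbb R^{n+1}$ is the unit sphere, $g_0$ its standard metric, points written $\theta=(\theta_1,\dots,\theta_{n+1})$; $\nu$ is the unit outer normal of $\partial\mathbb S^n_+$. $\Gamma_1:=\{\lambda\in\mathbb R^n:\sum_i\lambda_i>0\}$ and $\Gamma_n:=\{\lambda\in\mathbb R^n:\lambda_i>0\text{ for all }i\}$; $\Gamma$ symmetric means it is invariant under permutations of the coordinates. The Schouten tensor of a metric $g$ is $$A_g=\frac1{n-2}\left(Ric_g-\frac{R_g}{2(n-1)}g\right),$$ with $Ric_g$, $R_g$ the Ricci tensor and scalar curvature; $\lambda(A_g)$ denotes the eigenvalues of $A_g$ with respect to $g$. $\nabla_{\frac{\partial}{\partial\theta_{n+1}}}$ denotes the derivative along the meridians (great semicircles joining $\mathbf s=(0,\dots,0,-1)$ to $\mathbf n=(0,\dots,0,1)$) in the direction of increasing $\theta_{n+1}$ (at points other than the poles); note that this direction is tangent to $\partial\mathbb S^n_+=\{\theta\in\mathbb S^n:\theta_1=0\}$ along $\partial\mathbb S^n_+$. *)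

theory Defs
  imports "HOL-Analysis.Analysis"
begin

section \<open>Functions of class \<open>C\<^sup>1\<close> and \<open>C\<^sup>2\<close>\<close>

definition C1_open :: "'a::real_normed_vector set \<Rightarrow> ('a \<Rightarrow> 'b::real_normed_vector) \<Rightarrow> bool" where
  "C1_open U F \<longleftrightarrow>
     (\<exists>F' :: 'a \<Rightarrow> 'a \<Rightarrow>\<^sub>L 'b.
        (\<forall>x\<in>U. (F has_derivative blinfun_apply (F' x)) (at x)) \<and> continuous_on U F')"

definition C2_open :: "'a::real_normed_vector set \<Rightarrow> ('a \<Rightarrow> 'b::real_normed_vector) \<Rightarrow> bool" where
  "C2_open U F \<longleftrightarrow>
     (\<exists>F' :: 'a \<Rightarrow> 'a \<Rightarrow>\<^sub>L 'b.
        (\<forall>x\<in>U. (F has_derivative blinfun_apply (F' x)) (at x)) \<and> C1_open U F')"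

text \<open>On a submanifold (possibly with boundary) \<open>S\<close> of a Euclidean space, being of class
  \<open>C\<^sup>k\<close> means being the restriction to \<open>S\<close> of a \<open>C\<^sup>k\<close> function defined near \<open>S\<close>.\<close>

definition C1_on :: "'a::real_normed_vector set \<Rightarrow> ('a \<Rightarrow> 'b::real_normed_vector) \<Rightarrow> bool" where
  "C1_on S f \<longleftrightarrow> (\<exists>U F. open U \<and> S \<subseteq> U \<and> C1_open U F \<and> (\<forall>x\<in>S. F x = f x))"

definition C2_on :: "'a::real_normed_vector set \<Rightarrow> ('a \<Rightarrow> 'b::real_normed_vector) \<Rightarrow> bool" where
  "C2_on S f \<longleftrightarrow> (\<exists>U F. open U \<and> S \<subseteq> U \<and> C2_open U F \<and> (\<forall>x\<in>S. F x = f x))"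


section \<open>The Schouten tensor of a metric in local coordinates\<close>

text \<open>\<open>S\<close> is the coordinate domain, which may be a domain with boundary (a closed ball below);
  derivatives are taken within \<open>S\<close>, hence are one-sided at boundary points.  On a closed ball they are
  still uniquely determined, see \<open>has_derivative_within_cball_unique\<close>.\<close>

definition pderiv_within ::
    "(real^'n) set \<Rightarrow> 'n \<Rightarrow> (real^'n \<Rightarrow> 'b::real_normed_vector) \<Rightarrow> real^'n \<Rightarrow> 'b" where
  "pderiv_within S i F x = frechet_derivative F (at x within S) (axis i 1)"

definition christoffel ::
    "(real^'n) set \<Rightarrow> (real^'n \<Rightarrow> real^'n^'n) \<Rightarrow> 'n \<Rightarrow> 'n \<Rightarrow> 'n \<Rightarrow> real^'n \<Rightarrow> real" where
  "christoffel S g k i j x =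
     (\<Sum>l\<in>UNIV. matrix_inv (g x) $ k $ l *
        (pderiv_within S i (\<lambda>y. g y $ j $ l) x + pderiv_within S j (\<lambda>y. g y $ i $ l) x
         - pderiv_within S l (\<lambda>y. g y $ i $ j) x)) / 2"

text \<open>\<open>riemann S g l k i j\<close> is the coefficient of \<open>\<partial>\<^sub>l\<close> in
  \<open>R(\<partial>\<^sub>i, \<partial>\<^sub>j) \<partial>\<^sub>k = \<nabla>\<^sub>i \<nabla>\<^sub>j \<partial>\<^sub>k - \<nabla>\<^sub>j \<nabla>\<^sub>i \<partial>\<^sub>k\<close>;
  \<open>Ric(Y, Z)\<close> is the trace of \<open>X \<mapsto> R(X, Y) Z\<close>, which is positive on round spheres.\<close>

definition riemann ::
    "(real^'n) set \<Rightarrow> (real^'n \<Rightarrow> real^'n^'n) \<Rightarrow> 'n \<Rightarrow> 'n \<Rightarrow> 'n \<Rightarrow> 'n \<Rightarrow> real^'n \<Rightarrow> real" where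
  "riemann S g l k i j x =
     pderiv_within S i (christoffel S g l j k) x - pderiv_within S j (christoffel S g l i k) x
     + (\<Sum>m\<in>UNIV. christoffel S g l i m x * christoffel S g m j k x
                  - christoffel S g l j m x * christoffel S g m i k x)"

definition ricci ::
    "(real^'n) set \<Rightarrow> (real^'n \<Rightarrow> real^'n^'n) \<Rightarrow> real^'n \<Rightarrow> real^'n^'n" where
  "ricci S g x = (\<chi> j k. \<Sum>i\<in>UNIV. riemann S g i k i j x)"

definition scalar_curvature ::
    "(real^'n) set \<Rightarrow> (real^'n \<Rightarrow> real^'n^'n) \<Rightarrow> real^'n \<Rightarrow> real" where
  "scalar_curvature S g x =
     (\<Sum>i\<in>UNIV. \<Sum>j\<in>UNIV. matrix_inv (g x) $ i $ j * ricci S g x $ i $ j)"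

definition schouten ::
    "(real^'n) set \<Rightarrow> (real^'n \<Rightarrow> real^'n^'n) \<Rightarrow> real^'n \<Rightarrow> real^'n^'n" where
  "schouten S g x =
     (1 / (real CARD('n) - 2)) *\<^sub>R
       (ricci S g x - (scalar_curvature S g x / (2 * (real CARD('n) - 1))) *\<^sub>R g x)"

text \<open>\<open>l\<close> lists, in some order and with multiplicities, the eigenvalues of the bilinear form \<open>A\<close>
  with respect to the metric \<open>g\<close>, i.e. those of the endomorphism \<open>g\<^sup>-\<^sup>1 A\<close>.\<close>

definition eigenvalues_wrt :: "real^'n^'n \<Rightarrow> real^'n^'n \<Rightarrow> real^'n \<Rightarrow> bool" where
  "eigenvalues_wrt g A l \<longleftrightarrow>
     (\<forall>t::real. det (mat t - matrix_inv g ** A) = (\<Prod>i\<in>UNIV. t - l $ i))"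


section \<open>Symmetric functions on symmetric cones\<close>

text \<open>An open cone with vertex at the origin need not contain the origin, so only positive
  dilations are allowed (unlike in the library notion \<^const>\<open>cone\<close>).\<close>

definition cone_at_origin :: "'a::real_vector set \<Rightarrow> bool" where
  "cone_at_origin G \<longleftrightarrow> (\<forall>x\<in>G. \<forall>t>0. t *\<^sub>R x \<in> G)"

definition permute_coords :: "('n \<Rightarrow> 'n) \<Rightarrow> real^'n \<Rightarrow> real^'n" where
  "permute_coords p x = (\<chi> i. x $ p i)"

definition symmetric_set :: "(real^'n) set \<Rightarrow> bool" where
  "symmetric_set G \<longleftrightarrow> (\<forall>p x. p permutes UNIV \<longrightarrow> x \<in> G \<longrightarrow> permute_coords p x \<in> G)"

definition symmetric_fun_on :: "(real^'n) set \<Rightarrow> (real^'n \<Rightarrow> real) \<Rightarrow> bool" where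
  "symmetric_fun_on G f \<longleftrightarrow>
     (\<forall>p x. p permutes UNIV \<longrightarrow> x \<in> G \<longrightarrow> f (permute_coords p x) = f x)"

definition Gamma_1 :: "(real^'n) set" where
  "Gamma_1 = {l. (\<Sum>i\<in>UNIV. l $ i) > 0}"

definition Gamma_n :: "(real^'n) set" where
  "Gamma_n = {l. \<forall>i. l $ i > 0}"

definition partial :: "'n \<Rightarrow> (real^'n \<Rightarrow> real) \<Rightarrow> real^'n \<Rightarrow> real" where
  "partial i f l = frechet_derivative f (at l) (axis i 1)"


section \<open>The hemisphere\<close>

text \<open>With \<open>n = CARD('n)\<close>, the space \<open>\<real>\<^sup>n\<^sup>+\<^sup>1\<close> is \<open>real \<times> (real^'n)\<close>, whose norm is Euclidean:
  \<open>\<theta>\<^sub>1\<close> is \<open>fst \<theta>\<close>, the other coordinates are those of \<open>snd \<theta>\<close>,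
  and \<open>\<theta>\<^sub>n\<^sub>+\<^sub>1\<close> is \<open>snd \<theta> $ k\<close> for a chosen index \<open>k :: 'n\<close>.\<close>

definition hemisphere :: "(real \<times> (real^'n)) set" where
  "hemisphere = {\<theta> \<in> sphere 0 1. fst \<theta> \<ge> 0}"

definition hemisphere_bd :: "(real \<times> (real^'n)) set" where
  "hemisphere_bd = {\<theta> \<in> sphere 0 1. fst \<theta> = 0}"

definition outer_normal :: "real \<times> (real^'n)" where
  "outer_normal = (-1, 0)"

definition north :: "'n \<Rightarrow> real \<times> (real^'n)" where
  "north k = (0, axis k 1)"

definition poles :: "'n \<Rightarrow> (real \<times> (real^'n)) set" where
  "poles k = {north k, - north k}"

text \<open>The meridian through \<open>\<theta>\<close> (not a pole), parametrised by \<open>s = \<theta>\<^sub>n\<^sub>+\<^sub>1 \<in> (-1, 1)\<close>.\<close>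

definition meridian :: "'n \<Rightarrow> real \<times> (real^'n) \<Rightarrow> real \<Rightarrow> real \<times> (real^'n)" where
  "meridian k \<theta> s =
     sqrt (1 - s\<^sup>2) *\<^sub>R sgn (\<theta> - (snd \<theta> $ k) *\<^sub>R north k) + s *\<^sub>R north k"

definition meridian_deriv :: "'n \<Rightarrow> (real \<times> (real^'n) \<Rightarrow> real) \<Rightarrow> real \<times> (real^'n) \<Rightarrow> real" where
  "meridian_deriv k u \<theta> = deriv (\<lambda>s. u (meridian k \<theta> s)) (snd \<theta> $ k)"

text \<open>The geodesic \<open>t \<mapsto> cos t \<theta> + sin t \<nu>\<close> issuing from a boundary point \<open>\<theta>\<close> lies in the
  hemisphere for \<open>t \<le> 0\<close> near \<open>0\<close>.\<close>

definition has_normal_deriv ::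
    "(real \<times> (real^'n) \<Rightarrow> real) \<Rightarrow> real \<Rightarrow> real \<times> (real^'n) \<Rightarrow> bool" where
  "has_normal_deriv v d \<theta> \<longleftrightarrow>
     ((\<lambda>t. v (cos t *\<^sub>R \<theta> + sin t *\<^sub>R outer_normal)) has_real_derivative d) (at 0 within {..0})"

text \<open>Stereographic projection from \<open>(-1, 0)\<close> is a global chart of the closed hemisphere onto the
  closed unit ball, see \<open>bij_betw_chart\<close>.\<close>

definition chart :: "real \<times> (real^'n) \<Rightarrow> real^'n" where
  "chart \<theta> = (1 / (1 + fst \<theta>)) *\<^sub>R snd \<theta>"

definition chart_inv :: "real^'n \<Rightarrow> real \<times> (real^'n)" where
  "chart_inv x = ((1 - (norm x)\<^sup>2) / (1 + (norm x)\<^sup>2), (2 / (1 + (norm x)\<^sup>2)) *\<^sub>R x)"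

text \<open>The metric induced by \<open>\<real>\<^sup>n\<^sup>+\<^sup>1\<close> on the sphere, in the chart above.\<close>

definition round_metric :: "real^'n \<Rightarrow> real^'n^'n" where
  "round_metric x =
     (\<chi> i j. frechet_derivative chart_inv (at x) (axis i 1)
           \<bullet> frechet_derivative chart_inv (at x) (axis j 1))"

definition conformal_metric :: "(real \<times> (real^'n) \<Rightarrow> real) \<Rightarrow> real^'n \<Rightarrow> real^'n^'n" where
  "conformal_metric v x =
     (v (chart_inv x) powr (4 / (real CARD('n) - 2))) *\<^sub>R round_metric x"

definition schouten_eigenvalues ::
    "(real \<times> (real^'n) \<Rightarrow> real) \<Rightarrow> real \<times> (real^'n) \<Rightarrow> real^'n \<Rightarrow> bool" where
  "schouten_eigenvalues v \<theta> l \<longleftrightarrow>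
     (let x = chart \<theta>; g = conformal_metric v in
      eigenvalues_wrt (g x) (schouten (cball 0 1) g x) l)"

text \<open>As \<open>G\<close> and \<open>f\<close> are symmetric, the order in which the eigenvalues are listed is irrelevant.\<close>

definition is_solution ::
    "(real^'n) set \<Rightarrow> (real^'n \<Rightarrow> real) \<Rightarrow> (real \<times> (real^'n) \<Rightarrow> real) \<Rightarrow> (real \<times> (real^'n) \<Rightarrow> real) \<Rightarrow>
     (real \<times> (real^'n) \<Rightarrow> real) \<Rightarrow> bool" where
  "is_solution G f K H v \<longleftrightarrow>
     (\<forall>\<theta>\<in>hemisphere. v \<theta> > 0 \<and> (\<exists>l. schouten_eigenvalues v \<theta> l \<and> l \<in> G \<and> f l = K \<theta>)) \<and>
     (\<forall>\<theta>\<in>hemisphere_bd.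
        has_normal_deriv v (H \<theta> * v \<theta> powr (real CARD('n) / (real CARD('n) - 2))) \<theta>)"


section \<open>Well-definedness of the coordinate description\<close>

lemma bij_betw_chart:
  "bij_betw chart (hemisphere :: (real \<times> (real^'n)) set) (cball 0 1)"
  "\<And>x. x \<in> cball 0 1 \<Longrightarrow> chart_inv x \<in> (hemisphere :: (real \<times> (real^'n)) set) \<and> chart (chart_inv x) = x"
  "\<And>\<theta>. \<theta> \<in> (hemisphere :: (real \<times> (real^'n)) set) \<Longrightarrow> chart_inv (chart \<theta>) = \<theta>"
proof -
  have A: "chart_inv x \<in> hemisphere \<and> chart (chart_inv x) = x" if "x \<in> cball 0 1" for x :: "real^'n"
  proof -
    define r where "r = (norm x)\<^sup>2"
    have r: "0 \<le> r" "r \<le> 1"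
      using that by (auto simp: r_def abs_square_le_1)
    have s: "1 + (1 - r) / (1 + r) = 2 / (1 + r)"
      using r by (simp add: field_simps)
    have "((1 - r) / (1 + r))\<^sup>2 + (2 / (1 + r))\<^sup>2 * r = 1"
      using r by (simp add: divide_simps) (simp add: power2_eq_square algebra_simps)
    then have "norm (chart_inv x) = 1"
      by (simp add: chart_inv_def norm_Pair r_def power_mult_distrib power_divide)
    moreover have "fst (chart_inv x) \<ge> 0"
      using r by (simp add: chart_inv_def r_def)
    moreover have "chart (chart_inv x) = x"
    proof -
      have "1 / (1 + (1 - r) / (1 + r)) * (2 / (1 + r)) = 1"
        unfolding s using r by simp
      then show ?thesis by (simp only: chart_def chart_inv_def fst_conv snd_conv scaleR_scaleR
            scaleR_one flip: r_def)
    qed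
    ultimately show ?thesis by (simp add: hemisphere_def)
  qed
  have B: "chart \<theta> \<in> cball 0 1 \<and> chart_inv (chart \<theta>) = \<theta>" if "\<theta> \<in> hemisphere" for \<theta> :: "real \<times> (real^'n)"
  proof -
    obtain a y where \<theta>: "\<theta> = (a, y)" by (cases \<theta>)
    have a: "a \<ge> 0" and ny: "a\<^sup>2 + (norm y)\<^sup>2 = 1"
      using that by (auto simp: hemisphere_def \<theta> norm_Pair)
    have yy: "(norm y)\<^sup>2 = (1 - a) * (1 + a)"
      using ny by (simp add: power2_eq_square algebra_simps)
    have n2: "(norm (chart \<theta>))\<^sup>2 = (1 - a) / (1 + a)"
      using a yy by (simp add: chart_def \<theta> power_divide divide_simps power2_eq_square)
    have "(1 - a) / (1 + a) \<le> 1" using a by simp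
    then have "norm (chart \<theta>) \<le> 1"
      using n2 power_le_one_iff[of "norm (chart \<theta>)" 2] by simp
    moreover have "(1 - (1 - a) / (1 + a)) / (1 + (1 - a) / (1 + a)) = a"
      "2 / (1 + (1 - a) / (1 + a)) = 1 + a"
      using a by (auto simp: divide_simps)
    then have "chart_inv (chart \<theta>) = \<theta>"
      using a unfolding chart_inv_def n2 by (simp add: chart_def \<theta>)
    ultimately show ?thesis by simp
  qed
  show "bij_betw chart (hemisphere :: (real \<times> (real^'n)) set) (cball 0 1)"
    by (rule bij_betw_byWitness[where f' = chart_inv]) (use A B in auto)
  show "\<And>x. x \<in> cball 0 1 \<Longrightarrow> chart_inv x \<in> (hemisphere :: (real \<times> (real^'n)) set) \<and> chart (chart_inv x) = x"
    using A .
  show "\<And>\<theta>. \<theta> \<in> (hemisphere :: (real \<times> (real^'n)) set) \<Longrightarrow> chart_inv (chart \<theta>) = \<theta>"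
    using B by blast
qed

lemma has_derivative_within_cball_unique:
  fixes F :: "'a::real_normed_vector \<Rightarrow> 'b::real_normed_vector"
  assumes D: "(F has_derivative D1) (at x within cball 0 1)" "(F has_derivative D2) (at x within cball 0 1)"
    and x: "x \<in> cball 0 1"
  shows "D1 = D2"
proof -
  have lin: "linear D1" "linear D2"
    using D has_derivative_linear by blast+
  have eq: "D1 (y - x) = D2 (y - x)" if y: "y \<in> cball 0 1" for y
  proof -
    let ?c = "\<lambda>t::real. x + t *\<^sub>R (y - x)"
    have sub: "?c ` {0..1} \<subseteq> cball 0 1"
    proof clarify
      fix t :: real assume "t \<in> {0..1}"
      then have "(1 - t) *\<^sub>R x + t *\<^sub>R y \<in> cball 0 1"
        using convexD_alt[OF convex_cball x y, of t] by simp
      then show "?c t \<in> cball 0 1" by (simp add: algebra_simps)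
    qed
    have c: "(?c has_derivative (\<lambda>t. t *\<^sub>R (y - x))) (at 0 within {0..1})"
      by (auto intro!: derivative_eq_intros)
    have V: "((\<lambda>t. F (?c t)) has_vector_derivative D (y - x)) (at 0 within {0..1})"
      if "(F has_derivative D) (at x within cball 0 1)" for D
    proof -
      have "((\<lambda>t. F (?c t)) has_derivative (\<lambda>t. D (t *\<^sub>R (y - x)))) (at 0 within {0..1})"
        using that by (intro has_derivative_in_compose[OF c] has_derivative_subset[OF _ sub]) simp
      then show ?thesis
        using has_derivative_linear[OF that] by (simp add: has_vector_derivative_def linear_cmul)
    qed
    show ?thesis
      by (rule vector_derivative_unique_within[OF _ V[OF D(1)] V[OF D(2)]])
         (simp add: trivial_limit_within islimpt_Icc)
  qed
  show ?thesis
  proof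
    fix h :: 'a
    have "inverse (norm h + 1) * norm h \<le> 1"
      by (simp add: inverse_eq_divide divide_le_eq_1 add_nonneg_pos)
    then have "D1 (inverse (norm h + 1) *\<^sub>R h - x) = D2 (inverse (norm h + 1) *\<^sub>R h - x)"
      by (intro eq) simp
    moreover have "D1 (0 - x) = D2 (0 - x)" by (intro eq) simp
    ultimately have "inverse (norm h + 1) *\<^sub>R D1 h = inverse (norm h + 1) *\<^sub>R D2 h"
      using lin by (simp add: linear_diff linear_cmul linear_neg)
    moreover have "norm h + 1 \<noteq> 0" using norm_ge_zero[of h] by linarith
    ultimately show "D1 h = D2 h" by simp
  qed
qed

end

theory Submission
  imports Defs "HOL-Computational_Algebra.Polynomial"
begin

text \<open>
  The obstruction is proved by moving spheres.  Stereographic projection from the south pole maps the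
  hemisphere to the half space \<open>{y. 0 \<le> y $ k}\<close>, the north pole to the origin and the meridians to the
  rays.  Write the solution metric \<open>v\<^sup>4\<^sup>/\<^sup>(\<^sup>n\<^sup>-\<^sup>2\<^sup>) g\<^sub>0\<close> there as \<open>s\<^sup>-\<^sup>2 |dy|\<^sup>2\<close>.  With this
  choice of the unknown both equations become simple: the eigenvalues of the Schouten tensor are those of the matrix
  \<open>s D\<^sup>2s - |Ds|\<^sup>2/2 I\<close> (the conformal Hessian, \<open>conformally_flat_schouten\<close>), and the boundary condition
  becomes the linear Neumann condition \<open>\<partial>\<^sub>k s = 2/(n-2) H\<close>
  (\<open>half_space_factor_boundary_gradient\<close>).

  Projection from the north pole gives a second function \<open>t\<close> of the same kind, and the reflection
  of \<open>s\<close> in the sphere of radius \<open>L\<close> is \<open>s\<^sub>L(y) = L\<^sup>2 t(y/L\<^sup>2)\<close>, which is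
  as smooth at the origin as \<open>t\<close>.  It solves the problem with \<open>K\<close> and \<open>H\<close> evaluated at
  the reflected point, which for \<open>|y| < L\<close> lies further south on the same meridian.  As \<open>K\<close> and \<open>H\<close>
  increase northwards, \<open>s\<^sub>L\<close> is a supersolution on the half ball \<open>|y| \<le> L\<close>, and it equals \<open>s\<close> on its
  spherical part.

  The claim is that \<open>s \<le> s\<^sub>L\<close> on that half ball for every \<open>L > 0\<close>; at the origin it reads
  \<open>s(0) \<le> L\<^sup>2 t(0)\<close>, which is absurd for small \<open>L\<close>.  It holds for large \<open>L\<close> by
  the behaviour of \<open>s\<close> at infinity.  If it holds for some \<open>L\<close>, then either \<open>s = s\<^sub>L\<close>, in which case
  \<open>K\<close> and \<open>H\<close> are constant along all meridians, contrary to the assumption; or \<open>s < s\<^sub>L\<close>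
  away from the sphere with a definite slope at the sphere (\<open>strong_comparison\<close>), and this survives a
  small decrease of \<open>L\<close> (\<open>moving_spheres\<close>).

  The strong comparison rests on one barrier (\<open>hopf_barrier\<close>) on annuli cut by the half space.  It
  plays the part of the strong maximum principle inside, of Hopf's lemma on the flat face and of its version at the
  corner.  The nonlinear operator is compared, not linearised: by Weyl's inequality, a symmetric function of
  the eigenvalues that increases in each of them cannot fail to increase when the matrix decreases by little in every direction
  but its trace grows by much (\<open>uniform_ellipticity\<close>).
\<close>

section \<open>Symmetric matrices and symmetric functions of their eigenvalues\<close>

text \<open>An orthonormal family of eigenvectors together with its eigenvalues.  Keeping the vectors, and not
  only the characteristic polynomial, makes variational arguments and conjugation by orthogonal matrices immediate.\<close>

definition eigenbasis :: "real^'n^'n \<Rightarrow> ('n \<Rightarrow> real^'n) \<Rightarrow> real^'n \<Rightarrow> bool" where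
  "eigenbasis A u m \<longleftrightarrow>
     (\<forall>i j. u i \<bullet> u j = (if i = j then 1 else 0)) \<and> (\<forall>i. A *v u i = (m $ i) *\<^sub>R u i)"

lemma symmetric_matrix_inner:
  fixes A :: "real^'n^'n"
  assumes "transpose A = A"
  shows "x \<bullet> (A *v y) = (A *v x) \<bullet> y"
  by (metis assms dot_lmul_matrix vector_transpose_matrix)

text \<open>A maximum point \<open>u\<close> of the quadratic form on the unit sphere of \<open>V\<close>, with value \<open>c\<close>, is an eigenvector:
  the form \<open>c |x|\<^sup>2 - x \<bullet> Ax\<close> is nonnegative on \<open>V\<close> and vanishes at \<open>u\<close>, so moving
  from \<open>u\<close> against \<open>c u - Au\<close> would make it negative unless that vector is zero.\<close>

lemma eigenvector_in_invariant_subspace: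
  fixes A :: "real^'n^'n" and V :: "(real^'n) set"
  assumes sym: "transpose A = A" and V: "subspace V" and inv: "\<And>x. x \<in> V \<Longrightarrow> A *v x \<in> V"
    and nz: "z \<in> V" "z \<noteq> 0"
  obtains u c where "u \<in> V" "norm u = 1" "A *v u = c *\<^sub>R u"
proof -
  let ?S = "V \<inter> sphere 0 1"
  have "compact ?S" using V by (intro closed_Int_compact closed_subspace) auto
  moreover have "z /\<^sub>R norm z \<in> ?S" using nz V by (auto simp: subspace_scale)
  ultimately obtain u where u: "u \<in> ?S" and max: "\<And>x. x \<in> ?S \<Longrightarrow> x \<bullet> (A *v x) \<le> u \<bullet> (A *v u)"
  proof -
    have "continuous_on ?S (\<lambda>x. x \<bullet> (A *v x))"
      by (intro continuous_intros matrix_vector_mult_linear_continuous_on)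
    with \<open>compact ?S\<close> \<open>z /\<^sub>R norm z \<in> ?S\<close> show ?thesis
      using continuous_attains_sup[of ?S "\<lambda>x. x \<bullet> (A *v x)"] that by blast
  qed
  define c where "c = u \<bullet> (A *v u)"
  define q where "q x = c * (x \<bullet> x) - x \<bullet> (A *v x)" for x
  have q0: "q x \<ge> 0" if "x \<in> V" for x
  proof (cases "x = 0")
    case False
    then have "x /\<^sub>R norm x \<in> ?S" using that V by (auto simp: subspace_scale)
    then have "(x /\<^sub>R norm x) \<bullet> (A *v (x /\<^sub>R norm x)) \<le> c" using max c_def by blast
    then have "(x \<bullet> (A *v x)) / (norm x)^2 \<le> c"
      by (simp add: matrix_vector_mult_scaleR power2_eq_square divide_simps)
    then show ?thesis using False unfolding q_def
      by (simp add: divide_le_eq dot_square_norm)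
  qed (simp add: q_def)
  have qu: "q u = 0" using u by (simp add: q_def c_def dot_square_norm)
  define v where "v = c *\<^sub>R u - A *v u"
  have vV: "v \<in> V" using u inv V unfolding v_def by (auto intro: subspace_diff subspace_scale)
  have "v \<bullet> v = 0"
  proof (rule ccontr)
    assume "v \<bullet> v \<noteq> 0"
    then have pos: "v \<bullet> v > 0" by simp
    have exp: "q (u - t *\<^sub>R v) = - 2 * t * (v \<bullet> v) + t\<^sup>2 * q v" for t
    proof -
      have e0: "u \<bullet> (A *v v) = v \<bullet> (A *v u)"
        using symmetric_matrix_inner[OF sym, of u v] by (simp add: inner_commute)
      have vv: "v \<bullet> v = c * (u \<bullet> v) - v \<bullet> (A *v u)"
        using arg_cong[OF v_def, of "\<lambda>w. v \<bullet> w"] by (simp add: inner_diff_right inner_commute)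
      have e1: "(u - t *\<^sub>R v) \<bullet> (A *v (u - t *\<^sub>R v))
          = u \<bullet> (A *v u) - 2 * (t * (v \<bullet> (A *v u))) + t * (t * (v \<bullet> (A *v v)))"
        by (simp add: matrix_vector_mult_diff_distrib matrix_vector_mult_scaleR inner_diff_left inner_diff_right
            e0 right_diff_distrib)
      have e2: "(u - t *\<^sub>R v) \<bullet> (u - t *\<^sub>R v) = u \<bullet> u - 2 * (t * (u \<bullet> v)) + t * (t * (v \<bullet> v))"
        by (simp add: inner_diff_left inner_diff_right inner_commute[of v u] right_diff_distrib)
      have "q (u - t *\<^sub>R v) = q u - 2 * t * (c * (u \<bullet> v) - v \<bullet> (A *v u)) + t\<^sup>2 * q v"
        unfolding q_def e1 e2 by (simp add: algebra_simps power2_eq_square)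
      then have "q (u - t *\<^sub>R v) = q u - 2 * t * (v \<bullet> v) + t\<^sup>2 * q v" using vv by simp
      then show ?thesis using qu by simp
    qed
    define t where "t = (v \<bullet> v) / (q v + 1)"
    have qv: "q v \<ge> 0" using q0 vV by blast
    then have t: "t > 0" using pos unfolding t_def by simp
    have "u - t *\<^sub>R v \<in> V" using u vV V by (auto intro: subspace_diff subspace_scale)
    then have "0 \<le> - 2 * t * (v \<bullet> v) + t\<^sup>2 * q v" using q0 exp by metis
    then have "0 \<le> t * (t * q v - 2 * (v \<bullet> v))" by (simp add: algebra_simps power2_eq_square)
    then have "2 * (v \<bullet> v) \<le> t * q v" using t by (simp add: zero_le_mult_iff)
    moreover have "t * q v \<le> v \<bullet> v" unfolding t_def using qv pos by (simp add: divide_simps)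
    ultimately show False using pos by simp
  qed
  then have "A *v u = c *\<^sub>R u" by (simp add: v_def)
  then show ?thesis using that u by auto
qed

text \<open>Eigenvectors are added one at a time; the orthogonal complement of those already found is invariant.\<close>

lemma symmetric_matrix_eigenbasis:
  fixes A :: "real^'n^'n"
  assumes sym: "transpose A = A"
  obtains u m where "eigenbasis A u m"
proof -
  define P where "P B \<longleftrightarrow> finite B \<and> (\<forall>b\<in>B. norm b = 1 \<and> (\<exists>c. A *v b = c *\<^sub>R b)) \<and>
     (\<forall>a\<in>B. \<forall>b\<in>B. a \<noteq> b \<longrightarrow> a \<bullet> b = 0)" for B :: "(real^'n) set"
  have ex: "\<exists>B. P B \<and> card B = k" if "k \<le> CARD('n)" for k
    using that
  proof (induction k)
    case 0
    show ?case by (rule exI[of _ "{}"]) (simp add: P_def)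
  next
    case (Suc k)
    then obtain B where B: "P B" "card B = k" by auto
    define V where "V = {x. \<forall>b\<in>B. orthogonal b x}"
    have V: "subspace V" unfolding V_def by (rule subspace_orthogonal_to_vectors)
    have "dim (span B) < DIM(real^'n)"
      using B Suc.prems dim_le_card'[of B] by (auto simp: P_def dim_span)
    then obtain z where z: "z \<noteq> 0" "\<And>y. y \<in> span B \<Longrightarrow> orthogonal z y"
      using orthogonal_to_subspace_exists[of B] by (auto simp: dim_span)
    have zV: "z \<in> V" unfolding V_def using z(2) by (auto simp: span_base orthogonal_commute)
    have inv: "A *v x \<in> V" if "x \<in> V" for x
      unfolding V_def
    proof safe
      fix b assume b: "b \<in> B"
      then have "\<exists>c. A *v b = c *\<^sub>R b" using B by (auto simp: P_def)
      then obtain c where "A *v b = c *\<^sub>R b" by blast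
      then have "b \<bullet> (A *v x) = c * (b \<bullet> x)"
        using symmetric_matrix_inner[OF sym, of b x] by simp
      then show "orthogonal b (A *v x)" using that b by (auto simp: V_def orthogonal_def)
    qed
    obtain u c where u: "u \<in> V" "norm u = 1" "A *v u = c *\<^sub>R u"
      by (rule eigenvector_in_invariant_subspace[OF sym V inv zV z(1)])
    have ub: "u \<bullet> b = 0" "b \<bullet> u = 0" if "b \<in> B" for b
      using u that by (auto simp: V_def orthogonal_def inner_commute)
    have "u \<notin> B" using ub[of u] u(2) by auto
    then have "P (insert u B)" "card (insert u B) = Suc k"
      using B u ub by (auto simp: P_def)
    then show ?case by blast
  qed
  from ex[of "CARD('n)"] obtain B where B: "P B" "card B = CARD('n)" by auto
  then obtain u where u: "bij_betw u (UNIV :: 'n set) B"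
    by (metis P_def finite_same_card_bij finite)
  have "\<forall>i. \<exists>c. A *v u i = c *\<^sub>R u i"
    using B u by (auto simp: P_def bij_betw_def)
  then obtain c where c: "\<And>i. A *v u i = c i *\<^sub>R u i" by metis
  have "eigenbasis A u (\<chi> i. c i)"
    unfolding eigenbasis_def
  proof safe
    fix i j
    have "u i \<in> B" "u j \<in> B" "u i = u j \<longleftrightarrow> i = j" using u by (auto simp: bij_betw_def inj_on_def)
    then show "u i \<bullet> u j = (if i = j then 1 else 0)"
      using B by (auto simp: P_def dot_square_norm)
  qed (simp add: c)
  then show ?thesis using that by blast
qed

lemma eigenbasis_inj:
  assumes "eigenbasis A u m"
  shows "inj u"
proof (rule injI)
  fix i j assume "u i = u j"
  then show "i = j" using assms unfolding eigenbasis_def by (metis zero_neq_one)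
qed

lemma eigenbasis_independent:
  assumes "eigenbasis A u m"
  shows "independent (u ` I)"
proof (rule pairwise_orthogonal_independent)
  show "pairwise orthogonal (u ` I)"
    using assms by (auto simp: eigenbasis_def pairwise_def orthogonal_def)
  show "0 \<notin> u ` I"
  proof
    assume "0 \<in> u ` I"
    then obtain i where "u i = 0" by auto
    then show False using assms unfolding eigenbasis_def by (metis inner_zero_left zero_neq_one)
  qed
qed

lemma eigenbasis_expand:
  assumes "eigenbasis A u m"
  shows "x = (\<Sum>i\<in>UNIV. (x \<bullet> u i) *\<^sub>R u i)"
proof -
  have ou: "u i \<bullet> u j = (if i = j then 1 else 0)" for i j using assms by (simp add: eigenbasis_def)
  have "independent (range u)" by (rule eigenbasis_independent[OF assms])
  moreover have "card (range u) = CARD('a)" using eigenbasis_inj[OF assms] by (simp add: card_image)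
  ultimately have sp: "span (range u) = UNIV"
    by (metis card_eq_dim dim_UNIV DIM_cart DIM_real mult.right_neutral subset_UNIV finite_imageI finite top.extremum_uniqueI)
  define y where "y = x - (\<Sum>i\<in>UNIV. (x \<bullet> u i) *\<^sub>R u i)"
  have "orthogonal y b" if "b \<in> range u" for b
  proof -
    from that obtain j where b: "b = u j" by (rule imageE)
    have "(\<Sum>i\<in>UNIV. (x \<bullet> u i) *\<^sub>R u i) \<bullet> u j = x \<bullet> u j"
      by (simp add: inner_sum_left ou if_distrib cong: if_cong)
    then show ?thesis by (simp add: y_def b orthogonal_def inner_diff_left)
  qed
  then have "orthogonal y y" using orthogonal_to_span[of y "range u" y] sp by auto
  then show ?thesis by (simp add: y_def orthogonal_def)
qed

lemma eigenbasis_quadratic_form: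
  assumes "eigenbasis A u m"
  shows "x \<bullet> (A *v x) = (\<Sum>i\<in>UNIV. m $ i * (x \<bullet> u i)\<^sup>2)" and "x \<bullet> x = (\<Sum>i\<in>UNIV. (x \<bullet> u i)\<^sup>2)"
proof -
  have Au: "A *v u i = (m $ i) *\<^sub>R u i" for i using assms by (simp add: eigenbasis_def)
  have "A *v x = (\<Sum>i\<in>UNIV. (x \<bullet> u i) *\<^sub>R (A *v u i))"
    by (subst eigenbasis_expand[OF assms, of x])
       (simp add: linear_sum[OF matrix_vector_mul_linear] matrix_vector_mult_scaleR)
  then show "x \<bullet> (A *v x) = (\<Sum>i\<in>UNIV. m $ i * (x \<bullet> u i)\<^sup>2)"
    by (simp add: Au inner_sum_right power2_eq_square algebra_simps)
  have "x \<bullet> x = x \<bullet> (\<Sum>i\<in>UNIV. (x \<bullet> u i) *\<^sub>R u i)" using eigenbasis_expand[OF assms, of x] by simp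
  then show "x \<bullet> x = (\<Sum>i\<in>UNIV. (x \<bullet> u i)\<^sup>2)" by (simp add: inner_sum_right power2_eq_square)
qed

lemma eigenbasis_det:
  fixes A :: "real^'n^'n"
  assumes "eigenbasis A u m"
  shows "det (mat t - A) = (\<Prod>i\<in>UNIV. t - m $ i)"
proof -
  define P :: "real^'n^'n" where "P = (\<chi> i j. u j $ i)"
  define E :: "real^'n^'n" where "E = (\<chi> i j. if i = j then t - m $ j else 0)"
  have ou: "u i \<bullet> u j = (if i = j then 1 else 0)" for i j using assms by (simp add: eigenbasis_def)
  have Au: "A *v u i = (m $ i) *\<^sub>R u i" for i using assms by (simp add: eigenbasis_def)
  have "transpose P ** P = mat 1"
    using ou by (simp add: vec_eq_iff matrix_matrix_mult_def transpose_def P_def mat_def inner_vec_def)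
  then have "det (transpose P ** P) = 1" by simp
  then have dP: "det P \<noteq> 0" by (auto simp: det_mul)
  have "(mat t - A) ** P = P ** E"
  proof -
    have "((mat t - A) ** P) $ i $ j = (P ** E) $ i $ j" for i j
    proof -
      have "((mat t - A) ** P) $ i $ j = ((mat t - A) *v u j) $ i"
        by (simp add: matrix_matrix_mult_def matrix_vector_mult_def P_def)
      also have "(mat t - A) *v u j = (t - m $ j) *\<^sub>R u j"
      proof -
        have "mat t *v u j = t *\<^sub>R u j"
          by (simp add: vec_eq_iff matrix_vector_mult_def mat_def if_distrib[of "\<lambda>x. x * _"] cong: if_cong)
        then show ?thesis by (simp add: matrix_vector_mult_diff_rdistrib Au algebra_simps)
      qed
      also have "((t - m $ j) *\<^sub>R u j) $ i = (P ** E) $ i $ j"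
        by (simp add: matrix_matrix_mult_def P_def E_def if_distrib cong: if_cong)
      finally show ?thesis .
    qed
    then show ?thesis by (simp add: vec_eq_iff)
  qed
  then have "det (mat t - A) * det P = det P * det E" by (metis det_mul)
  then have "det (mat t - A) = det E" using dP by simp
  also have "det E = (\<Prod>i\<in>UNIV. t - m $ i)" by (subst det_diagonal) (auto simp: E_def)
  finally show ?thesis .
qed

lemma eigenbasis_trace:
  assumes "eigenbasis A u m"
  shows "trace A = (\<Sum>i\<in>UNIV. m $ i)"
proof -
  have ou: "u i \<bullet> u i = 1" for i using assms by (simp add: eigenbasis_def)
  have "trace A = (\<Sum>j\<in>UNIV. axis j 1 \<bullet> (A *v axis j 1))"
    by (simp add: trace_def inner_axis' matrix_vector_mult_basis column_def)
  also have "\<dots> = (\<Sum>j\<in>UNIV. \<Sum>i\<in>UNIV. m $ i * (u i $ j)\<^sup>2)"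
    by (simp add: eigenbasis_quadratic_form(1)[OF assms] inner_axis')
  also have "\<dots> = (\<Sum>i\<in>UNIV. m $ i * (\<Sum>j\<in>UNIV. (u i $ j)\<^sup>2))"
    by (subst sum.swap) (simp add: sum_distrib_left)
  also have "\<dots> = (\<Sum>i\<in>UNIV. m $ i)"
    using ou by (simp add: inner_vec_def power2_eq_square)
  finally show ?thesis .
qed

text \<open>Unique factorisation, in the form of a bijection between the roots.\<close>

lemma linear_factors_unique:
  fixes a :: "'i \<Rightarrow> real" and b :: "'j \<Rightarrow> real"
  assumes "finite I" "finite J" "(\<Prod>i\<in>I. [:- a i, 1:]) = (\<Prod>j\<in>J. [:- b j, 1:])"
  shows "\<exists>p. bij_betw p I J \<and> (\<forall>i\<in>I. b (p i) = a i)"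
  using assms
proof (induction I arbitrary: J rule: finite_induct)
  case empty
  have "J = {}"
  proof (rule ccontr)
    assume "J \<noteq> {}"
    then obtain j where "j \<in> J" by auto
    then have "poly (\<Prod>j\<in>J. [:- b j, 1:]) (b j) = 0"
      using empty.prems(1) by (auto simp: poly_prod intro!: prod_zero)
    moreover have "(\<Prod>j\<in>J. [:- b j, 1:]) = 1" using empty by simp
    ultimately show False by simp
  qed
  then show ?case by (auto simp: bij_betw_def)
next
  case (insert i I)
  have "poly (\<Prod>i\<in>insert i I. [:- a i, 1:]) (a i) = 0" using insert.hyps by (simp add: poly_prod)
  then have "poly (\<Prod>j\<in>J. [:- b j, 1:]) (a i) = 0" unfolding insert.prems(2) .
  then have "\<exists>j\<in>J. poly [:- b j, 1:] (a i) = 0"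
    by (simp only: poly_prod prod_zero_iff[OF insert.prems(1)])
  then obtain j where j: "j \<in> J" "b j = a i" by auto
  have "(\<Prod>j\<in>J. [:- b j, 1:]) = [:- a i, 1:] * (\<Prod>j\<in>J - {j}. [:- b j, 1:])"
    using j insert.prems(1) by (simp add: prod.remove)
  then have "[:- a i, 1:] * (\<Prod>i\<in>I. [:- a i, 1:]) = [:- a i, 1:] * (\<Prod>j\<in>J - {j}. [:- b j, 1:])"
    using insert by simp
  then have "(\<Prod>i\<in>I. [:- a i, 1:]) = (\<Prod>j\<in>J - {j}. [:- b j, 1:])"
    by (subst (asm) mult_cancel_left) auto
  from insert.IH[OF _ this] insert.prems(1) obtain p where
    p: "bij_betw p I (J - {j})" "\<forall>i\<in>I. b (p i) = a i" by auto
  let ?p = "p(i := j)"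
  have "bij_betw ?p (insert i I) (insert j (J - {j}))"
  proof -
    have "bij_betw ?p I (J - {j})"
      using p(1) insert.hyps(2) by (subst bij_betw_cong[of _ _ p]) auto
    then show ?thesis using notIn_Un_bij_betw[of i I ?p "J - {j}"] insert.hyps(2) by simp
  qed
  moreover have "insert j (J - {j}) = J" using j by auto
  ultimately have "bij_betw ?p (insert i I) J" by simp
  moreover have "\<forall>i'\<in>insert i I. b (?p i') = a i'" using p j insert.hyps by auto
  ultimately show ?case by blast
qed

lemma equal_char_polynomials_permute:
  fixes l m :: "real^'n"
  assumes "\<And>t. (\<Prod>i\<in>UNIV. t - l $ i) = (\<Prod>i\<in>UNIV. t - m $ i)"
  obtains p where "p permutes UNIV" "l = permute_coords p m"
proof -
  have "poly (\<Prod>i\<in>UNIV. [:- l $ i, 1:]) = poly (\<Prod>i\<in>UNIV. [:- m $ i, 1:])"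
    using assms by (auto simp: poly_prod fun_eq_iff)
  then have "(\<Prod>i\<in>UNIV. [:- l $ i, 1:]) = (\<Prod>i\<in>UNIV. [:- m $ i, 1:])" by (simp add: poly_eq_poly_eq_iff)
  from linear_factors_unique[OF _ _ this] obtain p :: "'n \<Rightarrow> 'n" where
    "bij p" "\<forall>i. m $ p i = l $ i" by auto
  then show ?thesis using that[of p] by (auto simp: permute_coords_def vec_eq_iff intro!: bij_imp_permutes)
qed


lemma matrix_inv_eqI:
  fixes A B :: "real^'n^'n"
  assumes "A ** B = mat 1"
  shows "matrix_inv A = B"
  unfolding matrix_inv_def
proof (rule some_equality)
  show "A ** B = mat 1 \<and> B ** A = mat 1" using assms matrix_left_right_inverse by blast
  show "C = B" if "A ** C = mat 1 \<and> C ** A = mat 1" for C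
    using that assms by (metis matrix_mul_assoc matrix_mul_lid matrix_mul_rid)
qed

lemma matrix_inv_mat_1: "matrix_inv (mat 1 :: real^'n^'n) = mat 1"
  by (rule matrix_inv_eqI) simp

text \<open>Translates eigenvalue lists given by the characteristic polynomial into orthonormal eigenvectors: any list
  is a permutation of the one from the spectral theorem, and the eigenvectors can be permuted along.\<close>

lemma eigenvalues_wrt_identity_iff:
  fixes A :: "real^'n^'n"
  assumes "transpose A = A"
  shows "eigenvalues_wrt (mat 1) A l \<longleftrightarrow> (\<exists>u. eigenbasis A u l)"
proof
  have det: "eigenvalues_wrt (mat 1) A l \<longleftrightarrow> (\<forall>t. det (mat t - A) = (\<Prod>i\<in>UNIV. t - l $ i))" for l
    by (simp add: eigenvalues_wrt_def matrix_inv_mat_1)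
  show "eigenvalues_wrt (mat 1) A l" if "\<exists>u. eigenbasis A u l"
    using that eigenbasis_det det by blast
  assume l: "eigenvalues_wrt (mat 1) A l"
  obtain u m where um: "eigenbasis A u m" using symmetric_matrix_eigenbasis[OF assms] .
  then obtain p where p: "p permutes UNIV" "l = permute_coords p m"
    using equal_char_polynomials_permute[of l m] l eigenbasis_det[OF um] unfolding det by metis
  have "eigenbasis A (u \<circ> p) l"
    using um p permutes_inj[OF p(1)] by (auto simp: eigenbasis_def permute_coords_def inj_def)
  then show "\<exists>u. eigenbasis A u l" by blast
qed

lemma eigenbasis_span_bound:
  assumes eb: "eigenbasis A u m" and x: "x \<in> span (u ` I)"
  shows "(\<And>i. i \<in> I \<Longrightarrow> m $ i \<le> c) \<Longrightarrow> x \<bullet> (A *v x) \<le> c * (x \<bullet> x)"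
    and "(\<And>i. i \<in> I \<Longrightarrow> m $ i \<ge> c) \<Longrightarrow> x \<bullet> (A *v x) \<ge> c * (x \<bullet> x)"
proof -
  have zero: "x \<bullet> u i = 0" if "i \<notin> I" for i
  proof -
    have "orthogonal (u i) y" if "y \<in> u ` I" for y
      using that eb \<open>i \<notin> I\<close> by (auto simp: eigenbasis_def orthogonal_def)
    from orthogonal_to_span[OF x this] show ?thesis by (simp add: orthogonal_def inner_commute)
  qed
  show "x \<bullet> (A *v x) \<le> c * (x \<bullet> x)" if "\<And>i. i \<in> I \<Longrightarrow> m $ i \<le> c"
    unfolding eigenbasis_quadratic_form[OF eb] sum_distrib_left
    by (rule sum_mono) (use that zero in \<open>metis mult_right_mono zero_le_power2 mult_zero_right power_zero_numeral order_refl\<close>)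
  show "x \<bullet> (A *v x) \<ge> c * (x \<bullet> x)" if "\<And>i. i \<in> I \<Longrightarrow> m $ i \<ge> c"
    unfolding eigenbasis_quadratic_form[OF eb] sum_distrib_left
    by (rule sum_mono) (use that zero in \<open>metis mult_right_mono zero_le_power2 mult_zero_right power_zero_numeral order_refl\<close>)
qed

lemma sorted_enumeration:
  fixes m :: "'n::finite \<Rightarrow> real"
  obtains e where "bij_betw e {..<CARD('n)} UNIV" "\<And>i j. i \<le> j \<Longrightarrow> j < CARD('n) \<Longrightarrow> m (e i) \<le> m (e j)"
proof -
  obtain xs :: "'n list" where xs: "set xs = UNIV" "distinct xs"
    using finite_distinct_list[OF finite] by blast
  define ys where "ys = sort_key m xs"
  have ys: "set ys = UNIV" "distinct ys" "sorted (map m ys)"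
    using xs by (auto simp: ys_def)
  have len: "length ys = CARD('n)" using ys distinct_card by force
  have "bij_betw (nth ys) {..<CARD('n)} UNIV"
    using bij_betw_nth[OF ys(2) len[symmetric, THEN arg_cong[where f=lessThan]] ys(1)[symmetric]] by simp
  moreover have "m (ys ! i) \<le> m (ys ! j)" if "i \<le> j" "j < CARD('n)" for i j
    using ys(3) that len sorted_nth_mono[of "map m ys" i j] by simp
  ultimately show ?thesis using that by blast
qed

text \<open>Weyl's inequality.  With both lists sorted, the span of the first \<open>j + 1\<close> eigenvectors of \<open>B\<close> and the span
  of the last \<open>n - j\<close> eigenvectors of \<open>A\<close> meet by dimension count, and a common vector compares
  the two eigenvalues of index \<open>j\<close>.\<close>

lemma weyl_monotonicity:
  fixes A B :: "real^'n^'n"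
  assumes A: "eigenbasis A u l" and B: "eigenbasis B v m"
    and le: "\<And>x. x \<bullet> (B *v x) \<ge> x \<bullet> (A *v x) - e * (x \<bullet> x)"
  obtains p where "p permutes UNIV" "\<And>i. m $ p i \<ge> l $ i - e"
proof -
  let ?n = "CARD('n)"
  obtain a where a: "bij_betw a {..<?n} (UNIV :: 'n set)" "\<And>i j. i \<le> j \<Longrightarrow> j < ?n \<Longrightarrow> l $ a i \<le> l $ a j"
    using sorted_enumeration[of "\<lambda>i. l $ i"] by blast
  obtain b where b: "bij_betw b {..<?n} (UNIV :: 'n set)" "\<And>i j. i \<le> j \<Longrightarrow> j < ?n \<Longrightarrow> m $ b i \<le> m $ b j"
    using sorted_enumeration[of "\<lambda>i. m $ i"] by blast
  have dimspan: "dim (span (w ` c ` I)) = card I"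
    if "eigenbasis D w r" "bij_betw c {..<?n} (UNIV :: 'n set)" "I \<subseteq> {..<?n}" for D :: "real^'n^'n" and w r c I
  proof -
    have inj: "inj w" by (rule eigenbasis_inj[OF that(1)])
    have "independent (w ` c ` I)" by (rule eigenbasis_independent[OF that(1)])
    then have "dim (span (w ` c ` I)) = card (w ` c ` I)" by (simp add: dim_eq_card_independent dim_span)
    also have "\<dots> = card I"
      using inj that(2,3) by (simp add: card_image inj_on_subset inj_on_def bij_betw_def subset_iff)
    finally show ?thesis .
  qed
  have key: "m $ b k \<ge> l $ a k - e" if k: "k < ?n" for k
  proof -
    let ?S = "span (v ` b ` {..k})" and ?T = "span (u ` a ` {k..<?n})"
    have "dim ?S = card {..k}" using k by (intro dimspan[OF B b(1)]) auto
    moreover have "dim ?T = card {k..<?n}" by (intro dimspan[OF A a(1)]) auto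
    moreover have "dim {x + y |x y. x \<in> ?S \<and> y \<in> ?T} + dim (?S \<inter> ?T) = dim ?S + dim ?T"
      by (rule dim_sums_Int) auto
    moreover have "dim {x + y |x y. x \<in> ?S \<and> y \<in> ?T} \<le> ?n"
      using dim_subset_UNIV[of "{x + y |x y. x \<in> ?S \<and> y \<in> ?T}"] by simp
    ultimately have "dim (?S \<inter> ?T) \<noteq> 0" using k by (simp del: dim_span dim_eq_0)
    then have "\<not> ?S \<inter> ?T \<subseteq> {0}" by (metis dim_eq_0)
    then obtain x where x: "x \<in> ?S" "x \<in> ?T" "x \<noteq> 0" by blast
    have "x \<bullet> (B *v x) \<le> (m $ b k) * (x \<bullet> x)"
      by (rule eigenbasis_span_bound(1)[OF B x(1)]) (use b k in auto)
    moreover have "x \<bullet> (A *v x) \<ge> (l $ a k) * (x \<bullet> x)"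
      by (rule eigenbasis_span_bound(2)[OF A x(2)]) (use a in auto)
    ultimately have "(l $ a k - e) * (x \<bullet> x) \<le> (m $ b k) * (x \<bullet> x)"
      using le[of x] by (simp add: algebra_simps)
    moreover have "x \<bullet> x > 0" using x by simp
    ultimately show ?thesis using mult_right_le_imp_le by blast
  qed
  define p where "p = b \<circ> inv_into {..<?n} a"
  have "bij_betw (inv_into {..<?n} a) UNIV {..<?n}" using a(1) by (rule bij_betw_inv_into)
  then have "bij p" unfolding p_def using b(1) bij_betw_trans by blast
  moreover have "m $ p i \<ge> l $ i - e" for i
  proof -
    have "inv_into {..<?n} a i < ?n" "a (inv_into {..<?n} a i) = i"
      using a(1) by (metis UNIV_I bij_betw_def inv_into_into lessThan_iff, metis UNIV_I bij_betw_def f_inv_into_f)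
    then show ?thesis using key[of "inv_into {..<?n} a i"] by (simp add: p_def)
  qed
  ultimately show ?thesis using that bij_imp_permutes[of p UNIV] by blast
qed


lemma eigenvalues_permute:
  fixes A :: "real^'n^'n"
  assumes "eigenbasis A u l" "eigenbasis A v m"
  obtains p where "p permutes UNIV" "l = permute_coords p m"
  using equal_char_polynomials_permute[of l m] eigenbasis_det[OF assms(1)] eigenbasis_det[OF assms(2)]
  by metis

text \<open>Eigenvalue lists of matrices in a compact set are bounded by the quadratic form, and being a list of
  eigenvalues is a closed condition on the characteristic polynomial.\<close>

lemma compact_eigenvalues:
  fixes X :: "(real^'n^'n) set"
  assumes X: "compact X" and sym: "\<And>A. A \<in> X \<Longrightarrow> transpose A = A"
  shows "compact {l :: real^'n. \<exists>A\<in>X. \<exists>u. eigenbasis A u l}" (is "compact ?L")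
proof -
  have "compact ((\<lambda>(A, x). x \<bullet> (A *v x)) ` (X \<times> sphere 0 1))"
    unfolding matrix_vector_mult_def case_prod_unfold
    by (intro compact_continuous_image compact_Times X continuous_intros) auto
  then obtain R where R: "\<And>A x. A \<in> X \<Longrightarrow> norm x = 1 \<Longrightarrow> norm (x \<bullet> (A *v x)) \<le> R"
    unfolding compact_eq_bounded_closed bounded_iff by fastforce
  let ?Z = "{z :: (real^'n^'n) \<times> (real^'n). \<forall>t. det (mat t - fst z) = (\<Prod>i\<in>UNIV. t - snd z $ i)}"
  have "closed ?Z"
    unfolding det_def by (intro closed_Collect_all closed_Collect_eq continuous_intros) 
  then have "compact ((X \<times> cball 0 (R * CARD('n))) \<inter> ?Z)" 
    using X by (intro compact_Int_closed compact_Times) auto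
  then have "compact (snd ` ((X \<times> cball 0 (R * CARD('n))) \<inter> ?Z))"
    by (intro compact_continuous_image continuous_intros)
  moreover have "snd ` ((X \<times> cball 0 (R * CARD('n))) \<inter> ?Z) = ?L"
  proof safe
    fix A :: "real^'n^'n" and l :: "real^'n" assume A: "A \<in> X" and Z: "\<forall>t. det (mat t - fst (A, l)) = (\<Prod>i\<in>UNIV. t - snd (A, l) $ i)"
    then have "eigenvalues_wrt (mat 1) A l"
      by (simp add: eigenvalues_wrt_def matrix_inv_mat_1)
    then show "\<exists>B\<in>X. \<exists>u. eigenbasis B u (snd (A, l))"
      using A eigenvalues_wrt_identity_iff[OF sym[OF A]] by auto
  next
    fix l A u assume A: "A \<in> X" and u: "eigenbasis A u l"
    have "\<bar>l $ i\<bar> \<le> R" for i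
    proof -
      have "norm (u i) = 1" "u i \<bullet> (A *v u i) = l $ i"
        using u by (auto simp: eigenbasis_def norm_eq_sqrt_inner)
      then show ?thesis using R[OF A, of "u i"] by simp
    qed
    then have "norm l \<le> R * CARD('n)"
      using norm_le_l1_cart[of l] sum_mono[of UNIV "\<lambda>i. \<bar>l $ i\<bar>" "\<lambda>_. R"] by (simp add: mult.commute)
    then have "(A, l) \<in> (X \<times> cball 0 (R * CARD('n))) \<inter> ?Z"
      using A eigenbasis_det[OF u] by simp
    then show "l \<in> snd ` ((X \<times> cball 0 (R * CARD('n))) \<inter> ?Z)" by force
  qed
  ultimately show ?thesis by simp
qed

lemma derivative_in_coordinates:
  fixes f :: "real^'n \<Rightarrow> real"
  assumes "(f has_derivative D) (at l)"
  shows "D d = (\<Sum>i\<in>UNIV. d $ i * partial i f l)"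
proof -
  have D: "D = frechet_derivative f (at l)" using frechet_derivative_at[OF assms] .
  have lin: "linear D" using assms by (rule has_derivative_linear)
  have "D d = D (\<Sum>i\<in>UNIV. d $ i *\<^sub>R axis i 1)"
    using basis_expansion[of d] by (simp add: scalar_mult_eq_scaleR)
  also have "\<dots> = (\<Sum>i\<in>UNIV. d $ i * D (axis i 1))"
    by (simp add: linear_sum[OF lin] linear_cmul[OF lin])
  finally show ?thesis unfolding partial_def D[symmetric] .
qed

text \<open>What remains of \<open>f(\<lambda>(B)) \<le> f(\<lambda>(A))\<close> for an elliptic operator, with \<open>C\<close> governed by the ratio of its
  ellipticity constants.  It is the only form in which the equation enters the comparison argument.\<close>

definition ellipticity_bound :: "real \<Rightarrow> real^'n^'n \<Rightarrow> real^'n^'n \<Rightarrow> bool" where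
  "ellipticity_bound C A B \<longleftrightarrow>
     (\<forall>e\<ge>0. (\<forall>x. x \<bullet> (B *v x) \<ge> x \<bullet> (A *v x) - e * (x \<bullet> x)) \<longrightarrow> trace B - trace A \<le> C * e)"

text \<open>By Weyl's inequality the eigenvalues of \<open>B\<close>, suitably ordered, are those of \<open>A\<close> plus \<open>d\<close> with
  \<open>d $ i \<ge> - e\<close>, and the sum of the \<open>d $ i\<close> is the difference of the traces.  On the
  segment between the two lists the partial derivatives of \<open>f\<close> lie between some \<open>a > 0\<close> and \<open>b\<close>, because the segment stays in
  the convex hull of a compact subset of \<open>G\<close>, which is compact and contained in \<open>G\<close>.  Hence a
  trace difference above \<open>n b e / a\<close> would make \<open>f\<close> grow.\<close>

lemma uniform_ellipticity:
  fixes G :: "(real^'n) set" and f :: "real^'n \<Rightarrow> real" and X :: "(real^'n^'n) set"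
  assumes G: "open G" "convex G" "symmetric_set G"
    and f: "C1_open G f" "symmetric_fun_on G f" "\<And>l i. l \<in> G \<Longrightarrow> partial i f l > 0"
    and X: "compact X" "\<And>A. A \<in> X \<Longrightarrow> transpose A = A"
      "\<And>A. A \<in> X \<Longrightarrow> \<exists>u l. eigenbasis A u l \<and> l \<in> G"
  obtains C where "C \<ge> 0"
    "\<And>A B u v l m. A \<in> X \<Longrightarrow> B \<in> X \<Longrightarrow> eigenbasis A u l \<Longrightarrow> eigenbasis B v m \<Longrightarrow> f m \<le> f l \<Longrightarrow>
       ellipticity_bound C A B"
proof -
  define L where "L = {l. \<exists>A\<in>X. \<exists>u. eigenbasis A u l}"
  define Q where "Q = convex hull L"
  have LG: "L \<subseteq> G"
  proof
    fix l assume "l \<in> L"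
    then obtain A u where A: "A \<in> X" and u: "eigenbasis A u l" unfolding L_def by auto
    obtain v m where "eigenbasis A v m" "m \<in> G" using X(3)[OF A] by auto
    then show "l \<in> G" using eigenvalues_permute[OF u] G(3) unfolding symmetric_set_def by metis
  qed
  have QG: "Q \<subseteq> G" unfolding Q_def using LG G(2) by (simp add: hull_minimal)
  have Qc: "compact Q" unfolding Q_def L_def by (intro compact_convex_hull compact_eigenvalues X)
  obtain F' :: "real^'n \<Rightarrow> (real^'n) \<Rightarrow>\<^sub>L real" where
    F': "\<And>l. l \<in> G \<Longrightarrow> (f has_derivative blinfun_apply (F' l)) (at l)" "continuous_on G F'"
    using f(1) unfolding C1_open_def by blast
  have pF: "partial i f l = blinfun_apply (F' l) (axis i 1)" if "l \<in> G" for i l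
    using frechet_derivative_at[OF F'(1)[OF that]] by (simp add: partial_def)
  have cont: "continuous_on Q (partial i f)" for i
  proof -
    have "continuous_on Q (\<lambda>l. blinfun_apply (F' l) (axis i 1))"
      by (intro continuous_intros continuous_on_subset[OF F'(2) QG])
    then show ?thesis using pF QG by (subst continuous_on_cong[OF refl]) auto
  qed
  have "\<exists>c C. 0 < c \<and> (\<forall>l\<in>Q. c \<le> partial i f l \<and> partial i f l \<le> C)" for i
  proof (cases "Q = {}")
    case False
    obtain a where "a \<in> Q" "\<forall>l\<in>Q. partial i f a \<le> partial i f l"
      using continuous_attains_inf[OF Qc False cont] by blast
    moreover obtain b where "b \<in> Q" "\<forall>l\<in>Q. partial i f l \<le> partial i f b"
      using continuous_attains_sup[OF Qc False cont] by blast
    ultimately show ?thesis using f(3) QG by blast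
  qed (auto intro: exI[of _ 1])
  then obtain c C where cC: "\<And>i. 0 < c i" "\<And>i l. l \<in> Q \<Longrightarrow> c i \<le> partial i f l \<and> partial i f l \<le> C i"
    by metis
  define a where "a = Min (range c)"
  define b where "b = Max (insert 0 (range C))"
  have a: "0 < a" unfolding a_def using cC(1) by simp
  have ab: "a \<le> partial i f l" "partial i f l \<le> b" "0 \<le> b" if "l \<in> Q" for i l
    unfolding a_def b_def using cC(2)[OF that, of i]
    by (auto simp: Min_le_iff intro!: max.coboundedI2 intro: order_trans[OF _ Max_ge])
  have b: "0 \<le> b" unfolding b_def by simp
  show ?thesis
  proof (rule that[of "CARD('n) * b / a"])
    show "CARD('n) * b / a \<ge> 0" using a b by simp
    fix A B u v l m
    assume AB: "A \<in> X" "B \<in> X" and u: "eigenbasis A u l" and v: "eigenbasis B v m" and fle: "f m \<le> f l"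
    show "ellipticity_bound (CARD('n) * b / a) A B"
      unfolding ellipticity_bound_def
    proof (intro allI impI, rule ccontr)
      fix e :: real
      assume e: "0 \<le> e" and "\<forall>x. x \<bullet> (B *v x) \<ge> x \<bullet> (A *v x) - e * (x \<bullet> x)"
        and "\<not> trace B - trace A \<le> CARD('n) * b / a * e"
      then have le: "\<And>x. x \<bullet> (B *v x) \<ge> x \<bullet> (A *v x) - e * (x \<bullet> x)"
        and tr: "trace B - trace A > CARD('n) * b / a * e" by auto
      obtain p where p: "p permutes UNIV" "\<And>i. m $ p i \<ge> l $ i - e"
        using weyl_monotonicity[OF u v le] by blast
      define m' where "m' = permute_coords p m"
      have l: "l \<in> L" and mL: "m \<in> L" using AB u v unfolding L_def by auto
      have "eigenbasis B (v \<circ> p) m'"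
        using v p permutes_inj[OF p(1)] by (auto simp: eigenbasis_def permute_coords_def m'_def inj_def)
      then have m': "m' \<in> L" using AB unfolding L_def by auto
      have fm: "f m' = f m" using f(2) p(1) mL LG unfolding symmetric_fun_on_def m'_def by blast
      define d where "d = m' - l"
      have d: "d $ i \<ge> - e" for i using p(2)[of i] by (simp add: d_def m'_def permute_coords_def)
      have "(\<Sum>i\<in>UNIV. m' $ i) = (\<Sum>i\<in>UNIV. m $ i)"
        unfolding m'_def permute_coords_def using sum.permute[OF p(1), where g="\<lambda>i. m $ i"] by (simp add: o_def)
      then have sd: "(\<Sum>i\<in>UNIV. d $ i) = trace B - trace A"
        by (simp add: d_def sum_subtractf eigenbasis_trace[OF u] eigenbasis_trace[OF v])
      have seg: "l + t *\<^sub>R d \<in> Q" if "0 \<le> t" "t \<le> 1" for t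
      proof -
        have "(1 - t) *\<^sub>R l + t *\<^sub>R m' \<in> Q"
          unfolding Q_def by (rule convexD_alt[OF convex_convex_hull]) (use l m' that in \<open>auto simp: hull_inc\<close>)
        then show ?thesis by (simp add: d_def algebra_simps)
      qed
      have "((\<lambda>t. f (l + t *\<^sub>R d)) has_derivative (\<lambda>h. F' (l + t *\<^sub>R d) (h *\<^sub>R d))) (at t within {0..1})"
        if "0 \<le> t" "t \<le> 1" for t
        by (rule has_derivative_compose[where g=f, OF _ F'(1)]) (use seg[OF that] QG in \<open>auto intro!: derivative_eq_intros\<close>)
      from mvt_very_simple[OF zero_le_one this] obtain t where t: "t \<in> {0..1}" and
        "f (l + 1 *\<^sub>R d) - f (l + 0 *\<^sub>R d) = F' (l + t *\<^sub>R d) ((1 - 0) *\<^sub>R d)" by auto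
      then have eq: "f m - f l = F' (l + t *\<^sub>R d) d" by (simp add: d_def fm)
      define z where "z = l + t *\<^sub>R d"
      have z: "z \<in> Q" using seg t by (simp add: z_def)
      have "f m - f l = (\<Sum>i\<in>UNIV. d $ i * partial i f z)"
        unfolding eq z_def[symmetric] using z QG F'(1) derivative_in_coordinates by blast
      also have "\<dots> \<ge> (\<Sum>i\<in>UNIV. (d $ i + e) * a - e * b)"
      proof (rule sum_mono)
        fix i
        have "(d $ i + e) * a \<le> (d $ i + e) * partial i f z" using d[of i] ab(1)[OF z, of i] by (intro mult_left_mono) auto
        moreover have "e * partial i f z \<le> e * b" using e ab(2)[OF z, of i] by (intro mult_left_mono) auto
        ultimately show "(d $ i + e) * a - e * b \<le> d $ i * partial i f z" by (simp add: algebra_simps)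
      qed
      also have "(\<Sum>i\<in>UNIV. (d $ i + e) * a - e * b) = (\<Sum>i\<in>UNIV. d $ i) * a + CARD('n) * e * a - CARD('n) * e * b"
        by (simp add: sum_subtractf sum.distrib sum_distrib_left algebra_simps)
      finally have "f m - f l \<ge> (trace B - trace A) * a + CARD('n) * e * a - CARD('n) * e * b" by (simp add: sd)
      moreover have "(trace B - trace A) * a > CARD('n) * b * e" using tr a by (simp add: field_simps)
      moreover have "CARD('n) * e * a \<ge> 0" using a e by simp
      ultimately have "f l < f m" by (simp add: algebra_simps)
      then show False using fle by simp
    qed
  qed
qed

section \<open>Gradients, Hessians and the conformal Hessian\<close>

text \<open>For open \<open>W\<close> this is the class \<open>C\<^sup>2\<close> with named derivatives.  Symmetry of the Hessian is part of the notion
  because the spectral theorem is applied to matrices built from it.\<close>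

definition has_grad_hess ::
  "(real^'n) set \<Rightarrow> (real^'n \<Rightarrow> real) \<Rightarrow> (real^'n \<Rightarrow> real^'n) \<Rightarrow> (real^'n \<Rightarrow> real^'n^'n) \<Rightarrow> bool" where
  "has_grad_hess W s g H \<longleftrightarrow>
     (\<forall>y\<in>W. (s has_derivative (\<lambda>h. g y \<bullet> h)) (at y) \<and> (g has_derivative (\<lambda>h. H y *v h)) (at y) \<and>
        transpose (H y) = H y) \<and> continuous_on W H"

lemma has_grad_hessD:
  assumes "has_grad_hess W s g H" "y \<in> W"
  shows "(s has_derivative (\<lambda>h. g y \<bullet> h)) (at y)" "(g has_derivative (\<lambda>h. H y *v h)) (at y)"
    "transpose (H y) = H y"
  using assms by (auto simp: has_grad_hess_def)

lemma has_grad_hess_continuous: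
  assumes "has_grad_hess W s g H"
  shows "continuous_on W s" "continuous_on W g" "continuous_on W H"
  using assms has_derivative_continuous[OF has_grad_hessD(1)[OF assms]]
    has_derivative_continuous[OF has_grad_hessD(2)[OF assms]]
  by (auto simp: continuous_on_eq_continuous_within has_grad_hess_def intro: continuous_at_imp_continuous_at_within)

lemma has_grad_hess_subset:
  "has_grad_hess W s g H \<Longrightarrow> V \<subseteq> W \<Longrightarrow> has_grad_hess V s g H"
  by (auto simp: has_grad_hess_def intro: continuous_on_subset)

lemma transpose_diff: "transpose (A - B) = transpose A - transpose (B :: 'a::ab_group_add^'n^'m)"
  and transpose_add: "transpose (A + B) = transpose A + transpose (B :: 'a::ab_group_add^'n^'m)"
  and transpose_scaleR: "transpose (c *\<^sub>R M) = c *\<^sub>R transpose (M :: real^'n^'m)"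
  by (simp_all add: transpose_def vec_eq_iff)

lemma has_grad_hess_diff:
  assumes "has_grad_hess W s g H" "has_grad_hess W t q K"
  shows "has_grad_hess W (\<lambda>y. s y - t y) (\<lambda>y. g y - q y) (\<lambda>y. H y - K y)"
  using assms unfolding has_grad_hess_def
  by (auto intro!: derivative_eq_intros continuous_intros
      simp: inner_diff_left matrix_vector_mult_diff_rdistrib transpose_diff)

lemma has_grad_hess_cmult:
  assumes "has_grad_hess W s g H"
  shows "has_grad_hess W (\<lambda>y. c * s y) (\<lambda>y. c *\<^sub>R g y) (\<lambda>y. c *\<^sub>R H y)"
  using assms unfolding has_grad_hess_def
  by (auto intro!: derivative_eq_intros continuous_intros
      simp: scaleR_matrix_vector_assoc[symmetric] transpose_scaleR)

definition outer :: "real^'n \<Rightarrow> real^'n \<Rightarrow> real^'n^'n" where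
  "outer a b = (\<chi> i j. a $ i * b $ j)"

lemma outer_mult: "outer a b *v x = (b \<bullet> x) *\<^sub>R a"
  by (simp add: outer_def vec_eq_iff matrix_vector_mult_def inner_vec_def sum_distrib_left sum_distrib_right ac_simps)

lemma transpose_outer: "transpose (outer a b) = outer b a"
  by (simp add: outer_def transpose_def vec_eq_iff)

lemma continuous_on_outer [continuous_intros]:
  "continuous_on W f \<Longrightarrow> continuous_on W g \<Longrightarrow> continuous_on W (\<lambda>y. outer (f y) (g y))"
  unfolding outer_def by (intro continuous_intros)

lemma has_grad_hess_mult:
  assumes s: "has_grad_hess W s g H" and t: "has_grad_hess W t q K"
  shows "has_grad_hess W (\<lambda>y. s y * t y) (\<lambda>y. s y *\<^sub>R q y + t y *\<^sub>R g y)
           (\<lambda>y. s y *\<^sub>R K y + t y *\<^sub>R H y + outer (q y) (g y) + outer (g y) (q y))"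
  using assms has_grad_hess_continuous[OF s] has_grad_hess_continuous[OF t] unfolding has_grad_hess_def
  by (auto intro!: derivative_eq_intros continuous_intros
      simp: scaleR_matrix_vector_assoc[symmetric] transpose_scaleR transpose_add transpose_outer
        matrix_vector_mult_add_rdistrib outer_mult inner_add_left algebra_simps)

lemma has_grad_hess_compose_real:
  assumes s: "has_grad_hess W s g H"
    and p: "\<And>y. y \<in> W \<Longrightarrow> (p has_real_derivative p' (s y)) (at (s y))"
      "\<And>y. y \<in> W \<Longrightarrow> (p' has_real_derivative p'' (s y)) (at (s y))"
    and c: "continuous_on (s ` W) p''"
  shows "has_grad_hess W (\<lambda>y. p (s y)) (\<lambda>y. p' (s y) *\<^sub>R g y)
           (\<lambda>y. p' (s y) *\<^sub>R H y + p'' (s y) *\<^sub>R outer (g y) (g y))"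
proof -
  have D: "((\<lambda>y. p (s y)) has_derivative (\<lambda>h. (p' (s y) *\<^sub>R g y) \<bullet> h)) (at y)"
    "((\<lambda>y. p' (s y)) has_derivative (\<lambda>h. p'' (s y) * (g y \<bullet> h))) (at y)" if "y \<in> W" for y
    using has_derivative_compose[OF has_grad_hessD(1)[OF s that] p(1)[OF that, unfolded has_field_derivative_def]]
      has_derivative_compose[OF has_grad_hessD(1)[OF s that] p(2)[OF that, unfolded has_field_derivative_def]]
    by (simp_all only: inner_scaleR_left)
  have 2: "((\<lambda>y. p' (s y) *\<^sub>R g y) has_derivative
      (\<lambda>h. (p' (s y) *\<^sub>R H y + p'' (s y) *\<^sub>R outer (g y) (g y)) *v h)) (at y)" if "y \<in> W" for y
    using D(2)[OF that] has_grad_hessD(2)[OF s that]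
    by (auto intro!: derivative_eq_intros
        simp: scaleR_matrix_vector_assoc[symmetric] matrix_vector_mult_add_rdistrib outer_mult algebra_simps)
  have cp': "continuous_on W (\<lambda>y. p' (s y))"
    using has_derivative_continuous[OF D(2)]
    by (auto simp: continuous_on_eq_continuous_within intro: continuous_at_imp_continuous_at_within)
  have cp'': "continuous_on W (\<lambda>y. p'' (s y))"
    using continuous_on_compose2[OF c has_grad_hess_continuous(1)[OF s]] by auto
  show ?thesis
    unfolding has_grad_hess_def
  proof (intro conjI ballI)
    show "((\<lambda>y. p (s y)) has_derivative (\<lambda>h. (p' (s y) *\<^sub>R g y) \<bullet> h)) (at y)" if "y \<in> W" for y
      by (rule D(1)[OF that])
    show "continuous_on W (\<lambda>y. p' (s y) *\<^sub>R H y + p'' (s y) *\<^sub>R outer (g y) (g y))"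
      using cp' cp'' has_grad_hess_continuous[OF s] by (intro continuous_intros)
  qed (auto simp: 2 has_grad_hessD(3)[OF s] transpose_scaleR transpose_add transpose_outer)
qed

lemma mat_mult_vector: "mat c *v (x :: real^'n) = c *\<^sub>R x"
  by (simp add: vec_eq_iff matrix_vector_mult_def mat_def if_distrib[of "\<lambda>x. x * _"] cong: if_cong)

lemma has_grad_hess_norm_square:
  "has_grad_hess W (\<lambda>y. (norm (y - a))\<^sup>2) (\<lambda>y. 2 *\<^sub>R (y - a)) (\<lambda>y. mat 2)"
  unfolding has_grad_hess_def power2_norm_eq_inner
  by (auto intro!: derivative_eq_intros simp: mat_mult_vector transpose_mat inner_commute inner_diff_left inner_diff_right algebra_simps)

lemma has_grad_hess_affine:
  "has_grad_hess W (\<lambda>y. c + y $ k) (\<lambda>y. axis k 1) (\<lambda>y. 0)"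
  unfolding has_grad_hess_def
  by (auto intro!: derivative_eq_intros bounded_linear.has_derivative[OF bounded_linear_vec_nth]
      simp: inner_axis' transpose_def vec_eq_iff)

text \<open>The factor \<open>c\<close> is the one that leaves the conformal Hessian unchanged: the gradient is merely transported, and the factors
  \<open>c\<close> and \<open>1/c\<close> in front of the function and the Hessian cancel.\<close>

lemma has_grad_hess_rescale:
  assumes s: "has_grad_hess W t g H" and c: "c > 0"
  shows "has_grad_hess {y. y /\<^sub>R c \<in> W} (\<lambda>y. c * t (y /\<^sub>R c)) (\<lambda>y. g (y /\<^sub>R c)) (\<lambda>y. inverse c *\<^sub>R H (y /\<^sub>R c))"
proof -
  have L: "((\<lambda>y. y /\<^sub>R c) has_derivative (\<lambda>h. h /\<^sub>R c)) (at y)" for y :: "real^'n"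
    by (auto intro!: derivative_eq_intros)
  have "((\<lambda>y. c * t (y /\<^sub>R c)) has_derivative (\<lambda>h. g (y /\<^sub>R c) \<bullet> h)) (at y)"
    "((\<lambda>y. g (y /\<^sub>R c)) has_derivative (\<lambda>h. (inverse c *\<^sub>R H (y /\<^sub>R c)) *v h)) (at y)"
    if "y /\<^sub>R c \<in> W" for y
  proof -
    show "((\<lambda>y. c * t (y /\<^sub>R c)) has_derivative (\<lambda>h. g (y /\<^sub>R c) \<bullet> h)) (at y)"
      using has_derivative_mult_right[OF has_derivative_compose[OF L has_grad_hessD(1)[OF s that]], of c] c
      by (simp add: mult.assoc[symmetric] cong: if_cong)
    show "((\<lambda>y. g (y /\<^sub>R c)) has_derivative (\<lambda>h. (inverse c *\<^sub>R H (y /\<^sub>R c)) *v h)) (at y)"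
      using has_derivative_compose[OF L has_grad_hessD(2)[OF s that]]
      by (simp add: matrix_vector_mult_scaleR scaleR_matrix_vector_assoc[symmetric])
  qed
  then show ?thesis
    using has_grad_hessD(3)[OF s] has_grad_hess_continuous(3)[OF s]
    unfolding has_grad_hess_def
    by (auto intro!: continuous_intros continuous_on_compose2[of W H] simp: transpose_scaleR)
qed

lemma norm_matrix_vector_mult_le: "norm ((A :: real^'n^'m) *v x) \<le> norm A * norm x"
proof -
  have "norm ((A *v x) $ i) \<le> norm (A $ i) * norm x" for i
    by (simp add: matrix_vector_mul_component Cauchy_Schwarz_ineq2)
  then have "norm (A *v x) \<le> L2_set (\<lambda>i. norm (A $ i) * norm x) UNIV"
    unfolding norm_vec_def[of "A *v x"] by (intro L2_set_mono) auto
  also have "\<dots> = norm A * norm x"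
    by (simp add: norm_vec_def[of A] L2_set_left_distrib)
  finally show ?thesis .
qed

text \<open>For the metric \<open>r\<^sup>-\<^sup>2 |dx|\<^sup>2\<close> with gradient \<open>q\<close> and Hessian \<open>A\<close> of \<open>r\<close>, this is the Schouten tensor with
  one index raised.\<close>

definition conformal_hessian :: "real \<Rightarrow> real^'n \<Rightarrow> real^'n^'n \<Rightarrow> real^'n^'n" where
  "conformal_hessian r q A = r *\<^sub>R A - mat (q \<bullet> q / 2)"

lemma conformal_hessian_form:
  "x \<bullet> (conformal_hessian r q A *v x) = r * (x \<bullet> (A *v x)) - (q \<bullet> q) / 2 * (x \<bullet> x)"
  by (simp add: conformal_hessian_def matrix_vector_mult_diff_rdistrib scaleR_matrix_vector_assoc[symmetric]
      mat_mult_vector inner_diff_right)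

lemma transpose_conformal_hessian: "transpose A = A \<Longrightarrow> transpose (conformal_hessian r q A) = conformal_hessian r q A"
  by (simp add: conformal_hessian_def transpose_diff transpose_scaleR transpose_mat)

lemma continuous_on_mat [continuous_intros]:
  "continuous_on W f \<Longrightarrow> continuous_on W (\<lambda>y. mat (f y) :: real^'n^'n)"
  unfolding mat_def
proof (intro continuous_intros)
  show "continuous_on W (\<lambda>x. if i = j then f x else 0)" if "continuous_on W f" for i j :: 'n
    using that by (cases "i = j") auto
qed

lemma continuous_on_conformal_hessian [continuous_intros]:
  "continuous_on W r \<Longrightarrow> continuous_on W q \<Longrightarrow> continuous_on W A \<Longrightarrow>
   continuous_on W (\<lambda>y. conformal_hessian (r y) (q y) (A y :: real^'n^'n))"
  unfolding conformal_hessian_def by (auto intro!: continuous_intros)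

lemma trace_eq_sum_form: "trace A = (\<Sum>i\<in>UNIV. axis i 1 \<bullet> (A *v axis i (1::real)))"
  by (simp add: trace_def inner_axis' matrix_vector_mult_basis column_def)

lemma min_along_ray_derivative:
  fixes f :: "real^'n \<Rightarrow> real"
  assumes "(f has_derivative D) (at y)" "\<delta> > 0" "\<And>t. 0 < t \<Longrightarrow> t < \<delta> \<Longrightarrow> f y \<le> f (y + t *\<^sub>R x)"
  shows "D x \<ge> 0"
proof (rule ccontr)
  assume neg: "\<not> D x \<ge> 0"
  have lin: "linear D" using assms(1) by (rule has_derivative_linear)
  have "((\<lambda>t. f (y + t *\<^sub>R x)) has_derivative (\<lambda>t. D (t *\<^sub>R x))) (at 0)"
    by (rule has_derivative_compose[where g=f]) (use assms(1) in \<open>auto intro!: derivative_eq_intros\<close>)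
  then have "((\<lambda>t. f (y + t *\<^sub>R x)) has_real_derivative D x) (at 0)"
    by (simp add: has_field_derivative_def linear_cmul[OF lin] mult_commute_abs)
  from DERIV_neg_dec_right[OF this] neg obtain d where d: "d > 0" "\<And>h. 0 < h \<Longrightarrow> h < d \<Longrightarrow> f (y + (0 + h) *\<^sub>R x) < f (y + 0 *\<^sub>R x)"
    by auto
  define e where "e = min d \<delta> / 2"
  have "0 < e" "e < d" "e < \<delta>" using d(1) assms(2) by (auto simp: e_def min_def)
  then show False using d(2)[of e] assms(3)[of e] by auto
qed

text \<open>Both facts are read off along lines through the minimum point.\<close>

lemma local_min_grad_hess:
  assumes W: "open W" "has_grad_hess W f g H" and y: "y \<in> W" and min: "\<And>z. z \<in> W \<Longrightarrow> f y \<le> f z"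
  shows "g y = 0" and "x \<bullet> (H y *v x) \<ge> 0"
proof -
  have ray: "\<exists>\<delta>>0. \<forall>t. \<bar>t\<bar> < \<delta> \<longrightarrow> y + t *\<^sub>R x \<in> W" for x
  proof -
    have "open ((\<lambda>t. y + t *\<^sub>R x) -` W)" by (intro continuous_open_vimage W continuous_intros)
    moreover have "0 \<in> (\<lambda>t. y + t *\<^sub>R x) -` W" using y by simp
    ultimately obtain e where e: "e > 0" "ball 0 e \<subseteq> (\<lambda>t. y + t *\<^sub>R x) -` W"
      unfolding open_contains_ball by blast
    have "y + t *\<^sub>R x \<in> W" if "\<bar>t\<bar> < e" for t using subsetD[OF e(2), of t] that by simp
    then show ?thesis using e(1) by blast
  qed
  have ge: "g y \<bullet> x \<ge> 0" for x
    using ray[of x] min_along_ray_derivative[OF has_grad_hessD(1)[OF W(2) y]] min by (metis abs_of_pos)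
  have "g y \<bullet> g y \<le> 0" using ge[of "- g y"] by simp
  then show g0: "g y = 0" by (metis inner_eq_zero_iff inner_ge_zero order_antisym)
  show "x \<bullet> (H y *v x) \<ge> 0"
  proof (rule ccontr)
    assume neg: "\<not> x \<bullet> (H y *v x) \<ge> 0"
    obtain \<delta> where \<delta>: "\<delta> > 0" "\<And>t. \<bar>t\<bar> < \<delta> \<Longrightarrow> y + t *\<^sub>R x \<in> W" using ray by blast
    have 1: "((\<lambda>z. g z \<bullet> x) has_derivative (\<lambda>h. (H y *v h) \<bullet> x)) (at (y + 0 *\<^sub>R x))"
      using has_derivative_inner_left[OF has_grad_hessD(2)[OF W(2) y]] by simp
    have 2: "((\<lambda>t. y + t *\<^sub>R x) has_derivative (\<lambda>t. t *\<^sub>R x)) (at 0)"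
      by (auto intro!: derivative_eq_intros)
    have "((\<lambda>t. g (y + t *\<^sub>R x) \<bullet> x) has_derivative (\<lambda>t. (H y *v (t *\<^sub>R x)) \<bullet> x)) (at 0)"
      by (rule has_derivative_compose[OF 2 1])
    then have "((\<lambda>t. g (y + t *\<^sub>R x) \<bullet> x) has_real_derivative x \<bullet> (H y *v x)) (at 0)"
      by (simp add: has_field_derivative_def matrix_vector_mult_scaleR inner_commute mult_commute_abs)
    from DERIV_neg_dec_right[OF this] neg g0 obtain d where
      d: "d > 0" "\<And>h. 0 < h \<Longrightarrow> h < d \<Longrightarrow> g (y + h *\<^sub>R x) \<bullet> x < 0" by auto
    define e where "e = min d \<delta> / 2"
    have e: "0 < e" "e < d" "e < \<delta>" using d(1) \<delta>(1) by (auto simp: e_def min_def)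
    have "((\<lambda>t. f (y + t *\<^sub>R x)) has_real_derivative g (y + t *\<^sub>R x) \<bullet> x) (at t)" if "0 \<le> t" "t \<le> e" for t
    proof -
      have "y + t *\<^sub>R x \<in> W" using that e \<delta>(2) by auto
      from has_grad_hessD(1)[OF W(2) this]
      have "((\<lambda>t. f (y + t *\<^sub>R x)) has_derivative (\<lambda>h. g (y + t *\<^sub>R x) \<bullet> (h *\<^sub>R x))) (at t)"
        by (rule has_derivative_compose[rotated]) (auto intro!: derivative_eq_intros)
      then show ?thesis by (simp add: has_field_derivative_def mult_commute_abs)
    qed
    from MVT2[OF e(1) this] obtain z where "0 < z" "z < e"
      "f (y + e *\<^sub>R x) - f (y + 0 *\<^sub>R x) = (e - 0) * (g (y + z *\<^sub>R x) \<bullet> x)" by blast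
    moreover have "f y \<le> f (y + e *\<^sub>R x)" using min \<delta>(2)[of e] e by auto
    ultimately show False using d(2)[of z] e mult_pos_neg[of e "g (y + z *\<^sub>R x) \<bullet> x"] by auto
  qed
qed

section \<open>Symmetry of the Hessian and composition with smooth maps\<close>

text \<open>Applying the mean value theorem to the second difference first in the direction \<open>a\<close> and then in the direction \<open>b\<close> leaves
  the mixed second derivative at a nearby point; the left-hand side is symmetric in \<open>a\<close> and \<open>b\<close>.\<close>

lemma second_difference_mean_value:
  fixes f :: "real^'n \<Rightarrow> real"
  assumes W: "open W" "ball y e \<subseteq> W"
    and f: "\<And>y. y \<in> W \<Longrightarrow> (f has_derivative (\<lambda>h. g y \<bullet> h)) (at y)"
    and g: "\<And>y. y \<in> W \<Longrightarrow> (g has_derivative (\<lambda>h. H y *v h)) (at y)"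
    and t: "t > 0" "t * (norm a + norm b) < e"
  obtains z where "dist z y \<le> t * (norm a + norm b)"
    "f (y + t *\<^sub>R a + t *\<^sub>R b) - f (y + t *\<^sub>R a) - f (y + t *\<^sub>R b) + f y = t\<^sup>2 * ((H z *v b) \<bullet> a)"
proof -
  \<comment> \<open>the whole parallelogram lies in the ball\<close>
  have near: "y + s *\<^sub>R a + r *\<^sub>R b \<in> W \<and> dist (y + s *\<^sub>R a + r *\<^sub>R b) y \<le> t * (norm a + norm b)"
    if "0 \<le> s" "s \<le> t" "0 \<le> r" "r \<le> t" for s r
  proof -
    have "norm (s *\<^sub>R a + r *\<^sub>R b) \<le> s * norm a + r * norm b"
      using norm_triangle_ineq[of "s *\<^sub>R a" "r *\<^sub>R b"] that by simp
    also have "\<dots> \<le> t * norm a + t * norm b" using that by (intro add_mono mult_right_mono) auto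
    finally have "norm (s *\<^sub>R a + r *\<^sub>R b) \<le> t * (norm a + norm b)" by (simp add: algebra_simps)
    then have d: "dist (y + s *\<^sub>R a + r *\<^sub>R b) y \<le> t * (norm a + norm b)" by (simp add: dist_norm add.assoc)
    then have "y + s *\<^sub>R a + r *\<^sub>R b \<in> ball y e" using t(2) by (simp add: dist_commute)
    then show ?thesis using W(2) d by blast
  qed
  have line: "((\<lambda>s. c + s *\<^sub>R x) has_derivative (\<lambda>h. h *\<^sub>R x)) (at s)" for c x :: "real^'n" and s
    by (auto intro!: derivative_eq_intros)
  have f_line: "((\<lambda>s. f (c + s *\<^sub>R a)) has_real_derivative g (c + s *\<^sub>R a) \<bullet> a) (at s)"
    if "c + s *\<^sub>R a \<in> W" for c s
  proof -
    have "((\<lambda>s. f (c + s *\<^sub>R a)) has_derivative (\<lambda>h. g (c + s *\<^sub>R a) \<bullet> (h *\<^sub>R a))) (at s)"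
      by (rule has_derivative_compose[OF line f[OF that]])
    then show ?thesis by (simp add: has_field_derivative_def mult_commute_abs)
  qed
  have g_line: "((\<lambda>r. g (c + r *\<^sub>R b) \<bullet> a) has_real_derivative (H (c + r *\<^sub>R b) *v b) \<bullet> a) (at r)"
    if "c + r *\<^sub>R b \<in> W" for c r
  proof -
    have "((\<lambda>r. g (c + r *\<^sub>R b)) has_derivative (\<lambda>h. H (c + r *\<^sub>R b) *v (h *\<^sub>R b))) (at r)"
      by (rule has_derivative_compose[OF line g[OF that]])
    from has_derivative_inner_left[OF this, of a] show ?thesis
      by (simp add: has_field_derivative_def matrix_vector_mult_scaleR mult_commute_abs)
  qed
  define \<phi> where "\<phi> s = f (y + t *\<^sub>R b + s *\<^sub>R a) - f (y + s *\<^sub>R a)" for s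
  have "(\<phi> has_real_derivative g (y + t *\<^sub>R b + s *\<^sub>R a) \<bullet> a - g (y + s *\<^sub>R a) \<bullet> a) (at s)" if "0 \<le> s" "s \<le> t" for s
  proof -
    have "y + t *\<^sub>R b + s *\<^sub>R a \<in> W" "y + s *\<^sub>R a \<in> W"
      using near[of s t] near[of s 0] that t(1) by (auto simp: algebra_simps)
    then show ?thesis unfolding \<phi>_def by (intro DERIV_diff f_line)
  qed
  from MVT2[OF t(1) this] obtain s where s: "0 < s" "s < t"
    "\<phi> t - \<phi> 0 = (t - 0) * (g (y + t *\<^sub>R b + s *\<^sub>R a) \<bullet> a - g (y + s *\<^sub>R a) \<bullet> a)" by blast
  have "((\<lambda>r. g (y + s *\<^sub>R a + r *\<^sub>R b) \<bullet> a) has_real_derivative (H (y + s *\<^sub>R a + r *\<^sub>R b) *v b) \<bullet> a) (at r)"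
    if "0 \<le> r" "r \<le> t" for r
    using near[of s r] that s by (intro g_line) auto
  from MVT2[OF t(1) this] obtain r where r: "0 < r" "r < t"
    "g (y + s *\<^sub>R a + t *\<^sub>R b) \<bullet> a - g (y + s *\<^sub>R a + 0 *\<^sub>R b) \<bullet> a = (t - 0) * ((H (y + s *\<^sub>R a + r *\<^sub>R b) *v b) \<bullet> a)" by blast
  show ?thesis
  proof (rule that[of "y + s *\<^sub>R a + r *\<^sub>R b"])
    show "dist (y + s *\<^sub>R a + r *\<^sub>R b) y \<le> t * (norm a + norm b)" using near[of s r] s r by auto
    have e: "y + t *\<^sub>R b + s *\<^sub>R a = y + s *\<^sub>R a + t *\<^sub>R b" by simp
    have "\<phi> t - \<phi> 0 = t * (t * ((H (y + s *\<^sub>R a + r *\<^sub>R b) *v b) \<bullet> a))"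
      using s(3) r(3) unfolding e by simp
    then show "f (y + t *\<^sub>R a + t *\<^sub>R b) - f (y + t *\<^sub>R a) - f (y + t *\<^sub>R b) + f y = t\<^sup>2 * ((H (y + s *\<^sub>R a + r *\<^sub>R b) *v b) \<bullet> a)"
      by (simp add: \<phi>_def power2_eq_square add.commute add.left_commute)
  qed
qed

lemma continuous_hessian_symmetric:
  fixes f :: "real^'n \<Rightarrow> real"
  assumes W: "open W" "y \<in> W"
    and f: "\<And>y. y \<in> W \<Longrightarrow> (f has_derivative (\<lambda>h. g y \<bullet> h)) (at y)"
    and g: "\<And>y. y \<in> W \<Longrightarrow> (g has_derivative (\<lambda>h. H y *v h)) (at y)"
    and H: "continuous_on W H"
  shows "transpose (H y) = H y"
proof -
  obtain e where e: "e > 0" "ball y e \<subseteq> W" using W open_contains_ball by blast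
  have "(H y *v b) \<bullet> a = (H y *v a) \<bullet> b" for a b
  proof -
    define c where "c = norm a + norm b + 1"
    have c: "c > 0" by (simp add: c_def add_nonneg_pos)
    define t where "t j = e / (c * real (j + 2))" for j
    have t: "t j > 0" "t j * (norm a + norm b) < e" for j
    proof -
      show "t j > 0" using e c by (simp add: t_def)
      then have "t j * (norm a + norm b) < t j * c" by (simp add: c_def)
      also have "\<dots> = e / real (j + 2)" using c by (simp add: t_def)
      also have "\<dots> \<le> e" using e by (simp add: divide_le_eq)
      finally show "t j * (norm a + norm b) < e" .
    qed
    have "\<exists>z. dist z y \<le> t j * (norm a + norm b) \<and>
      f (y + t j *\<^sub>R a + t j *\<^sub>R b) - f (y + t j *\<^sub>R a) - f (y + t j *\<^sub>R b) + f y = (t j)\<^sup>2 * ((H z *v b) \<bullet> a)" for j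
      using second_difference_mean_value[OF W(1) e(2) f g t] by metis
    then obtain z where z: "\<And>j. dist (z j) y \<le> t j * (norm a + norm b)"
      "\<And>j. f (y + t j *\<^sub>R a + t j *\<^sub>R b) - f (y + t j *\<^sub>R a) - f (y + t j *\<^sub>R b) + f y = (t j)\<^sup>2 * ((H (z j) *v b) \<bullet> a)"
      by metis
    have t': "t j * (norm b + norm a) < e" for j using t(2)[of j] by (simp add: add.commute)
    have "\<exists>z. dist z y \<le> t j * (norm b + norm a) \<and>
      f (y + t j *\<^sub>R b + t j *\<^sub>R a) - f (y + t j *\<^sub>R b) - f (y + t j *\<^sub>R a) + f y = (t j)\<^sup>2 * ((H z *v a) \<bullet> b)" for j
      using second_difference_mean_value[OF W(1) e(2) f g t(1) t'] by metis
    then obtain z' where z': "\<And>j. dist (z' j) y \<le> t j * (norm b + norm a)"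
      "\<And>j. f (y + t j *\<^sub>R b + t j *\<^sub>R a) - f (y + t j *\<^sub>R b) - f (y + t j *\<^sub>R a) + f y = (t j)\<^sup>2 * ((H (z' j) *v a) \<bullet> b)"
      by metis
    have eq: "(H (z j) *v b) \<bullet> a = (H (z' j) *v a) \<bullet> b" for j
    proof -
      have "(t j)\<^sup>2 * ((H (z j) *v b) \<bullet> a) = (t j)\<^sup>2 * ((H (z' j) *v a) \<bullet> b)"
        using z(2)[of j] z'(2)[of j] by (simp add: algebra_simps)
      then show ?thesis using t(1)[of j] by simp
    qed
    have t0: "t \<longlonglongrightarrow> 0"
    proof -
      have "(\<lambda>j. (e / c) * (1 / real (j + 2))) \<longlonglongrightarrow> (e / c) * 0"
        by (intro tendsto_mult tendsto_const LIMSEQ_ignore_initial_segment[OF lim_1_over_n])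
      then show ?thesis by (simp add: t_def[abs_def])
    qed
    have lim: "w \<longlonglongrightarrow> y" if "\<And>j. dist (w j) y \<le> t j * k" for w k
    proof -
      have "(\<lambda>j. t j * k) \<longlonglongrightarrow> 0" using tendsto_mult_left_zero[OF t0] .
      then have "(\<lambda>j. dist (w j) y) \<longlonglongrightarrow> 0"
        by (rule Lim_null_comparison[rotated]) (simp add: that)
      then show ?thesis by (simp only: tendsto_dist_iff[symmetric])
    qed
    have "isCont H y" using H W by (simp add: continuous_on_eq_continuous_at)
    then have HL: "(\<lambda>j. H (w j)) \<longlonglongrightarrow> H y" if "w \<longlonglongrightarrow> y" for w using that by (rule isCont_tendsto_compose)
    have mv: "(\<lambda>j. (H (w j) *v x) \<bullet> x') \<longlonglongrightarrow> (H y *v x) \<bullet> x'" if "w \<longlonglongrightarrow> y" for w x x'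
      unfolding matrix_vector_mult_def using HL[OF that] by (intro tendsto_intros)
    have "(\<lambda>j. (H (z j) *v b) \<bullet> a) \<longlonglongrightarrow> (H y *v b) \<bullet> a" by (rule mv[OF lim[OF z(1)]])
    moreover have "(\<lambda>j. (H (z j) *v b) \<bullet> a) \<longlonglongrightarrow> (H y *v a) \<bullet> b" unfolding eq by (rule mv[OF lim[OF z'(1)]])
    ultimately show ?thesis by (rule LIMSEQ_unique)
  qed
  from this[of "axis _ 1" "axis _ 1"] have "H y $ i $ j = H y $ j $ i" for i j
    by (simp add: matrix_vector_mult_basis column_def inner_axis)
  then show ?thesis by (simp add: vec_eq_iff transpose_def)
qed

text \<open>\<open>T\<close> and \<open>S\<close> are the first and second derivatives of \<open>\<Theta>\<close>, given directionally so that an explicit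
  map needs no operator-valued calculus.\<close>

lemma C2_open_compose_grad_hess:
  fixes F :: "'a::euclidean_space \<Rightarrow> real" and \<Theta> :: "real^'n \<Rightarrow> 'a"
  assumes F: "C2_open U F" and W: "open W" "\<And>x. x \<in> W \<Longrightarrow> \<Theta> x \<in> U"
    and T: "\<And>x. x \<in> W \<Longrightarrow> (\<Theta> has_derivative T x) (at x)"
    and S: "\<And>x h. x \<in> W \<Longrightarrow> ((\<lambda>x. T x h) has_derivative S x h) (at x)"
    and cS: "\<And>h k. continuous_on W (\<lambda>x. S x h k)"
  shows "\<exists>g H. has_grad_hess W (\<lambda>x. F (\<Theta> x)) g H"
proof -
  obtain F' :: "'a \<Rightarrow> 'a \<Rightarrow>\<^sub>L real" where F': "\<And>x. x \<in> U \<Longrightarrow> (F has_derivative blinfun_apply (F' x)) (at x)" "C1_open U F'"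
    using F unfolding C2_open_def by blast
  obtain F'' :: "'a \<Rightarrow> 'a \<Rightarrow>\<^sub>L ('a \<Rightarrow>\<^sub>L real)" where
    F'': "\<And>x. x \<in> U \<Longrightarrow> (F' has_derivative blinfun_apply (F'' x)) (at x)" "continuous_on U F''"
    using F'(2) unfolding C1_open_def by blast
  have cont: "continuous_on V G" if "\<And>x. x \<in> V \<Longrightarrow> (G has_derivative G' x) (at x)"
    for V and G :: "'x::real_normed_vector \<Rightarrow> 'y::real_normed_vector" and G'
    using has_derivative_continuous[OF that]
    by (auto simp: continuous_on_eq_continuous_within intro: continuous_at_imp_continuous_at_within)
  have cT: "continuous_on W \<Theta>" "continuous_on W (\<lambda>x. T x h)" for h
    by (rule cont[OF T], assumption) (rule cont[OF S], assumption)
  have cF': "continuous_on W (\<lambda>x. F' (\<Theta> x))" "continuous_on W (\<lambda>x. F'' (\<Theta> x))"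
    using continuous_on_compose2[OF cont[OF F''(1)] cT(1)] continuous_on_compose2[OF F''(2) cT(1)] W(2) by blast+
  define g where "g x = (\<chi> i. F' (\<Theta> x) (T x (axis i 1)))" for x
  define H where "H x = (\<chi> i j. F'' (\<Theta> x) (T x (axis j 1)) (T x (axis i 1)) + F' (\<Theta> x) (S x (axis i 1) (axis j 1)))" for x
  have lin: "linear (T x)" "linear (S x h)" if "x \<in> W" for x h
    using has_derivative_linear[OF T[OF that]] has_derivative_linear[OF S[OF that]] by auto
  have 1: "((\<lambda>x. F (\<Theta> x)) has_derivative (\<lambda>h. g x \<bullet> h)) (at x)" if x: "x \<in> W" for x
  proof -
    have "((\<lambda>x. F (\<Theta> x)) has_derivative (\<lambda>h. F' (\<Theta> x) (T x h))) (at x)"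
      by (rule has_derivative_compose[OF T[OF x] F'(1)[OF W(2)[OF x]]])
    moreover have "F' (\<Theta> x) (T x h) = g x \<bullet> h" for h
    proof -
      have l: "linear (\<lambda>h. F' (\<Theta> x) (T x h))"
        using linear_compose[OF lin(1)[OF x] bounded_linear.linear[OF blinfun.bounded_linear_right[of "F' (\<Theta> x)"]]] by (simp add: o_def)
      have "F' (\<Theta> x) (T x h) = F' (\<Theta> x) (T x (\<Sum>i\<in>UNIV. h $ i *\<^sub>R axis i 1))"
        using basis_expansion[of h] by (simp add: scalar_mult_eq_scaleR)
      also have "\<dots> = (\<Sum>i\<in>UNIV. h $ i * F' (\<Theta> x) (T x (axis i 1)))"
        using linear_sum[OF l, of "\<lambda>i. h $ i *\<^sub>R axis i 1" UNIV] by (simp add: linear_cmul[OF l])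
      finally show ?thesis by (simp add: g_def inner_vec_def mult.commute)
    qed
    ultimately show ?thesis by simp
  qed
  have 2: "(g has_derivative (\<lambda>h. H x *v h)) (at x)" if x: "x \<in> W" for x
  proof -
    have comp: "((\<lambda>x. F' (\<Theta> x) (T x (axis i 1))) has_derivative
        (\<lambda>h. F'' (\<Theta> x) (T x h) (T x (axis i 1)) + F' (\<Theta> x) (S x (axis i 1) h))) (at x)" for i
      using blinfun.FDERIV[OF has_derivative_compose[OF T[OF x] F''(1)[OF W(2)[OF x]]] S[OF x]]
      by (simp add: add.commute)
    moreover have "F'' (\<Theta> x) (T x h) (T x (axis i 1)) + F' (\<Theta> x) (S x (axis i 1) h) = (H x *v h) $ i" for h i
    proof -
      have l: "linear (\<lambda>h. F'' (\<Theta> x) (T x h) (T x (axis i 1)) + F' (\<Theta> x) (S x (axis i 1) h))"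
        using has_derivative_linear[OF comp] .
      have "F'' (\<Theta> x) (T x h) (T x (axis i 1)) + F' (\<Theta> x) (S x (axis i 1) h)
          = (\<lambda>h. F'' (\<Theta> x) (T x h) (T x (axis i 1)) + F' (\<Theta> x) (S x (axis i 1) h)) (\<Sum>j\<in>UNIV. h $ j *\<^sub>R axis j 1)"
        using basis_expansion[of h] by (simp add: scalar_mult_eq_scaleR)
      also have "\<dots> = (\<Sum>j\<in>UNIV. h $ j * (F'' (\<Theta> x) (T x (axis j 1)) (T x (axis i 1)) + F' (\<Theta> x) (S x (axis i 1) (axis j 1))))"
        using linear_sum[OF l, of "\<lambda>i. h $ i *\<^sub>R axis i 1" UNIV] by (simp only: linear_cmul[OF l] real_scaleR_def)
      finally show ?thesis by (simp add: H_def matrix_vector_mult_def mult.commute)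
    qed
    ultimately have "((\<lambda>x. g x $ i) has_derivative (\<lambda>h. (H x *v h) $ i)) (at x)" for i
      unfolding g_def by simp
    then show ?thesis
      unfolding has_derivative_componentwise_within[of g] by (auto simp: Basis_vec_def inner_axis)
  qed
  have 3: "continuous_on W H"
    unfolding H_def by (intro continuous_intros cF' cT cS)
  show ?thesis
    unfolding has_grad_hess_def
    using 1 2 3 continuous_hessian_symmetric[OF W(1) _ 1 2 3] by blast
qed

section \<open>The Schouten tensor of a conformally flat metric\<close>

lemma pderiv_within_cball:
  assumes "(F has_derivative D) (at x within cball 0 1)" "x \<in> cball 0 1"
  shows "pderiv_within (cball 0 1) i F x = D (axis i 1)"
proof -
  have "F differentiable (at x within cball 0 1)" using assms(1) by (auto simp: differentiable_def)
  then have "(F has_derivative frechet_derivative F (at x within cball 0 1)) (at x within cball 0 1)"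
    by (simp add: frechet_derivative_works)
  from has_derivative_within_cball_unique[OF this assms] show ?thesis by (simp add: pderiv_within_def)
qed

text \<open>The Kronecker symbol, kept as a constant so that sums against it collapse by rewriting (\<open>kdelta_sum\<close>) before any
  case distinction on indices is made.\<close>

definition kdelta :: "'n \<Rightarrow> 'n \<Rightarrow> real" where "kdelta i j = (if i = j then 1 else 0)"

lemma kdelta_sum:
  fixes f :: "'n::finite \<Rightarrow> real"
  shows "(\<Sum>m\<in>UNIV. kdelta a m * f m) = f a" "(\<Sum>m\<in>UNIV. kdelta m a * f m) = f a"
  by (simp_all add: kdelta_def if_distrib[of "\<lambda>x. x * _"] cong: if_cong)

lemma kdelta_sym: "kdelta i j = kdelta j i" and kdelta_refl: "kdelta i i = 1"
  by (auto simp: kdelta_def)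

text \<open>The two contractions of products of Christoffel symbols in the Ricci tensor of \<open>e\<^sup>2\<^sup>\<psi> |dx|\<^sup>2\<close>, where
  \<open>p\<close> is the gradient of \<open>\<psi>\<close>.\<close>

lemma conformally_flat_christoffel_square:
  fixes p :: "'n::finite \<Rightarrow> real"
  defines "\<Gamma> \<equiv> \<lambda>l i j. kdelta l i * p j + kdelta l j * p i - kdelta i j * p l"
  shows "(\<Sum>i\<in>UNIV. \<Sum>m\<in>UNIV. \<Gamma> i i m * \<Gamma> m j k) = CARD('n) * (2 * p j * p k - (\<Sum>i\<in>UNIV. (p i)\<^sup>2) * kdelta j k)"
    and "(\<Sum>i\<in>UNIV. \<Sum>m\<in>UNIV. \<Gamma> i j m * \<Gamma> m i k) = (CARD('n) + 2) * (p j * p k) - 2 * (\<Sum>i\<in>UNIV. (p i)\<^sup>2) * kdelta j k"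
proof -
  let ?P = "\<Sum>i\<in>UNIV. (p i)\<^sup>2"
  have tr: "(\<Sum>i\<in>UNIV. \<Gamma> i i m) = CARD('n) * p m" for m
    by (simp add: \<Gamma>_def sum.distrib sum_subtractf kdelta_sum kdelta_refl)
  have "(\<Sum>i\<in>UNIV. \<Sum>m\<in>UNIV. \<Gamma> i i m * \<Gamma> m j k) = (\<Sum>m\<in>UNIV. (\<Sum>i\<in>UNIV. \<Gamma> i i m) * \<Gamma> m j k)"
    by (subst sum.swap) (simp add: sum_distrib_right)
  also have "\<dots> = CARD('n) * (\<Sum>m\<in>UNIV. kdelta m j * (p m * p k) + kdelta m k * (p m * p j) - kdelta j k * (p m)\<^sup>2)"
    unfolding tr by (simp add: \<Gamma>_def sum_distrib_left power2_eq_square algebra_simps)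
  also have "\<dots> = CARD('n) * (2 * p j * p k - ?P * kdelta j k)"
    by (simp add: sum.distrib sum_subtractf kdelta_sum sum_distrib_left[symmetric])
  finally show "(\<Sum>i\<in>UNIV. \<Sum>m\<in>UNIV. \<Gamma> i i m * \<Gamma> m j k) = CARD('n) * (2 * p j * p k - ?P * kdelta j k)" .
  have inner: "(\<Sum>m\<in>UNIV. \<Gamma> i j m * \<Gamma> m i k)
     = kdelta i j * (2 * p i * p k) + kdelta i k * (p i * p j) - kdelta i k * (p j * p i) + p j * p k
       - kdelta i j * (kdelta i k * ?P) - kdelta j k * (p i)\<^sup>2 - kdelta i j * (p i * p k) + kdelta i k * (p i * p j)" for i
  proof -
    have "(\<Sum>m\<in>UNIV. \<Gamma> i j m * \<Gamma> m i k) = (\<Sum>m\<in>UNIV.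
        kdelta m i * (kdelta i j * p m * p k) + kdelta m k * (kdelta i j * p m * p i) - kdelta i j * kdelta i k * (p m)\<^sup>2
        + kdelta i m * (kdelta m i * (p j * p k)) + kdelta m k * (kdelta i m * (p j * p i)) - kdelta i m * (kdelta i k * p j * p m)
        - kdelta j m * (kdelta m i * (p i * p k)) - kdelta m k * (kdelta j m * (p i * p i)) + kdelta j m * (kdelta i k * p i * p m))"
      unfolding \<Gamma>_def by (intro sum.cong refl) (simp add: power2_eq_square algebra_simps)
    also have "\<dots> = kdelta i j * p i * p k + kdelta i j * p k * p i - kdelta i j * kdelta i k * ?P
        + kdelta i i * (p j * p k) + kdelta i k * (p j * p i) - kdelta i k * p j * p i
        - kdelta j i * (p i * p k) - kdelta j k * (p i * p i) + kdelta i k * p i * p j"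
      unfolding sum.distrib sum_subtractf kdelta_sum sum_distrib_left[symmetric] by simp
    finally show ?thesis by (simp add: kdelta_refl kdelta_sym[of j i] power2_eq_square algebra_simps)
  qed
  have "(\<Sum>i\<in>UNIV. \<Sum>m\<in>UNIV. \<Gamma> i j m * \<Gamma> m i k) = 2 * p j * p k + p k * p j - p j * p k + CARD('n) * (p j * p k)
       - kdelta j k * ?P - kdelta j k * ?P - p j * p k + p k * p j"
    unfolding inner sum.distrib sum_subtractf kdelta_sum sum_distrib_left[symmetric] by simp
  then show "(\<Sum>i\<in>UNIV. \<Sum>m\<in>UNIV. \<Gamma> i j m * \<Gamma> m i k) = (CARD('n) + 2) * (p j * p k) - 2 * ?P * kdelta j k"
    by (simp add: algebra_simps)
qed

lemma matrix_inv_mat: "c \<noteq> 0 \<Longrightarrow> matrix_inv (mat c :: real^'n^'n) = mat (1 / c)"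
  by (rule matrix_inv_eqI)
     (simp add: matrix_eq matrix_vector_mul_assoc[symmetric] mat_mult_vector)

context
  fixes W :: "(real^'n) set" and r :: "real^'n \<Rightarrow> real" and q :: "real^'n \<Rightarrow> real^'n"
    and A :: "real^'n \<Rightarrow> real^'n^'n" and g :: "real^'n \<Rightarrow> real^'n^'n"
  assumes W: "cball 0 1 \<subseteq> W" and r: "has_grad_hess W r q A"
    and pos: "\<And>x. x \<in> cball 0 1 \<Longrightarrow> r x > 0"
    and g: "\<And>x. x \<in> cball 0 1 \<Longrightarrow> g x = mat (1 / (r x)\<^sup>2)"
begin

text \<open>In the following lemmas the metric is \<open>r\<^sup>-\<^sup>2 |dx|\<^sup>2 = e\<^sup>2\<^sup>\<psi> |dx|\<^sup>2\<close> on the closed unit ball, with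
  \<open>\<psi> = - ln r\<close> and gradient \<open>- q / r\<close> of \<open>\<psi>\<close>.\<close>

lemma conformally_flat_christoffel:
  assumes x: "x \<in> cball 0 1"
  shows "christoffel (cball 0 1) g l i j x
     = kdelta l i * (- q x $ j / r x) + kdelta l j * (- q x $ i / r x) - kdelta i j * (- q x $ l / r x)"
proof -
  have r0: "r x \<noteq> 0" using pos[OF x] by simp
  have d: "((\<lambda>y. 1 / (r y)\<^sup>2) has_derivative (\<lambda>h. - 2 * (q x \<bullet> h) / (r x) ^ 3)) (at x within cball 0 1)"
  proof -
    have rd: "(r has_derivative (\<lambda>h. q x \<bullet> h)) (at x within cball 0 1)"
      using has_grad_hessD(1)[OF r] W x by (blast intro: has_derivative_at_withinI)
    show ?thesis
      by (rule has_derivative_eq_rhs, (rule derivative_intros rd)+)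
         (use r0 in \<open>auto simp: fun_eq_iff power2_eq_square power3_eq_cube field_simps\<close>)
  qed
  have pd: "pderiv_within (cball 0 1) i (\<lambda>y. g y $ j $ l) x = kdelta j l * (- 2 * (q x $ i) / (r x) ^ 3)" for i j l
  proof -
    have "((\<lambda>y. kdelta j l * (1 / (r y)\<^sup>2)) has_derivative (\<lambda>h. kdelta j l * (- 2 * (q x \<bullet> h) / (r x) ^ 3))) (at x within cball 0 1)"
      by (rule has_derivative_mult_right[OF d])
    then have "((\<lambda>y. g y $ j $ l) has_derivative (\<lambda>h. kdelta j l * (- 2 * (q x \<bullet> h) / (r x) ^ 3))) (at x within cball 0 1)"
      by (rule has_derivative_transform[OF x, rotated]) (simp add: g mat_def kdelta_def)
    from pderiv_within_cball[OF this x] show ?thesis by (simp add: inner_axis)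
  qed
  have inv: "matrix_inv (g x) $ l $ m = kdelta l m * (r x)\<^sup>2" for m
    using r0 by (simp add: g[OF x] matrix_inv_mat) (simp add: mat_def kdelta_def)
  have "christoffel (cball 0 1) g l i j x = (\<Sum>m\<in>UNIV. kdelta l m * ((r x)\<^sup>2 *
      (kdelta j m * (- 2 * (q x $ i) / (r x) ^ 3) + kdelta i m * (- 2 * (q x $ j) / (r x) ^ 3)
        - kdelta i j * (- 2 * (q x $ m) / (r x) ^ 3)))) / 2"
    unfolding christoffel_def pd inv by (simp add: mult.assoc)
  also have "\<dots> = ((r x)\<^sup>2 *
      (kdelta j l * (- 2 * (q x $ i) / (r x) ^ 3) + kdelta i l * (- 2 * (q x $ j) / (r x) ^ 3)
        - kdelta i j * (- 2 * (q x $ l) / (r x) ^ 3))) / 2"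
    by (simp only: kdelta_sum)
  also have "\<dots> = kdelta j l * (- q x $ i / r x) + kdelta i l * (- q x $ j / r x) - kdelta i j * (- q x $ l / r x)"
  proof -
    have e: "- 2 * (q x $ i) / (r x) ^ 3 = 2 * (- q x $ i / r x) / (r x)\<^sup>2" for i
      using r0 by (simp add: power2_eq_square power3_eq_cube)
    have gen: "c * (k1 * (2 * a / c) + k2 * (2 * b / c) - k3 * (2 * d / c)) / 2 = k1 * a + k2 * b - k3 * d"
      if "c \<noteq> 0" for c k1 k2 k3 a b d :: real
      using that by (simp add: field_simps)
    show ?thesis unfolding e by (rule gen) (use r0 in simp)
  qed
  finally show ?thesis by (simp add: kdelta_sym[of j l] kdelta_sym[of i l])
qed

lemma conformally_flat_christoffel_derivative:
  assumes x: "x \<in> cball 0 1"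
  defines "P \<equiv> \<lambda>j i. - A x $ j $ i / r x + q x $ j * q x $ i / (r x)\<^sup>2"
  shows "pderiv_within (cball 0 1) m (christoffel (cball 0 1) g l i j) x
     = kdelta l i * P j m + kdelta l j * P i m - kdelta i j * P l m"
proof -
  have r0: "r x \<noteq> 0" using pos[OF x] by simp
  have xW: "x \<in> W" using W x by auto
  have rd: "(r has_derivative (\<lambda>h. q x \<bullet> h)) (at x within cball 0 1)"
    using has_grad_hessD(1)[OF r xW] by (rule has_derivative_at_withinI)
  have qd: "((\<lambda>y. q y $ j) has_derivative (\<lambda>h. (A x *v h) $ j)) (at x within cball 0 1)" for j
    using bounded_linear.has_derivative[OF bounded_linear_vec_nth has_grad_hessD(2)[OF r xW]]
    by (rule has_derivative_at_withinI)
  have d: "((\<lambda>y. - q y $ j / r y) has_derivative (\<lambda>h. ((- (A x *v h) $ j) * r x - (- q x $ j) * (q x \<bullet> h)) / (r x * r x))) (at x within cball 0 1)" for j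
    by (rule has_derivative_divide'[OF has_derivative_minus[OF qd] rd r0])
  have "((\<lambda>y. kdelta l i * (- q y $ j / r y) + kdelta l j * (- q y $ i / r y) - kdelta i j * (- q y $ l / r y)) has_derivative
    (\<lambda>h. kdelta l i * (((- (A x *v h) $ j) * r x - (- q x $ j) * (q x \<bullet> h)) / (r x * r x))
       + kdelta l j * (((- (A x *v h) $ i) * r x - (- q x $ i) * (q x \<bullet> h)) / (r x * r x))
       - kdelta i j * (((- (A x *v h) $ l) * r x - (- q x $ l) * (q x \<bullet> h)) / (r x * r x)))) (at x within cball 0 1)"
    by (intro has_derivative_diff has_derivative_add has_derivative_mult_right d)
  then have "(christoffel (cball 0 1) g l i j has_derivative
    (\<lambda>h. kdelta l i * (((- (A x *v h) $ j) * r x - (- q x $ j) * (q x \<bullet> h)) / (r x * r x))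
       + kdelta l j * (((- (A x *v h) $ i) * r x - (- q x $ i) * (q x \<bullet> h)) / (r x * r x))
       - kdelta i j * (((- (A x *v h) $ l) * r x - (- q x $ l) * (q x \<bullet> h)) / (r x * r x)))) (at x within cball 0 1)"
    by (rule has_derivative_transform[OF x, rotated]) (simp add: conformally_flat_christoffel)
  note chr = pderiv_within_cball[OF this x]
  have e: "((- A x $ j $ m) * r x - (- q x $ j) * (q x $ m)) / (r x * r x) = P j m" for j
    using r0 by (simp add: P_def field_simps power2_eq_square)
  from chr[of m] have "pderiv_within (cball 0 1) m (christoffel (cball 0 1) g l i j) x =
     kdelta l i * (((- A x $ j $ m) * r x - (- q x $ j) * (q x $ m)) / (r x * r x))
       + kdelta l j * (((- A x $ i $ m) * r x - (- q x $ i) * (q x $ m)) / (r x * r x))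
       - kdelta i j * (((- A x $ l $ m) * r x - (- q x $ l) * (q x $ m)) / (r x * r x))"
    by (simp add: inner_axis matrix_vector_mult_basis column_def)
  then show ?thesis unfolding e .
qed

lemma conformally_flat_ricci:
  assumes x: "x \<in> cball 0 1"
  defines "p \<equiv> \<lambda>j. - q x $ j / r x"
  defines "P \<equiv> \<lambda>j i. - A x $ j $ i / r x + q x $ j * q x $ i / (r x)\<^sup>2"
  shows "ricci (cball 0 1) g x $ j $ k = (2 - real CARD('n)) * (P j k - p j * p k)
     - ((\<Sum>i\<in>UNIV. P i i) + (real CARD('n) - 2) * (\<Sum>i\<in>UNIV. (p i)\<^sup>2)) * kdelta j k"
proof -
  have xW: "x \<in> W" using W x by auto
  have sym: "P i j = P j i" for i j
  proof -
    have "A x $ i $ j = transpose (A x) $ j $ i" by (simp add: transpose_def)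
    then have "A x $ i $ j = A x $ j $ i" by (simp add: has_grad_hessD(3)[OF r xW])
    then show ?thesis by (simp add: P_def mult.commute)
  qed
  let ?\<Gamma> = "\<lambda>l i j. kdelta l i * p j + kdelta l j * p i - kdelta i j * p l"
  have Chr: "christoffel (cball 0 1) g l i j x = ?\<Gamma> l i j" for l i j
    unfolding p_def by (rule conformally_flat_christoffel[OF x])
  have dChr: "pderiv_within (cball 0 1) m (christoffel (cball 0 1) g l i j) x
     = kdelta l i * P j m + kdelta l j * P i m - kdelta i j * P l m" for m l i j
    unfolding P_def by (rule conformally_flat_christoffel_derivative[OF x])
  have "ricci (cball 0 1) g x $ j $ k =
      (\<Sum>i\<in>UNIV. (kdelta i j * P k i + kdelta i k * P j i - kdelta j k * P i i)
          - (kdelta i i * P k j + kdelta i k * P i j - kdelta i k * P i j))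
      + ((\<Sum>i\<in>UNIV. \<Sum>m\<in>UNIV. ?\<Gamma> i i m * ?\<Gamma> m j k) - (\<Sum>i\<in>UNIV. \<Sum>m\<in>UNIV. ?\<Gamma> i j m * ?\<Gamma> m i k))"
    unfolding ricci_def riemann_def dChr Chr by (simp add: sum.distrib sum_subtractf)
  also have "(\<Sum>i\<in>UNIV. (kdelta i j * P k i + kdelta i k * P j i - kdelta j k * P i i)
          - (kdelta i i * P k j + kdelta i k * P i j - kdelta i k * P i j))
      = P k j + P j k - kdelta j k * (\<Sum>i\<in>UNIV. P i i) - real CARD('n) * P k j"
    by (simp add: sum.distrib sum_subtractf kdelta_sum kdelta_refl sum_distrib_left)
  finally show ?thesis
    unfolding conformally_flat_christoffel_square sym[of k j] by (simp add: algebra_simps)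
qed

text \<open>In terms of \<open>\<psi>\<close> the Schouten tensor is \<open>- D\<^sup>2\<psi> + d\<psi> \<otimes> d\<psi> - |d\<psi>|\<^sup>2/2 I\<close>.  With
  \<open>\<psi> = - ln r\<close> the two rank-one terms cancel, which is why \<open>r\<close> is the convenient unknown.\<close>

lemma conformally_flat_schouten:
  assumes x: "x \<in> cball 0 1" and n: "CARD('n) \<ge> 3"
  shows "matrix_inv (g x) ** schouten (cball 0 1) g x = conformal_hessian (r x) (q x) (A x)"
proof -
  define p where "p = (\<lambda>j. - q x $ j / r x)"
  define P where "P = (\<lambda>j i. - A x $ j $ i / r x + q x $ j * q x $ i / (r x)\<^sup>2)"
  define n where "n = real CARD('n)"
  define T where "T = (\<Sum>i\<in>UNIV. P i i)"
  define S where "S = (\<Sum>i\<in>UNIV. (p i)\<^sup>2)"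
  have r0: "r x \<noteq> 0" using pos[OF x] by simp
  have n0: "n - 2 \<noteq> 0" "n - 1 \<noteq> 0" using n by (auto simp: n_def)
  \<comment> \<open>\<open>T\<close> and \<open>S\<close> are the Laplacian and the squared gradient of \<open>\<psi>\<close>\<close>
  have Ric: "ricci (cball 0 1) g x $ j $ k = (2 - n) * (P j k - p j * p k) - (T + (n - 2) * S) * kdelta j k" for j k
    unfolding T_def S_def P_def p_def n_def by (rule conformally_flat_ricci[OF x])
  have inv: "matrix_inv (g x) = mat ((r x)\<^sup>2)" using r0 by (simp add: g[OF x] matrix_inv_mat)
  have "scalar_curvature (cball 0 1) g x
      = (\<Sum>i\<in>UNIV. \<Sum>j\<in>UNIV. kdelta i j * ((r x)\<^sup>2 * ((2 - n) * (P i j - p i * p j) - (T + (n - 2) * S) * kdelta i j)))"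
    unfolding scalar_curvature_def Ric inv by (intro sum.cong refl) (simp add: mat_def kdelta_def)
  also have "\<dots> = (\<Sum>i\<in>UNIV. (r x)\<^sup>2 * ((2 - n) * (P i i - (p i)\<^sup>2) - (T + (n - 2) * S)))"
    by (simp add: kdelta_sum kdelta_refl power2_eq_square)
  also have "\<dots> = (r x)\<^sup>2 * ((2 - n) * (T - S) - n * (T + (n - 2) * S))"
    by (simp add: sum_distrib_left[symmetric] sum_subtractf T_def S_def n_def)
  finally have R: "scalar_curvature (cball 0 1) g x = (r x)\<^sup>2 * (- 2 * (n - 1) * T - (n - 1) * (n - 2) * S)"
    by (simp add: algebra_simps)
  have R': "scalar_curvature (cball 0 1) g x / (2 * (n - 1)) = (r x)\<^sup>2 * (- T - (n - 2) / 2 * S)"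
    unfolding R using n0 by (simp add: field_simps)
  have sch: "schouten (cball 0 1) g x $ j $ k = - P j k + p j * p k - S / 2 * kdelta j k" for j k
  proof -
    have "schouten (cball 0 1) g x $ j $ k
      = (1 / (n - 2)) * (((2 - n) * (P j k - p j * p k) - (T + (n - 2) * S) * kdelta j k)
          - ((r x)\<^sup>2 * (- T - (n - 2) / 2 * S)) * (kdelta j k / (r x)\<^sup>2))"
      unfolding schouten_def n_def[symmetric] R' by (simp add: Ric g[OF x]) (simp add: mat_def kdelta_def)
    also have "\<dots> = (1 / (n - 2)) * ((2 - n) * (P j k - p j * p k) - (n - 2) / 2 * S * kdelta j k)"
      using r0 by (simp add: algebra_simps)
    also have "\<dots> = - P j k + p j * p k - S / 2 * kdelta j k" using n0 by (simp add: field_simps)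
    finally show ?thesis .
  qed
  have Sq: "S = (q x \<bullet> q x) / (r x)\<^sup>2"
    by (simp add: S_def p_def power_divide sum_divide_distrib[symmetric] inner_vec_def power2_eq_square)
  have "(matrix_inv (g x) ** schouten (cball 0 1) g x) $ j $ k = conformal_hessian (r x) (q x) (A x) $ j $ k" for j k
  proof -
    have "(matrix_inv (g x) ** schouten (cball 0 1) g x) $ j $ k = (\<Sum>m\<in>UNIV. kdelta j m * ((r x)\<^sup>2 * schouten (cball 0 1) g x $ m $ k))"
      unfolding inv matrix_matrix_mult_def by (simp, intro sum.cong refl) (simp add: mat_def kdelta_def)
    also have "\<dots> = (r x)\<^sup>2 * (- P j k + p j * p k - S / 2 * kdelta j k)" by (simp only: kdelta_sum sch)
    also have "\<dots> = r x * A x $ j $ k - (q x \<bullet> q x) / 2 * kdelta j k"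
      using r0 by (simp add: P_def p_def Sq field_simps power2_eq_square)
    finally show ?thesis by (simp add: conformal_hessian_def mat_def kdelta_def)
  qed
  then show ?thesis by (simp add: vec_eq_iff)
qed

end

section \<open>Covariance of the conformal Hessian under inversions\<close>

text \<open>Reflection in the hyperplane orthogonal to \<open>z\<close>; up to a scalar it is the differential at \<open>y\<close> of any inversion
  with centre \<open>y - z\<close>.\<close>

definition reflection_matrix :: "real^'n \<Rightarrow> real^'n^'n" where
  "reflection_matrix z = mat 1 - (2 / (z \<bullet> z)) *\<^sub>R outer z z"

lemma reflection_matrix_mult: "reflection_matrix z *v x = x - (2 * (z \<bullet> x) / (z \<bullet> z)) *\<^sub>R z"
  by (simp add: reflection_matrix_def matrix_vector_mult_diff_rdistrib scaleR_matrix_vector_assoc[symmetric]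
      outer_mult)

lemma transpose_reflection_matrix: "transpose (reflection_matrix z) = reflection_matrix z"
  by (simp add: reflection_matrix_def transpose_diff transpose_scaleR transpose_outer transpose_mat)

lemma orthogonal_reflection_matrix:
  assumes "z \<noteq> 0"
  shows "orthogonal_matrix (reflection_matrix z)"
proof -
  have "reflection_matrix z ** reflection_matrix z = mat 1"
  proof (rule matrix_eq[THEN iffD2], rule allI)
    fix x
    have "z \<bullet> z \<noteq> 0" using assms by simp
    then show "(reflection_matrix z ** reflection_matrix z) *v x = mat 1 *v x"
      by (simp add: matrix_vector_mul_assoc[symmetric] reflection_matrix_mult inner_diff_right)
  qed
  then show ?thesis by (simp add: orthogonal_matrix_def transpose_reflection_matrix)
qed

lemma orthogonal_matrix_inner:
  fixes Q :: "real^'n^'n"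
  shows "orthogonal_matrix Q \<Longrightarrow> (Q *v x) \<bullet> (Q *v y) = x \<bullet> y"
  using orthogonal_transformation_matrix[of "(*v) Q"] by (simp add: orthogonal_transformation_def)

lemma eigenbasis_conjugate:
  assumes "orthogonal_matrix Q" "eigenbasis M u l"
  shows "eigenbasis (transpose Q ** M ** Q) (\<lambda>i. transpose Q *v u i) l"
proof -
  have "orthogonal_matrix (transpose Q)" using assms(1) by (simp add: orthogonal_matrix_def)
  moreover have "(transpose Q ** M ** Q) *v (transpose Q *v x) = transpose Q *v (M *v x)" for x
  proof -
    have "(transpose Q ** M ** Q) *v (transpose Q *v x) = transpose Q *v (M *v ((Q ** transpose Q) *v x))"
      by (simp add: matrix_vector_mul_assoc[symmetric] del: vector_transpose_matrix transpose_matrix_vector)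
    then show ?thesis using assms(1) by (simp add: orthogonal_matrix_def)
  qed
  ultimately show ?thesis
    using assms(2) by (simp add: eigenbasis_def orthogonal_matrix_inner matrix_vector_mult_scaleR
        del: vector_transpose_matrix transpose_matrix_vector)
qed

lemma has_grad_hess_orthogonal:
  assumes r: "has_grad_hess W r q A"
  shows "has_grad_hess {x. Q *v x \<in> W} (\<lambda>x. r (Q *v x)) (\<lambda>x. transpose Q *v q (Q *v x))
           (\<lambda>x. transpose Q ** A (Q *v x) ** Q)"
proof -
  have L: "((\<lambda>x. Q *v x) has_derivative (\<lambda>h. Q *v h)) (at x)" for x
    by (rule bounded_linear_imp_has_derivative) (rule matrix_vector_mul_bounded_linear)
  have 1: "((\<lambda>x. r (Q *v x)) has_derivative (\<lambda>h. (transpose Q *v q (Q *v x)) \<bullet> h)) (at x)" if "Q *v x \<in> W" for x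
  proof -
    have "(\<lambda>h. (transpose Q *v q (Q *v x)) \<bullet> h) = (\<lambda>h. q (Q *v x) \<bullet> (Q *v h))"
      by (metis dot_lmul_matrix vector_transpose_matrix transpose_transpose)
    then show ?thesis using has_derivative_compose[OF L has_grad_hessD(1)[OF r that]] by simp
  qed
  have 2: "((\<lambda>x. transpose Q *v q (Q *v x)) has_derivative (\<lambda>h. (transpose Q ** A (Q *v x) ** Q) *v h)) (at x)"
    if "Q *v x \<in> W" for x
    using bounded_linear.has_derivative[OF matrix_vector_mul_bounded_linear[of "transpose Q"]
        has_derivative_compose[OF L has_grad_hessD(2)[OF r that]]]
    by (simp add: matrix_vector_mul_assoc matrix_mul_assoc)
  have 3: "transpose (transpose Q ** A (Q *v x) ** Q) = transpose Q ** A (Q *v x) ** Q" if "Q *v x \<in> W" for x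
    using has_grad_hessD(3)[OF r that] by (simp add: matrix_transpose_mul matrix_mul_assoc)
  have 4: "continuous_on {x. Q *v x \<in> W} (\<lambda>x. transpose Q ** A (Q *v x) ** Q)"
  proof -
    have "continuous_on {x. Q *v x \<in> W} (\<lambda>x. A (Q *v x))"
      by (rule continuous_on_compose2[OF has_grad_hess_continuous(3)[OF r]])
         (auto intro: matrix_vector_mult_linear_continuous_on)
    then show ?thesis unfolding matrix_matrix_mult_def by (intro continuous_intros)
  qed
  show ?thesis unfolding has_grad_hess_def
  proof (intro conjI ballI)
    fix x assume "x \<in> {x. Q *v x \<in> W}"
    then have x: "Q *v x \<in> W" by simp
    show "((\<lambda>x. r (Q *v x)) has_derivative (\<lambda>h. (transpose Q *v q (Q *v x)) \<bullet> h)) (at x)"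
      "((\<lambda>x. transpose Q *v q (Q *v x)) has_derivative (\<lambda>h. (transpose Q ** A (Q *v x) ** Q) *v h)) (at x)"
      "transpose (transpose Q ** A (Q *v x) ** Q) = transpose Q ** A (Q *v x) ** Q"
      by (rule 1[OF x] 2[OF x] 3[OF x])+
  qed (rule 4)
qed

text \<open>Together with \<open>has_grad_hess_orthogonal\<close>: an orthogonal change of variables conjugates the conformal Hessian, and
  so leaves its eigenvalues alone.\<close>

lemma conformal_hessian_conjugate:
  assumes "orthogonal_matrix Q"
  shows "transpose Q ** conformal_hessian r q A ** Q = conformal_hessian r (transpose Q *v q) (transpose Q ** A ** Q)"
proof (rule matrix_eq[THEN iffD2], rule allI)
  fix x
  have o: "orthogonal_matrix (transpose Q)" using assms by (simp add: orthogonal_matrix_def)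
  have "transpose Q *v (Q *v x) = x"
    using assms by (simp add: orthogonal_matrix_def matrix_vector_mul_assoc)
  then show "(transpose Q ** conformal_hessian r q A ** Q) *v x
     = conformal_hessian r (transpose Q *v q) (transpose Q ** A ** Q) *v x"
    unfolding conformal_hessian_def
    by (simp add: matrix_vector_mul_assoc[symmetric] matrix_vector_mult_diff_rdistrib matrix_vector_mult_diff_distrib
        scaleR_matrix_vector_assoc[symmetric] mat_mult_vector matrix_vector_mult_scaleR orthogonal_matrix_inner[OF o]
        del: transpose_matrix_vector vector_transpose_matrix)
qed

definition inversion :: "real^'n \<Rightarrow> real \<Rightarrow> real^'n \<Rightarrow> real^'n" where
  "inversion a c y = a + (c / ((y - a) \<bullet> (y - a))) *\<^sub>R (y - a)"

lemma inversion_has_derivative: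
  assumes "y \<noteq> a"
  shows "(inversion a c has_derivative
           (\<lambda>h. (c / ((y - a) \<bullet> (y - a))) *\<^sub>R (reflection_matrix (y - a) *v h))) (at y)"
proof -
  have N: "(y - a) \<bullet> (y - a) \<noteq> 0" using assms by simp
  have "((\<lambda>y. a + (c / ((y - a) \<bullet> (y - a))) *\<^sub>R (y - a)) has_derivative
     (\<lambda>h. (c / ((y - a) \<bullet> (y - a))) *\<^sub>R h + (- c * (2 * ((y - a) \<bullet> h)) / ((y - a) \<bullet> (y - a))\<^sup>2) *\<^sub>R (y - a))) (at y)"
    using N by (auto intro!: derivative_eq_intros simp: power2_eq_square inner_commute divide_simps)
  then have "(inversion a c has_derivative
     (\<lambda>h. (c / ((y - a) \<bullet> (y - a))) *\<^sub>R h + (- c * (2 * ((y - a) \<bullet> h)) / ((y - a) \<bullet> (y - a))\<^sup>2) *\<^sub>R (y - a))) (at y)"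
    unfolding inversion_def[abs_def] .
  then show ?thesis
    by (rule has_derivative_eq_rhs)
       (auto simp: fun_eq_iff reflection_matrix_mult scaleR_diff_right power2_eq_square)
qed

lemma has_derivative_inner_quotient:
  assumes f: "(f has_derivative f') (at y)" and g: "(g has_derivative g') (at y)" and n: "f y \<bullet> f y \<noteq> 0"
  shows "((\<lambda>y. 2 * (f y \<bullet> g y) / (f y \<bullet> f y)) has_derivative
     (\<lambda>h. (2 * (f' h \<bullet> g y + f y \<bullet> g' h) * (f y \<bullet> f y) - 2 * (f y \<bullet> g y) * (2 * (f y \<bullet> f' h)))
        / ((f y \<bullet> f y) * (f y \<bullet> f y)))) (at y)"
proof -
  have 1: "((\<lambda>y. 2 * (f y \<bullet> g y)) has_derivative (\<lambda>h. 2 * (f' h \<bullet> g y + f y \<bullet> g' h))) (at y)"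
    using has_derivative_mult_right[OF has_derivative_inner[OF f g], of 2] by (simp add: add.commute)
  have 2: "((\<lambda>y. f y \<bullet> f y) has_derivative (\<lambda>h. 2 * (f y \<bullet> f' h))) (at y)"
    using has_derivative_inner[OF f f] by (simp add: inner_commute)
  show ?thesis by (rule has_derivative_divide'[OF 1 2 n])
qed

text \<open>Conformal covariance: pulling the metric \<open>r\<^sup>-\<^sup>2 |dx|\<^sup>2\<close> back by the inversion gives
  \<open>s\<^sup>-\<^sup>2 |dy|\<^sup>2\<close> with the function \<open>s\<close> below, and conjugates the conformal Hessian by the reflection \<open>R\<close>.
  In \<open>H\<close> the terms of the second derivative along \<open>y - a\<close> cancel, so that only a multiple of the identity
  is added to the conjugated Hessian; it is compensated by the change of the gradient term.\<close>

lemma has_grad_hess_inversion: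
  fixes r :: "real^'n \<Rightarrow> real" and a :: "real^'n" and c :: real
  assumes W: "open W" and r: "has_grad_hess W r q A" and c: "c \<noteq> 0"
  defines "V \<equiv> {y. y \<noteq> a \<and> inversion a c y \<in> W}"
  defines "R \<equiv> \<lambda>y. reflection_matrix (y - a)"
  defines "s \<equiv> \<lambda>y. ((y - a) \<bullet> (y - a)) / c * r (inversion a c y)"
  defines "g \<equiv> \<lambda>y. (2 * r (inversion a c y) / c) *\<^sub>R (y - a) + R y *v q (inversion a c y)"
  defines "H \<equiv> \<lambda>y. mat (2 * r (inversion a c y) / c - 2 * ((y - a) \<bullet> q (inversion a c y)) / ((y - a) \<bullet> (y - a)))
      + (c / ((y - a) \<bullet> (y - a))) *\<^sub>R (R y ** A (inversion a c y) ** R y)"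
  shows "has_grad_hess V s g H" and "open V"
    and "y \<in> V \<Longrightarrow> conformal_hessian (s y) (g y) (H y) =
       R y ** conformal_hessian (r (inversion a c y)) (q (inversion a c y)) (A (inversion a c y)) ** R y"
proof -
  have ci: "continuous_on (- {a}) (inversion a c)" unfolding inversion_def[abs_def]
    by (intro continuous_intros) auto
  have "V = - {a} \<inter> inversion a c -` W" by (auto simp: V_def)
  moreover have "open (- {a})" by (simp add: open_Compl)
  ultimately show "open V" using continuous_open_preimage[OF ci _ W] by metis
  have N: "(y - a) \<bullet> (y - a) \<noteq> 0" if "y \<in> V" for y using that by (simp add: V_def)
  have R: "R y *v x = x - (2 * ((y - a) \<bullet> x) / ((y - a) \<bullet> (y - a))) *\<^sub>R (y - a)" for x y
    by (simp add: R_def reflection_matrix_mult)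
  have Rsym: "x \<bullet> (R y *v x') = (R y *v x) \<bullet> x'" for x x' y
    unfolding R_def by (rule symmetric_matrix_inner[OF transpose_reflection_matrix])
  have Dr: "((\<lambda>y. r (inversion a c y)) has_derivative
        (\<lambda>h. (c / ((y - a) \<bullet> (y - a))) * (q (inversion a c y) \<bullet> (R y *v h)))) (at y)"
    and Dq: "((\<lambda>y. q (inversion a c y)) has_derivative
        (\<lambda>h. (c / ((y - a) \<bullet> (y - a))) *\<^sub>R (A (inversion a c y) *v (R y *v h)))) (at y)" if y: "y \<in> V" for y
  proof -
    have "y \<noteq> a" and iW: "inversion a c y \<in> W" using y by (auto simp: V_def)
    note I = inversion_has_derivative[OF this(1), of c, folded R_def]
    show "((\<lambda>y. r (inversion a c y)) has_derivative
        (\<lambda>h. (c / ((y - a) \<bullet> (y - a))) * (q (inversion a c y) \<bullet> (R y *v h)))) (at y)"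
      using has_derivative_compose[OF I has_grad_hessD(1)[OF r iW]] unfolding R_def by simp
    show "((\<lambda>y. q (inversion a c y)) has_derivative
        (\<lambda>h. (c / ((y - a) \<bullet> (y - a))) *\<^sub>R (A (inversion a c y) *v (R y *v h)))) (at y)"
      using has_derivative_compose[OF I has_grad_hessD(2)[OF r iW]] unfolding R_def by (simp add: matrix_vector_mult_scaleR)
  qed
  have 1: "(s has_derivative (\<lambda>h. g y \<bullet> h)) (at y)" if y: "y \<in> V" for y
  proof -
    have "(s has_derivative (\<lambda>h. ((y - a) \<bullet> (y - a)) / c * ((c / ((y - a) \<bullet> (y - a))) * (q (inversion a c y) \<bullet> (R y *v h)))
        + 2 * ((y - a) \<bullet> h) / c * r (inversion a c y))) (at y)"
      unfolding s_def
      by (rule derivative_eq_intros Dr[OF y] refl | simp add: c inner_commute)+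
    moreover have "((y - a) \<bullet> (y - a)) / c * ((c / ((y - a) \<bullet> (y - a))) * (q (inversion a c y) \<bullet> (R y *v h)))
        + 2 * ((y - a) \<bullet> h) / c * r (inversion a c y) = g y \<bullet> h" for h
      using N[OF y] c unfolding g_def Rsym by (simp add: inner_add_left)
    ultimately show ?thesis by simp
  qed
  have 2: "(g has_derivative (\<lambda>h. H y *v h)) (at y)" if y: "y \<in> V" for y
  proof -
    have g': "g = (\<lambda>y. (2 * r (inversion a c y) / c) *\<^sub>R (y - a) + (q (inversion a c y)
        - (2 * ((y - a) \<bullet> q (inversion a c y)) / ((y - a) \<bullet> (y - a))) *\<^sub>R (y - a)))"
      unfolding g_def R ..
    define z where "z = y - a"
    define Q where "Q = q (inversion a c y)"
    define \<rho> where "\<rho> = r (inversion a c y)"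
    define P where "P h = A (inversion a c y) *v (R y *v h)" for h
    have N': "z \<bullet> z \<noteq> 0" using N[OF y] by (simp add: z_def)
    have Dr': "((\<lambda>y. r (inversion a c y)) has_derivative (\<lambda>h. (c / (z \<bullet> z)) * (Q \<bullet> (R y *v h)))) (at y)"
      using Dr[OF y] unfolding z_def Q_def .
    have Dq': "((\<lambda>y. q (inversion a c y)) has_derivative (\<lambda>h. (c / (z \<bullet> z)) *\<^sub>R P h)) (at y)"
      using Dq[OF y] unfolding z_def P_def .
    have D1: "((\<lambda>y. (2 * r (inversion a c y) / c) *\<^sub>R (y - a)) has_derivative
       (\<lambda>h. (2 * \<rho> / c) *\<^sub>R h + (2 * ((c / (z \<bullet> z)) * (Q \<bullet> (R y *v h))) / c) *\<^sub>R z)) (at y)"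
      by (rule derivative_eq_intros Dr' refl | simp add: c \<rho>_def z_def)+
    have D3: "((\<lambda>y. y - a) has_derivative (\<lambda>h. h)) (at y)" by (auto intro!: derivative_eq_intros)
    have D2: "((\<lambda>y. 2 * ((y - a) \<bullet> q (inversion a c y)) / ((y - a) \<bullet> (y - a))) has_derivative
       (\<lambda>h. (2 * (h \<bullet> Q + z \<bullet> ((c / (z \<bullet> z)) *\<^sub>R P h)) * (z \<bullet> z) - 2 * (z \<bullet> Q) * (2 * (z \<bullet> h))) / ((z \<bullet> z) * (z \<bullet> z)))) (at y)"
      using has_derivative_inner_quotient[OF D3 Dq'] N' by (simp add: z_def Q_def)
    have "(g has_derivative (\<lambda>h. ((2 * \<rho> / c) *\<^sub>R h + (2 * ((c / (z \<bullet> z)) * (Q \<bullet> (R y *v h))) / c) *\<^sub>R z)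
       + ((c / (z \<bullet> z)) *\<^sub>R P h -
          ((2 * (z \<bullet> Q) / (z \<bullet> z)) *\<^sub>R h +
           ((2 * (h \<bullet> Q + z \<bullet> ((c / (z \<bullet> z)) *\<^sub>R P h)) * (z \<bullet> z) - 2 * (z \<bullet> Q) * (2 * (z \<bullet> h))) / ((z \<bullet> z) * (z \<bullet> z))) *\<^sub>R z)))) (at y)"
      unfolding g'
      using has_derivative_add[OF D1 has_derivative_diff[OF Dq' has_derivative_scaleR[OF D2 D3]]]
      by (simp add: z_def Q_def)
    moreover have "((2 * \<rho> / c) *\<^sub>R h + (2 * ((c / (z \<bullet> z)) * (Q \<bullet> (R y *v h))) / c) *\<^sub>R z)
       + ((c / (z \<bullet> z)) *\<^sub>R P h -
          ((2 * (z \<bullet> Q) / (z \<bullet> z)) *\<^sub>R h +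
           ((2 * (h \<bullet> Q + z \<bullet> ((c / (z \<bullet> z)) *\<^sub>R P h)) * (z \<bullet> z) - 2 * (z \<bullet> Q) * (2 * (z \<bullet> h))) / ((z \<bullet> z) * (z \<bullet> z))) *\<^sub>R z))
       = H y *v h" for h
    proof -
      have "H y *v h = (2 * \<rho> / c - 2 * (z \<bullet> Q) / (z \<bullet> z)) *\<^sub>R h + (c / (z \<bullet> z)) *\<^sub>R (R y *v P h)"
        unfolding H_def z_def[symmetric] Q_def[symmetric] \<rho>_def[symmetric] P_def
        by (simp add: matrix_vector_mult_add_rdistrib mat_mult_vector scaleR_matrix_vector_assoc[symmetric]
            matrix_vector_mul_assoc[symmetric])
      also have "R y *v P h = P h - (2 * (z \<bullet> P h) / (z \<bullet> z)) *\<^sub>R z" by (simp add: R z_def)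
      finally have e1: "H y *v h = (2 * \<rho> / c - 2 * (z \<bullet> Q) / (z \<bullet> z)) *\<^sub>R h
        + (c / (z \<bullet> z)) *\<^sub>R (P h - (2 * (z \<bullet> P h) / (z \<bullet> z)) *\<^sub>R z)" .
      have e2: "Q \<bullet> (R y *v h) = h \<bullet> Q - (2 * (z \<bullet> h) / (z \<bullet> z)) * (z \<bullet> Q)"
        by (simp add: R inner_diff_right inner_commute z_def)
      show ?thesis
        unfolding e1 e2 inner_scaleR_right vec_eq_iff
        using N' c by (auto simp: field_simps)
    qed
    ultimately show ?thesis by simp
  qed
  have 3: "transpose (H y) = H y" if y: "y \<in> V" for y
    using has_grad_hessD(3)[OF r] y
    by (simp add: H_def V_def R_def transpose_add transpose_scaleR transpose_mat matrix_transpose_mul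
        transpose_reflection_matrix matrix_mul_assoc)
  have 4: "continuous_on V H"
  proof -
    have i: "continuous_on V (inversion a c)" "inversion a c ` V \<subseteq> W"
      using continuous_on_subset[OF ci] by (auto simp: V_def)
    have "continuous_on V (\<lambda>y. r (inversion a c y))" "continuous_on V (\<lambda>y. q (inversion a c y))"
      "continuous_on V (\<lambda>y. A (inversion a c y))"
      by (rule continuous_on_compose2[OF has_grad_hess_continuous(1)[OF r] i]
          continuous_on_compose2[OF has_grad_hess_continuous(2)[OF r] i]
          continuous_on_compose2[OF has_grad_hess_continuous(3)[OF r] i])+
    moreover have "continuous_on V (\<lambda>y. R y)"
      unfolding R_def reflection_matrix_def using N by (intro continuous_intros) auto
    ultimately show ?thesis
      unfolding H_def matrix_matrix_mult_def using N c by (intro continuous_intros) auto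
  qed
  show "has_grad_hess V s g H" unfolding has_grad_hess_def using 1 2 3 4 by blast
  show "conformal_hessian (s y) (g y) (H y) =
       R y ** conformal_hessian (r (inversion a c y)) (q (inversion a c y)) (A (inversion a c y)) ** R y" if y: "y \<in> V"
  proof -
    define z where "z = y - a"
    define Q where "Q = q (inversion a c y)"
    define \<rho> where "\<rho> = r (inversion a c y)"
    define B where "B = A (inversion a c y)"
    have N': "z \<bullet> z \<noteq> 0" using N[OF y] by (simp add: z_def)
    have orth: "orthogonal_matrix (R y)" unfolding R_def using y by (intro orthogonal_reflection_matrix) (simp add: V_def)
    have tr: "transpose (R y) = R y" by (simp add: R_def transpose_reflection_matrix)
    have gg: "g y \<bullet> g y = 4 * \<rho>\<^sup>2 * (z \<bullet> z) / c\<^sup>2 - 4 * \<rho> * (z \<bullet> Q) / c + Q \<bullet> Q"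
    proof -
      have "z \<bullet> (R y *v Q) = - (z \<bullet> Q)" using N' by (simp add: R inner_diff_right z_def)
      moreover have "(R y *v Q) \<bullet> (R y *v Q) = Q \<bullet> Q" by (rule orthogonal_matrix_inner[OF orth])
      ultimately show ?thesis
        unfolding g_def z_def[symmetric] Q_def[symmetric] \<rho>_def[symmetric]
        by (simp add: inner_add_left inner_add_right inner_commute power2_eq_square algebra_simps)
    qed
    have RR: "R y ** conformal_hessian \<rho> Q B ** R y = conformal_hessian \<rho> (R y *v Q) (R y ** B ** R y)"
      using conformal_hessian_conjugate[OF orth, of \<rho> Q B] by (simp add: tr)
    show ?thesis
      unfolding Q_def[symmetric] \<rho>_def[symmetric] B_def[symmetric] RR
      unfolding conformal_hessian_def gg s_def H_def z_def[symmetric] Q_def[symmetric] \<rho>_def[symmetric] B_def[symmetric]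
        orthogonal_matrix_inner[OF orth]
      using N' c by (auto simp: vec_eq_iff mat_def field_simps power2_eq_square)
  qed
qed

section \<open>The barrier\<close>

text \<open>The barrier is Hopf's radial exponential times \<open>1 + y $ k\<close>.  The factor makes its derivative in the direction \<open>k\<close>
  strictly positive on the face \<open>y $ k = 0\<close>, inside the ball where the exponential exceeds \<open>c\<close>, even when the centre
  lies on that face.\<close>

lemma barrier_has_grad_hess:
  fixes p :: "real^'n" and a c :: real and k :: 'n
  defines "E \<equiv> \<lambda>y. exp (- a * (norm (y - p))\<^sup>2)"
  shows "has_grad_hess W (\<lambda>y. (1 + y $ k) * (E y - c))
     (\<lambda>y. (1 + y $ k) *\<^sub>R ((- 2 * a * E y) *\<^sub>R (y - p)) + (E y - c) *\<^sub>R axis k 1)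
     (\<lambda>y. (1 + y $ k) *\<^sub>R (E y *\<^sub>R (4 * a\<^sup>2) *\<^sub>R outer (y - p) (y - p) - mat (2 * a * E y))
         + outer ((- 2 * a * E y) *\<^sub>R (y - p)) (axis k 1) + outer (axis k 1) ((- 2 * a * E y) *\<^sub>R (y - p)))"
proof -
  have 1: "has_grad_hess W (\<lambda>y. - a * (norm (y - p))\<^sup>2) (\<lambda>y. (- a) *\<^sub>R 2 *\<^sub>R (y - p)) (\<lambda>y. (- a) *\<^sub>R mat 2)"
    by (rule has_grad_hess_cmult[OF has_grad_hess_norm_square])
  have 2: "has_grad_hess W (\<lambda>y. exp (- a * (norm (y - p))\<^sup>2) - c)
     (\<lambda>y. exp (- a * (norm (y - p))\<^sup>2) *\<^sub>R (- a) *\<^sub>R 2 *\<^sub>R (y - p))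
     (\<lambda>y. exp (- a * (norm (y - p))\<^sup>2) *\<^sub>R (- a) *\<^sub>R mat 2 + exp (- a * (norm (y - p))\<^sup>2) *\<^sub>R
       outer ((- a) *\<^sub>R 2 *\<^sub>R (y - p)) ((- a) *\<^sub>R 2 *\<^sub>R (y - p)))"
    by (rule has_grad_hess_compose_real[OF 1, where p = "\<lambda>x. exp x - c" and p' = exp and p'' = exp])
       (auto intro!: derivative_eq_intros continuous_intros)
  have g: "exp (- a * (norm (y - p))\<^sup>2) *\<^sub>R (- a) *\<^sub>R 2 *\<^sub>R (y - p) = (- 2 * a * E y) *\<^sub>R (y - p)" for y
    by (simp add: E_def)
  have h: "exp (- a * (norm (y - p))\<^sup>2) *\<^sub>R (- a) *\<^sub>R mat 2 + exp (- a * (norm (y - p))\<^sup>2) *\<^sub>R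
       outer ((- a) *\<^sub>R 2 *\<^sub>R (y - p)) ((- a) *\<^sub>R 2 *\<^sub>R (y - p))
      = E y *\<^sub>R (4 * a\<^sup>2) *\<^sub>R outer (y - p) (y - p) - mat (2 * a * E y)" for y
    unfolding E_def by (auto simp: vec_eq_iff outer_def mat_def power2_eq_square algebra_simps)
  from 2 have "has_grad_hess W (\<lambda>y. E y - c) (\<lambda>y. (- 2 * a * E y) *\<^sub>R (y - p))
     (\<lambda>y. E y *\<^sub>R (4 * a\<^sup>2) *\<^sub>R outer (y - p) (y - p) - mat (2 * a * E y))"
    unfolding g h unfolding E_def .
  from has_grad_hess_mult[OF has_grad_hess_affine[of W 1 k] this]
  show ?thesis by simp
qed

text \<open>Subtract a small multiple of the barrier from \<open>u - s\<close> and look at a negative minimum.  It is not on the inner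
  sphere, where \<open>u - s\<close> is bounded below, nor on the outer one, where the barrier vanishes.  On the face it
  would contradict the Neumann inequality, since the barrier has a positive derivative there.  At an interior point,
  \<open>u\<close> and \<open>s\<close> have nearly equal values and gradients, and the Hessian of \<open>u\<close> exceeds that of \<open>s\<close> by the Hessian of the
  barrier, which is large in the radial direction and only slightly negative in the others; this violates the ellipticity bound.\<close>

lemma hopf_barrier:
  fixes u s :: "real^'n \<Rightarrow> real" and p :: "real^'n" and k :: 'n
  defines "A r R \<equiv> {y. r \<le> norm (y - p) \<and> norm (y - p) \<le> R \<and> 0 \<le> y $ k}"
  assumes W: "open W" and u: "has_grad_hess W u gu Hu" and s: "has_grad_hess W s gs Hs"
    and geom: "0 < r" "r < R" "0 \<le> p $ k" "A r R \<subseteq> W"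
    and pos: "\<And>y. y \<in> A r R \<Longrightarrow> 0 < s y" "\<And>y. y \<in> A r R \<Longrightarrow> s y \<le> u y"
      "\<And>y. y \<in> A r R \<Longrightarrow> norm (y - p) = r \<Longrightarrow> s y < u y"
    and bd: "\<And>y. y \<in> A r R \<Longrightarrow> norm (y - p) < R \<Longrightarrow> y $ k = 0 \<Longrightarrow> gu y $ k \<le> gs y $ k"
    and ell: "C \<ge> 0" "\<And>y. y \<in> A r R \<Longrightarrow> norm (y - p) < R \<Longrightarrow> 0 < y $ k \<Longrightarrow>
        ellipticity_bound C (conformal_hessian (s y) (gs y) (Hs y)) (conformal_hessian (u y) (gu y) (Hu y))"
  obtains a \<epsilon> where "a > 0" "\<epsilon> > 0"
    "\<And>y. y \<in> A r R \<Longrightarrow> u y - s y \<ge> \<epsilon> * (exp (- a * (norm (y - p))\<^sup>2) - exp (- a * R\<^sup>2))"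
proof (cases "A r R = {}")
  case True
  then show ?thesis using that[of 1 1] by auto
next
  case False
  let ?A = "A r R"
  note Adef = A_def
  have cA: "compact ?A"
  proof -
    have "closed ?A" unfolding Adef
      by (intro closed_Collect_conj closed_Collect_le continuous_intros)
    moreover have "?A \<subseteq> cball p R" unfolding Adef by (auto simp: dist_norm norm_minus_commute)
    ultimately show ?thesis using compact_eq_bounded_closed bounded_subset bounded_cball by blast
  qed
  have cont: "continuous_on ?A u" "continuous_on ?A s" "continuous_on ?A gs" "continuous_on ?A Hs"
    using has_grad_hess_continuous[OF u] has_grad_hess_continuous[OF s] geom(4)
    by (auto intro: continuous_on_subset)
  obtain B where B: "\<And>y. y \<in> ?A \<Longrightarrow> norm (Hs y) \<le> B"
    using compact_imp_bounded[OF compact_continuous_image[OF cont(4) cA]] unfolding bounded_iff by auto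
  obtain B1 where B1: "\<And>y. y \<in> ?A \<Longrightarrow> norm (gs y) \<le> B1"
    using compact_imp_bounded[OF compact_continuous_image[OF cont(3) cA]] unfolding bounded_iff by auto
  obtain S2 where S2: "\<And>y. y \<in> ?A \<Longrightarrow> u y \<le> S2"
    using continuous_attains_sup[OF cA False cont(1)] by blast
  obtain s0 where s0: "s0 > 0" "\<And>y. y \<in> ?A \<Longrightarrow> s0 \<le> s y"
    using continuous_attains_inf[OF cA False cont(2)] pos(1) by blast
  obtain z0 where z0: "z0 \<in> ?A" using False by auto
  have nn: "B \<ge> 0" "B1 \<ge> 0" "S2 \<ge> 0" "R > 0"
    using B[OF z0] B1[OF z0] S2[OF z0] pos(1,2)[OF z0] geom norm_ge_zero[of "Hs z0"] norm_ge_zero[of "gs z0"]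
    by linarith+
  obtain m where m: "m > 0" "\<And>y. y \<in> ?A \<Longrightarrow> norm (y - p) = r \<Longrightarrow> m \<le> u y - s y"
  proof -
    have c: "compact (?A \<inter> {y. norm (y - p) = r})"
      by (intro compact_Int_closed cA closed_Collect_eq continuous_intros)
    show ?thesis
    proof (cases "?A \<inter> {y. norm (y - p) = r} = {}")
      case True
      then show ?thesis using that[of 1] by auto
    next
      case False
      have "continuous_on (?A \<inter> {y. norm (y - p) = r}) (\<lambda>y. u y - s y)"
        using cont by (auto intro!: continuous_intros intro: continuous_on_subset)
      from continuous_attains_inf[OF c False this] obtain z where
        "z \<in> ?A" "norm (z - p) = r" "\<And>y. y \<in> ?A \<Longrightarrow> norm (y - p) = r \<Longrightarrow> u z - s z \<le> u y - s y" by blast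
      then show ?thesis using pos(3)[of z] that[of "u z - s z"] by auto
    qed
  qed
  define Y where "Y = norm p + R"
  have Y: "\<bar>y $ k\<bar> \<le> Y" if "y \<in> ?A" for y
  proof -
    have "norm y \<le> norm p + norm (y - p)" using norm_triangle_ineq[of p "y - p"] by simp
    then show ?thesis using component_le_norm_cart[of y k] that unfolding Adef Y_def by auto
  qed
  have Y0: "Y \<ge> 0" using nn by (simp add: Y_def)
  define c1 where "c1 = 1 + 2 * (1 + Y) * R"
  define c2 where "c2 = 2 * (1 + Y) + 4 * R"
  define c3 where "c3 = (1 + Y) * B + S2 * c2 + B1 * c1 + c1\<^sup>2 / 2"
  have c: "c1 \<ge> 0" "c2 \<ge> 0" "c3 \<ge> 0" using nn Y0 by (auto simp: c1_def c2_def c3_def)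
  \<comment> \<open>the exponent is taken so large that the radial second derivative of the barrier, of order
    \<open>a\<^sup>2\<close>, dominates all error terms, of order \<open>a\<close>\<close>
  define a where "a = 1 + (CARD('n) + C) * c3 / (4 * s0 * r\<^sup>2)"
  have a1: "a \<ge> 1" using c ell(1) s0(1) by (simp add: a_def)
  have abig: "4 * a * s0 * r\<^sup>2 > (CARD('n) + C) * c3"
    using s0(1) geom(1) by (simp add: a_def field_simps)
  \<comment> \<open>the first bound absorbs the quadratic gradient term of the barrier, the second one keeps it below \<open>u - s\<close> on the
    inner sphere\<close>
  define \<epsilon> where "\<epsilon> = min (1 / a) (m / (1 + Y))"
  have eps: "\<epsilon> > 0" "\<epsilon> * a \<le> 1" "\<epsilon> * (1 + Y) \<le> m"
  proof -
    show "\<epsilon> > 0" using a1 m(1) Y0 by (simp add: \<epsilon>_def)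
    have "\<epsilon> \<le> 1 / a" "\<epsilon> \<le> m / (1 + Y)" by (auto simp: \<epsilon>_def)
    then show "\<epsilon> * a \<le> 1" "\<epsilon> * (1 + Y) \<le> m" using a1 Y0 by (auto simp: field_simps)
  qed
  define E where "E = (\<lambda>y. exp (- a * (norm (y - p))\<^sup>2))"
  define c where "c = exp (- a * R\<^sup>2)"
  define b where "b = (\<lambda>y. (1 + y $ k) * (E y - c))"
  define gb where "gb = (\<lambda>y. (1 + y $ k) *\<^sub>R ((- 2 * a * E y) *\<^sub>R (y - p)) + (E y - c) *\<^sub>R axis k 1)"
  define Hb where "Hb = (\<lambda>y. (1 + y $ k) *\<^sub>R (E y *\<^sub>R (4 * a\<^sup>2) *\<^sub>R outer (y - p) (y - p) - mat (2 * a * E y))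
         + outer ((- 2 * a * E y) *\<^sub>R (y - p)) (axis k 1) + outer (axis k 1) ((- 2 * a * E y) *\<^sub>R (y - p)))"
  have hb: "has_grad_hess W b gb Hb" unfolding b_def gb_def Hb_def E_def by (rule barrier_has_grad_hess)
  have E1: "0 < E y" "E y \<le> 1" for y using a1 by (auto simp: E_def)
  have Ec: "E y - c \<ge> 0" if "y \<in> ?A" for y
    using that a1 geom unfolding Adef E_def c_def by (auto intro!: mult_left_mono power_mono)
  have Ec': "E y - c > 0" if "norm (y - p) < R" for y
    using that a1 unfolding E_def c_def by (auto intro!: power_strict_mono)
  have bE: "0 \<le> b y" "b y \<le> (1 + Y) * E y" "E y - c \<le> b y" if "y \<in> ?A" for y
  proof -
    have yk: "0 \<le> y $ k" "y $ k \<le> Y" using that Y[OF that] by (auto simp: Adef)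
    show "0 \<le> b y" using yk Ec[OF that] by (simp add: b_def)
    have "c > 0" by (simp add: c_def)
    then show "b y \<le> (1 + Y) * E y" unfolding b_def using yk Ec[OF that] by (intro mult_mono) auto
    show "E y - c \<le> b y" unfolding b_def using yk Ec[OF that] by (simp add: mult_le_cancel_right1)
  qed
  define f where "f = (\<lambda>y. (u y - s y) - \<epsilon> * b y)"
  define gf where "gf = (\<lambda>y. (gu y - gs y) - \<epsilon> *\<^sub>R gb y)"
  define Hf where "Hf = (\<lambda>y. (Hu y - Hs y) - \<epsilon> *\<^sub>R Hb y)"
  have hf: "has_grad_hess W f gf Hf"
    unfolding f_def gf_def Hf_def by (intro has_grad_hess_diff has_grad_hess_cmult u s hb)
  have main: "f y \<ge> 0" if "y \<in> ?A" for y
  proof (rule ccontr)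
    assume "\<not> f y \<ge> 0"
    have cf: "continuous_on ?A f" using has_grad_hess_continuous(1)[OF hf] geom(4) continuous_on_subset by blast
    obtain y0 where y0: "y0 \<in> ?A" "\<And>z. z \<in> ?A \<Longrightarrow> f y0 \<le> f z"
      using continuous_attains_inf[OF cA False cf] by blast
    have neg: "f y0 < 0" using y0(2)[OF that] \<open>\<not> f y \<ge> 0\<close> by simp
    have y0W: "y0 \<in> W" using y0 geom by auto
    have nr: "r < norm (y0 - p)"
    proof (rule ccontr)
      assume "\<not> r < norm (y0 - p)"
      then have eq: "norm (y0 - p) = r" using y0 by (auto simp: Adef)
      have "\<epsilon> * b y0 \<le> \<epsilon> * ((1 + Y) * 1)"
        using bE(2)[OF y0(1)] E1(2)[of y0] eps(1) Y0 by (intro mult_left_mono order_trans[OF bE(2)[OF y0(1)]]) auto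
      then show False using m(2)[OF y0(1) eq] eps(3) neg by (simp add: f_def)
    qed
    have nR: "norm (y0 - p) < R"
    proof (rule ccontr)
      assume "\<not> norm (y0 - p) < R"
      then have "norm (y0 - p) = R" using y0 by (auto simp: Adef)
      then have "b y0 = 0" by (simp add: b_def E_def c_def)
      then show False using neg pos(2)[OF y0(1)] by (simp add: f_def)
    qed
    have yk: "0 \<le> y0 $ k" using y0 by (simp add: Adef)
    show False
    proof (cases "y0 $ k = 0")
      case True
      obtain \<delta> where \<delta>: "\<delta> > 0" "\<And>z. dist z y0 < \<delta> \<Longrightarrow> norm (z - p) \<in> {r<..<R}"
      proof -
        have "open ((\<lambda>z. norm (z - p)) -` {r<..<R})" by (intro continuous_open_vimage continuous_intros open_greaterThanLessThan)
        moreover have "y0 \<in> (\<lambda>z. norm (z - p)) -` {r<..<R}" using nr nR by auto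
        ultimately show ?thesis using that unfolding open_dist by (metis vimageE)
      qed
      have "y0 + t *\<^sub>R axis k 1 \<in> ?A" if "0 < t" "t < \<delta>" for t
        using \<delta>(2)[of "y0 + t *\<^sub>R axis k 1"] that yk by (auto simp: Adef dist_norm)
      then have "f y0 \<le> f (y0 + t *\<^sub>R axis k 1)" if "0 < t" "t < \<delta>" for t using that y0(2) by blast
      from min_along_ray_derivative[OF has_grad_hessD(1)[OF hf y0W] \<delta>(1) this]
      have "0 \<le> gf y0 $ k" by (simp add: inner_axis)
      moreover have "gb y0 $ k \<ge> E y0 - c"
        using True geom(3) a1 E1(1)[of y0] by (simp add: gb_def mult_nonneg_nonpos)
      then have "\<epsilon> * gb y0 $ k > 0" using eps(1) Ec'[OF nR] by simp
      moreover have "gu y0 $ k \<le> gs y0 $ k" using bd[OF y0(1) nR True] .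
      ultimately show False by (simp add: gf_def)
    next
      case False
      with yk have yk: "0 < y0 $ k" by simp
      define V where "V = W \<inter> {z. r < norm (z - p) \<and> norm (z - p) < R \<and> 0 < z $ k}"
      have V: "open V" unfolding V_def
        by (intro open_Int W open_Collect_conj open_Collect_less continuous_intros)
      have y0V: "y0 \<in> V" using y0W nr nR yk by (simp add: V_def)
      have minV: "f y0 \<le> f z" if "z \<in> V" for z
        using that y0(2)[of z] by (auto simp: V_def Adef)
      have hfV: "has_grad_hess V f gf Hf" by (rule has_grad_hess_subset[OF hf]) (auto simp: V_def)
      have g0: "gf y0 = 0" and H0: "\<And>x. 0 \<le> x \<bullet> (Hf y0 *v x)"
        using local_min_grad_hess[OF V hfV y0V minV] by auto
      define d where "d = y0 - p"
      have d: "norm d \<le> R" "r \<le> norm d" using nr nR by (auto simp: d_def)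
      define e where "e = \<epsilon> * a * E y0 * c3"
      have aE: "a * E y0 \<ge> 0" using a1 E1(1)[of y0] by simp
      have e0: "e \<ge> 0" using eps(1) a1 E1(1)[of y0] \<open>c3 \<ge> 0\<close> by (simp add: e_def)
      have w: "0 \<le> u y0 - s y0" "u y0 - s y0 \<le> \<epsilon> * ((1 + Y) * (a * E y0))"
      proof -
        show "0 \<le> u y0 - s y0" using pos(2)[OF y0(1)] by simp
        have "E y0 \<le> a * E y0" using a1 E1(1)[of y0] by simp
        then have "b y0 \<le> (1 + Y) * (a * E y0)"
          using bE(2)[OF y0(1)] Y0 by (meson add_nonneg_nonneg mult_left_mono order_trans zero_le_one)
        then have "\<epsilon> * b y0 \<le> \<epsilon> * ((1 + Y) * (a * E y0))" using eps(1) by simp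
        then show "u y0 - s y0 \<le> \<epsilon> * ((1 + Y) * (a * E y0))" using neg by (simp add: f_def)
      qed
      have us: "u y0 \<ge> s0" "u y0 \<le> S2" "0 < u y0" using s0 S2 y0(1) pos by force+
      have gueq: "gu y0 = gs y0 + \<epsilon> *\<^sub>R gb y0" using g0 by (simp add: gf_def algebra_simps)
      have ykY: "y0 $ k \<le> Y" using Y[OF y0(1)] by simp
      have ngb: "norm (gb y0) \<le> a * E y0 * c1"
      proof -
        have "norm (gb y0) \<le> norm ((1 + y0 $ k) *\<^sub>R ((- 2 * a * E y0) *\<^sub>R d)) + norm ((E y0 - c) *\<^sub>R (axis k 1 :: real^'n))"
          unfolding gb_def d_def by (rule norm_triangle_ineq)
        also have "\<dots> = (1 + y0 $ k) * (2 * a * E y0 * norm d) + (E y0 - c)"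
          using yk a1 E1(1)[of y0] Ec[OF y0(1)] by (simp add: abs_mult)
        also have "\<dots> \<le> (1 + Y) * (2 * a * E y0 * R) + a * E y0"
        proof (rule add_mono)
          show "(1 + y0 $ k) * (2 * a * E y0 * norm d) \<le> (1 + Y) * (2 * a * E y0 * R)"
            using ykY yk d a1 E1(1)[of y0] Y0 by (intro mult_mono) auto
          have "0 < c" by (simp add: c_def)
          moreover have "E y0 \<le> a * E y0" using a1 E1(1)[of y0] by simp
          ultimately show "E y0 - c \<le> a * E y0" by linarith
        qed
        also have "\<dots> = a * E y0 * c1" by (simp add: c1_def algebra_simps)
        finally show ?thesis .
      qed
      have gdiff: "gu y0 \<bullet> gu y0 - gs y0 \<bullet> gs y0 \<le> \<epsilon> * (a * E y0) * (2 * B1 * c1 + c1\<^sup>2)"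
      proof -
        have "gu y0 \<bullet> gu y0 - gs y0 \<bullet> gs y0 = 2 * \<epsilon> * (gs y0 \<bullet> gb y0) + \<epsilon>\<^sup>2 * (norm (gb y0))\<^sup>2"
          unfolding gueq power2_norm_eq_inner
          by (simp add: inner_add_left inner_add_right inner_commute power2_eq_square algebra_simps)
        also have "gs y0 \<bullet> gb y0 \<le> B1 * (a * E y0 * c1)"
          by (rule order_trans[OF norm_cauchy_schwarz]) (use B1[OF y0(1)] ngb nn in \<open>auto intro!: mult_mono\<close>)
        also have "(norm (gb y0))\<^sup>2 \<le> (a * E y0 * c1)\<^sup>2" using ngb by (simp add: power_mono)
        also have "2 * \<epsilon> * (B1 * (a * E y0 * c1)) + \<epsilon>\<^sup>2 * (a * E y0 * c1)\<^sup>2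
          = \<epsilon> * (a * E y0) * (2 * B1 * c1) + (\<epsilon> * (a * E y0)) * ((\<epsilon> * a) * E y0) * c1\<^sup>2"
          by (simp add: power2_eq_square algebra_simps)
        also have "(\<epsilon> * (a * E y0)) * ((\<epsilon> * a) * E y0) * c1\<^sup>2 \<le> (\<epsilon> * (a * E y0)) * 1 * c1\<^sup>2"
        proof -
          have "(\<epsilon> * a) * E y0 \<le> 1 * 1" using eps E1[of y0] a1 by (intro mult_mono) auto
          then show ?thesis using eps(1) aE by (intro mult_right_mono mult_left_mono) auto
        qed
        finally show ?thesis using eps(1) by (simp add: algebra_simps)
      qed
      have Hbx: "x \<bullet> (Hb y0 *v x) \<ge> 4 * a\<^sup>2 * E y0 * (d \<bullet> x)\<^sup>2 - a * E y0 * c2 * (x \<bullet> x)" for x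
      proof -
        have eq: "x \<bullet> (Hb y0 *v x) = (1 + y0 $ k) * (4 * a\<^sup>2 * E y0 * (d \<bullet> x)\<^sup>2 - 2 * a * E y0 * (x \<bullet> x))
            - 4 * (a * E y0) * (x $ k * (d \<bullet> x))"
          unfolding Hb_def d_def[symmetric]
          by (simp add: matrix_vector_mult_add_rdistrib matrix_vector_mult_diff_rdistrib scaleR_matrix_vector_assoc[symmetric]
              outer_mult mat_mult_vector inner_add_right inner_diff_right inner_axis inner_axis' inner_commute
              power2_eq_square algebra_simps)
        have "x $ k * (d \<bullet> x) \<le> \<bar>x $ k\<bar> * \<bar>d \<bullet> x\<bar>" by (metis abs_ge_self abs_mult)
        also have "\<dots> \<le> norm x * (R * norm x)"
          using component_le_norm_cart[of x k] Cauchy_Schwarz_ineq2[of d x] d(1)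
          by (intro mult_mono order_trans[OF Cauchy_Schwarz_ineq2[of d x]] mult_right_mono) auto
        also have "\<dots> = R * (x \<bullet> x)" by (simp add: dot_square_norm power2_eq_square)
        finally have 1: "4 * (a * E y0) * (x $ k * (d \<bullet> x)) \<le> 4 * (a * E y0) * (R * (x \<bullet> x))"
          using aE by (intro mult_left_mono) auto
        have "4 * a\<^sup>2 * E y0 * (d \<bullet> x)\<^sup>2 \<ge> 0" using E1(1)[of y0] by simp
        then have 2: "(1 + y0 $ k) * (4 * a\<^sup>2 * E y0 * (d \<bullet> x)\<^sup>2) \<ge> 4 * a\<^sup>2 * E y0 * (d \<bullet> x)\<^sup>2"
          using yk by (simp add: mult_le_cancel_right1)
        have 3: "(1 + y0 $ k) * (2 * a * E y0 * (x \<bullet> x)) \<le> (1 + Y) * (2 * a * E y0 * (x \<bullet> x))"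
          using ykY aE by (intro mult_right_mono) auto
        show ?thesis unfolding eq c2_def using 1 2 3 by (simp add: algebra_simps)
      qed
      let ?Mu = "conformal_hessian (u y0) (gu y0) (Hu y0)" and ?Ms = "conformal_hessian (s y0) (gs y0) (Hs y0)"
      have Q: "x \<bullet> (?Mu *v x) \<ge> x \<bullet> (?Ms *v x) + 4 * \<epsilon> * a\<^sup>2 * E y0 * s0 * (d \<bullet> x)\<^sup>2 - e * (x \<bullet> x)" for x
      proof -
        have xx: "x \<bullet> x \<ge> 0" by simp
        have "x \<bullet> (Hu y0 *v x) \<ge> x \<bullet> (Hs y0 *v x) + \<epsilon> * (x \<bullet> (Hb y0 *v x))"
          using H0[of x] unfolding Hf_def
          by (simp add: matrix_vector_mult_diff_rdistrib scaleR_matrix_vector_assoc[symmetric] inner_diff_right)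
        moreover have "\<epsilon> * (x \<bullet> (Hb y0 *v x)) \<ge> \<epsilon> * (4 * a\<^sup>2 * E y0 * (d \<bullet> x)\<^sup>2 - a * E y0 * c2 * (x \<bullet> x))"
          using Hbx[of x] eps(1) by simp
        ultimately have "x \<bullet> (Hu y0 *v x) \<ge> x \<bullet> (Hs y0 *v x)
            + \<epsilon> * (4 * a\<^sup>2 * E y0 * (d \<bullet> x)\<^sup>2 - a * E y0 * c2 * (x \<bullet> x))" by linarith
        then have "u y0 * (x \<bullet> (Hu y0 *v x)) \<ge> u y0 * (x \<bullet> (Hs y0 *v x)
            + \<epsilon> * (4 * a\<^sup>2 * E y0 * (d \<bullet> x)\<^sup>2 - a * E y0 * c2 * (x \<bullet> x)))"
          using us(3) by simp
        then have 1: "u y0 * (x \<bullet> (Hu y0 *v x)) \<ge> s y0 * (x \<bullet> (Hs y0 *v x)) + (u y0 - s y0) * (x \<bullet> (Hs y0 *v x))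
            + u y0 * (4 * \<epsilon> * a\<^sup>2 * E y0 * (d \<bullet> x)\<^sup>2) - u y0 * (\<epsilon> * (a * E y0) * c2 * (x \<bullet> x))"
          by (simp add: algebra_simps)
        have "\<bar>x \<bullet> (Hs y0 *v x)\<bar> \<le> norm x * (norm (Hs y0) * norm x)"
          using Cauchy_Schwarz_ineq2[of x "Hs y0 *v x"] norm_matrix_vector_mult_le[of "Hs y0" x]
          by (meson mult_left_mono norm_ge_zero order_trans)
        also have "\<dots> \<le> norm x * (B * norm x)" using B[OF y0(1)] by (intro mult_left_mono mult_right_mono) auto
        finally have "- (B * (x \<bullet> x)) \<le> x \<bullet> (Hs y0 *v x)" by (simp add: dot_square_norm power2_eq_square algebra_simps)
        then have "(u y0 - s y0) * (- (B * (x \<bullet> x))) \<le> (u y0 - s y0) * (x \<bullet> (Hs y0 *v x))"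
          using w(1) by (rule mult_left_mono)
        moreover have "(u y0 - s y0) * (B * (x \<bullet> x)) \<le> (\<epsilon> * ((1 + Y) * (a * E y0))) * (B * (x \<bullet> x))"
          using w(2) nn(1) by (intro mult_right_mono) auto
        ultimately have 2: "(u y0 - s y0) * (x \<bullet> (Hs y0 *v x)) \<ge> - (\<epsilon> * (a * E y0) * ((1 + Y) * B) * (x \<bullet> x))"
          by (simp add: algebra_simps)
        have 3: "u y0 * (4 * \<epsilon> * a\<^sup>2 * E y0 * (d \<bullet> x)\<^sup>2) \<ge> s0 * (4 * \<epsilon> * a\<^sup>2 * E y0 * (d \<bullet> x)\<^sup>2)"
          using us(1) eps(1) E1(1)[of y0] by (intro mult_right_mono) auto
        have 4: "u y0 * (\<epsilon> * (a * E y0) * c2 * (x \<bullet> x)) \<le> S2 * (\<epsilon> * (a * E y0) * c2 * (x \<bullet> x))"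
          using us(2) eps(1) aE \<open>c2 \<ge> 0\<close> by (intro mult_right_mono) auto
        have 5: "(gu y0 \<bullet> gu y0) / 2 * (x \<bullet> x) - (gs y0 \<bullet> gs y0) / 2 * (x \<bullet> x)
            \<le> \<epsilon> * (a * E y0) * (B1 * c1 + c1\<^sup>2 / 2) * (x \<bullet> x)"
          using mult_right_mono[OF gdiff xx] by (simp add: algebra_simps)
        have "e * (x \<bullet> x) = \<epsilon> * (a * E y0) * ((1 + Y) * B) * (x \<bullet> x) + S2 * (\<epsilon> * (a * E y0) * c2 * (x \<bullet> x))
            + \<epsilon> * (a * E y0) * (B1 * c1 + c1\<^sup>2 / 2) * (x \<bullet> x)"
          unfolding e_def c3_def by (simp add: algebra_simps)
        then show ?thesis unfolding conformal_hessian_form using 1 2 3 4 5 by (simp add: mult_ac)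
      qed
      have form: "x \<bullet> (?Mu *v x) \<ge> x \<bullet> (?Ms *v x) - e * (x \<bullet> x)" for x
      proof -
        have "0 \<le> 4 * \<epsilon> * a\<^sup>2 * E y0 * s0 * (d \<bullet> x)\<^sup>2" using eps(1) E1(1)[of y0] s0(1) by simp
        then show ?thesis using Q[of x] by linarith
      qed
      have "trace ?Mu - trace ?Ms \<ge> (\<Sum>i\<in>UNIV. 4 * \<epsilon> * a\<^sup>2 * E y0 * s0 * (d $ i)\<^sup>2 - e)"
        unfolding trace_eq_sum_form sum_subtractf[symmetric]
      proof (rule sum_mono)
        fix i
        show "4 * \<epsilon> * a\<^sup>2 * E y0 * s0 * (d $ i)\<^sup>2 - e \<le> axis i 1 \<bullet> (?Mu *v axis i 1) - axis i 1 \<bullet> (?Ms *v axis i 1)"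
          using Q[of "axis i 1"] by (simp add: inner_axis)
      qed
      also have "(\<Sum>i\<in>UNIV. 4 * \<epsilon> * a\<^sup>2 * E y0 * s0 * (d $ i)\<^sup>2 - e)
          = 4 * \<epsilon> * a\<^sup>2 * E y0 * s0 * (norm d)\<^sup>2 - CARD('n) * e"
      proof -
        have "(norm d)\<^sup>2 = (\<Sum>i\<in>UNIV. (d $ i)\<^sup>2)"
          unfolding power2_norm_eq_inner inner_vec_def by (simp add: power2_eq_square)
        then show ?thesis by (simp add: sum_subtractf sum_distrib_left)
      qed
      finally have "4 * \<epsilon> * a\<^sup>2 * E y0 * s0 * (norm d)\<^sup>2 - CARD('n) * e \<le> C * e"
        using ell(2)[OF y0(1) nR yk] e0 form unfolding ellipticity_bound_def by fastforce
      moreover have "4 * \<epsilon> * a\<^sup>2 * E y0 * s0 * r\<^sup>2 \<le> 4 * \<epsilon> * a\<^sup>2 * E y0 * s0 * (norm d)\<^sup>2"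
        using d geom eps(1) E1(1)[of y0] s0(1) by (intro mult_left_mono power_mono) auto
      ultimately have "(\<epsilon> * a * E y0) * (4 * a * s0 * r\<^sup>2) \<le> (\<epsilon> * a * E y0) * ((CARD('n) + C) * c3)"
        by (simp add: e_def algebra_simps power2_eq_square)
      moreover have "\<epsilon> * a * E y0 > 0" using eps(1) a1 E1(1)[of y0] by simp
      ultimately have "4 * a * s0 * r\<^sup>2 \<le> (CARD('n) + C) * c3" by (rule mult_left_le_imp_le)
      then show False using abig by simp
    qed
  qed
  show ?thesis
  proof (rule that[of a \<epsilon>])
    show "a > 0" using a1 by simp
    show "\<epsilon> > 0" by (rule eps)
    fix y assume y: "y \<in> ?A"
    have "\<epsilon> * (E y - c) \<le> \<epsilon> * b y" using bE(3)[OF y] eps(1) by simp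
    then show "u y - s y \<ge> \<epsilon> * (exp (- a * (norm (y - p))\<^sup>2) - exp (- a * R\<^sup>2))"
      using main[OF y] by (simp add: f_def E_def c_def)
  qed
qed

section \<open>Strong comparison and moving spheres\<close>

definition half_ball :: "'n \<Rightarrow> real \<Rightarrow> (real^'n) set" where
  "half_ball k R = {y. norm y \<le> R \<and> 0 \<le> y $ k}"

lemma compact_half_ball:
  fixes k :: "'n::finite"
  shows "compact (half_ball k R)"
proof -
  have "half_ball k R = cball 0 R \<inter> {y :: real^'n. 0 \<le> y $ k}" by (auto simp: half_ball_def)
  moreover have "closed {y :: real^'n. 0 \<le> y $ k}" by (intro closed_Collect_le continuous_intros)
  ultimately show ?thesis by (simp add: compact_Int_closed)
qed

text \<open>Positivity of \<open>u - s\<close> at a point spreads to every ball around it whose part in the half space stays below radius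
  \<open>L\<close>, because the barrier is positive inside the ball.  Connectedness gives positivity up to the
  sphere, and the barrier centred at the origin then gives the growth from the whole spherical part at once, the
  corner included.\<close>

lemma strong_comparison:
  fixes u s :: "real^'n \<Rightarrow> real" and k :: 'n
  assumes W: "open W" and u: "has_grad_hess W u gu Hu" and s: "has_grad_hess W s gs Hs"
    and geom: "0 < L" "half_ball k L \<subseteq> W"
    and pos: "\<And>y. y \<in> half_ball k L \<Longrightarrow> 0 < s y" "\<And>y. y \<in> half_ball k L \<Longrightarrow> s y \<le> u y"
    and bd: "\<And>y. norm y < L \<Longrightarrow> y $ k = 0 \<Longrightarrow> gu y $ k \<le> gs y $ k"
    and ell: "C \<ge> 0" "\<And>y. norm y < L \<Longrightarrow> 0 < y $ k \<Longrightarrow>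
        ellipticity_bound C (conformal_hessian (s y) (gs y) (Hs y)) (conformal_hessian (u y) (gu y) (Hu y))"
    and ne: "norm z < L" "0 \<le> z $ k" "u z \<noteq> s z"
  shows "\<And>y. norm y < L \<Longrightarrow> 0 \<le> y $ k \<Longrightarrow> s y < u y"
    and "\<exists>a>0. \<exists>\<epsilon>>0. \<forall>y\<in>half_ball k L. L / 2 \<le> norm y \<longrightarrow>
           u y - s y \<ge> \<epsilon> * (exp (- a * (norm y)\<^sup>2) - exp (- a * L\<^sup>2))"
proof -
  let ?O = "{y :: real^'n. norm y < L \<and> 0 \<le> y $ k}"
  have Osub: "y \<in> half_ball k L" if "y \<in> ?O" for y using that by (auto simp: half_ball_def)
  have cont: "continuous_on W (\<lambda>y. u y - s y)"
    using has_grad_hess_continuous(1)[OF u] has_grad_hess_continuous(1)[OF s] by (intro continuous_intros)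
  have spread: "s y < u y" if x: "x \<in> ?O" "s x < u x" and y: "y \<in> ?O" "norm (y - x) < R" and R: "norm x + R < L" for x y R
  proof -
    have "open (W \<inter> (\<lambda>y. u y - s y) -` {0<..})"
      by (rule continuous_open_preimage[OF cont W open_greaterThan])
    moreover have "x \<in> W \<inter> (\<lambda>y. u y - s y) -` {0<..}" using x geom(2) Osub by auto
    ultimately obtain r0 where r0: "r0 > 0" "ball x r0 \<subseteq> W \<inter> (\<lambda>y. u y - s y) -` {0<..}"
      unfolding open_contains_ball by blast
    have Rpos: "R > 0" using y(2) norm_ge_zero[of "y - x"] by linarith
    define r where "r = min r0 R / 2"
    have r: "0 < r" "r < r0" "r < R" using r0(1) Rpos by (auto simp: r_def min_def)
    have near: "s q < u q" if "norm (q - x) \<le> r" for q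
      using subsetD[OF r0(2), of q] that r by (auto simp: dist_norm norm_minus_commute)
    have sub: "norm q < L" if "norm (q - x) \<le> R" for q
      using norm_triangle_ineq[of x "q - x"] that R by simp
    show ?thesis
    proof (cases "norm (y - x) \<le> r")
      case True
      then show ?thesis by (rule near)
    next
      case False
      have *: "q \<in> half_ball k L \<and> norm q < L" if "q \<in> {q. r \<le> norm (q - x) \<and> norm (q - x) \<le> R \<and> 0 \<le> q $ k}" for q
        using that sub[of q] by (auto simp: half_ball_def)
      obtain a \<epsilon> where a: "a > 0" "\<epsilon> > 0" and
        ge: "\<And>q. q \<in> {q. r \<le> norm (q - x) \<and> norm (q - x) \<le> R \<and> 0 \<le> q $ k} \<Longrightarrow>
           u q - s q \<ge> \<epsilon> * (exp (- a * (norm (q - x))\<^sup>2) - exp (- a * R\<^sup>2))"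
      proof (rule hopf_barrier[OF W u s r(1) r(3), of x k C])
        show "0 \<le> x $ k" using x by simp
        show "{q. r \<le> norm (q - x) \<and> norm (q - x) \<le> R \<and> 0 \<le> q $ k} \<subseteq> W" using * geom(2) by blast
      qed (use * pos near bd ell in auto)
      have "(norm (y - x))\<^sup>2 < R\<^sup>2" using y(2) by (intro power_strict_mono) auto
      then have "exp (- a * (norm (y - x))\<^sup>2) - exp (- a * R\<^sup>2) > 0" using a by simp
      then have "0 < \<epsilon> * (exp (- a * (norm (y - x))\<^sup>2) - exp (- a * R\<^sup>2))" using a by simp
      also have "\<dots> \<le> u y - s y" using False y by (intro ge) auto
      finally show ?thesis by simp
    qed
  qed
  have "convex ?O"
  proof -
    have "?O = ball 0 L \<inter> {y. axis k 1 \<bullet> y \<ge> 0}" by (auto simp: inner_axis')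
    then show ?thesis by (simp add: convex_Int convex_halfspace_ge)
  qed
  then have conn: "connected ?O" by (rule convex_connected)
  have zO: "z \<in> ?O" "s z < u z" using ne pos(2)[of z] by (auto simp: half_ball_def)
  show all: "s y < u y" if y: "norm y < L" "0 \<le> y $ k" for y
  proof (rule connected_induction_simple[OF conn, where P = "\<lambda>y. s y < u y" and a = z and b = y])
    show "z \<in> ?O" "s z < u z" by (rule zO)+
    show "y \<in> ?O" using y by simp
    fix a assume a: "a \<in> ?O"
    define \<rho> where "\<rho> = (L - norm a) / 4"
    have \<rho>: "\<rho> > 0" using a by (simp add: \<rho>_def)
    show "\<exists>T. openin (top_of_set ?O) T \<and> a \<in> T \<and> (\<forall>x\<in>T. \<forall>y\<in>T. s x < u x \<longrightarrow> s y < u y)"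
    proof (intro exI conjI ballI impI)
      show "openin (top_of_set ?O) (?O \<inter> ball a \<rho>)" by (simp add: openin_open_Int)
      show "a \<in> ?O \<inter> ball a \<rho>" using a \<rho> by simp
      fix x y assume xy: "x \<in> ?O \<inter> ball a \<rho>" "y \<in> ?O \<inter> ball a \<rho>" "s x < u x"
      have yx: "norm (y - x) < 2 * \<rho>"
        using xy dist_triangle_half_r[of a y "2 * \<rho>" x] by (simp add: dist_norm norm_minus_commute)
      have "norm x \<le> norm a + \<rho>"
        using xy norm_triangle_ineq[of a "x - a"] by (simp add: dist_norm norm_minus_commute)
      moreover have "L = norm a + 4 * \<rho>" by (simp add: \<rho>_def field_simps)
      ultimately have "norm x + 2 * \<rho> < L" using \<rho> by linarith
      then show "s y < u y" using spread xy \<open>norm (y - x) < 2 * \<rho>\<close> by blast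
    qed
  qed
  show "\<exists>a>0. \<exists>\<epsilon>>0. \<forall>y\<in>half_ball k L. L / 2 \<le> norm y \<longrightarrow>
           u y - s y \<ge> \<epsilon> * (exp (- a * (norm y)\<^sup>2) - exp (- a * L\<^sup>2))"
  proof -
    have "(\<exists>a \<epsilon>. 0 < a \<and> 0 < \<epsilon> \<and> (\<forall>y. y \<in> {y. L / 2 \<le> norm (y - 0) \<and> norm (y - 0) \<le> L \<and> 0 \<le> y $ k} \<longrightarrow>
        \<epsilon> * (exp (- a * (norm (y - 0))\<^sup>2) - exp (- a * L\<^sup>2)) \<le> u y - s y))"
    proof (rule hopf_barrier[OF W u s, of "L / 2" L 0 k C])
      show "{y. L / 2 \<le> norm (y - 0) \<and> norm (y - 0) \<le> L \<and> 0 \<le> y $ k} \<subseteq> W"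
        using geom(2) by (auto simp: half_ball_def)
      show "s y < u y" if "y \<in> {y. L / 2 \<le> norm (y - 0) \<and> norm (y - 0) \<le> L \<and> 0 \<le> y $ k}" "norm (y - 0) = L / 2" for y
        using that all geom(1) by auto
    qed (use geom pos bd ell in \<open>auto simp: half_ball_def\<close>)
    then show ?thesis by (auto simp: half_ball_def)
  qed
qed

text \<open>The reflected function is \<open>u L\<close>, and \<open>good L\<close> is the claim \<open>s \<le> u L\<close>.  The set of radii above which all
  radii are good is nonempty and has a positive infimum; the infimum is good by continuity, and goodness is an open
  condition by the strong comparison, so the infimum could be lowered.\<close>

lemma moving_spheres:
  fixes s t :: "real^'n \<Rightarrow> real" and k :: 'n
  assumes W: "open W" "{y. 0 \<le> y $ k} \<subseteq> W"
    and s: "has_grad_hess W s gs Hs" and t: "has_grad_hess W t gt Ht"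
    and pos: "\<And>y. 0 \<le> y $ k \<Longrightarrow> 0 < s y" "\<And>y. 0 \<le> y $ k \<Longrightarrow> 0 < t y"
    and inv: "\<And>y. 0 \<le> y $ k \<Longrightarrow> y \<noteq> 0 \<Longrightarrow> s y = (norm y)\<^sup>2 * t (y /\<^sub>R (norm y)\<^sup>2)"
    and ell: "\<And>L. L > 0 \<Longrightarrow> \<exists>C\<ge>0. \<forall>y. norm y < L \<longrightarrow> 0 < y $ k \<longrightarrow>
        ellipticity_bound C (conformal_hessian (s y) (gs y) (Hs y))
          (conformal_hessian (t (y /\<^sub>R L\<^sup>2)) (gt (y /\<^sub>R L\<^sup>2)) (Ht (y /\<^sub>R L\<^sup>2)))"
    and bd: "\<And>L y. L > 0 \<Longrightarrow> norm y < L \<Longrightarrow> y $ k = 0 \<Longrightarrow> gt (y /\<^sub>R L\<^sup>2) $ k \<le> gs y $ k"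
    and rigid: "\<And>L. L > 0 \<Longrightarrow> \<exists>y. norm y < L \<and> 0 \<le> y $ k \<and> L\<^sup>2 * t (y /\<^sub>R L\<^sup>2) \<noteq> s y"
  shows False
proof -
  define u where "u L y = L\<^sup>2 * t (y /\<^sub>R L\<^sup>2)" for L y
  define good where "good L \<longleftrightarrow> (\<forall>y\<in>half_ball k L. s y \<le> u L y)" for L
  have hW: "y \<in> W" if "0 \<le> y $ k" for y using that W(2) by auto
  have cont: "continuous_on W s" "continuous_on W t" "continuous_on W gs" "continuous_on W gt"
    using has_grad_hess_continuous[OF s] has_grad_hess_continuous[OF t] by auto
  have isC: "isCont s y" "isCont t y" "isCont gs y" "isCont gt y" if "0 \<le> y $ k" for y
    using cont W(1) hW[OF that] by (simp_all add: continuous_on_eq_continuous_at)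
  have half_scale: "0 \<le> (y /\<^sub>R c) $ k" if "0 \<le> y $ k" "0 \<le> c" for y :: "real^'n" and c
    unfolding vector_scaleR_component using that by (intro scaleR_nonneg_nonneg) auto
  have t_along_ray: "((\<lambda>r. t (r *\<^sub>R w)) has_real_derivative gt (r *\<^sub>R w) \<bullet> w) (at r)"
    if "0 \<le> w $ k" "0 \<le> r" for r w
  proof -
    have "((\<lambda>r. t (r *\<^sub>R w)) has_derivative (\<lambda>h. gt (r *\<^sub>R w) \<bullet> (h *\<^sub>R w))) (at r)"
      by (rule has_derivative_compose[where g=t, OF _ has_grad_hessD(1)[OF t]])
         (use that hW in \<open>auto intro!: derivative_eq_intros\<close>)
    then show ?thesis by (simp add: has_field_derivative_def mult_commute_abs)
  qed
  have s_along_ray: "((\<lambda>r. s (r *\<^sub>R w)) has_real_derivative gs (r *\<^sub>R w) \<bullet> w) (at r)"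
    if "0 \<le> w $ k" "0 \<le> r" for r w
  proof -
    have "((\<lambda>r. s (r *\<^sub>R w)) has_derivative (\<lambda>h. gs (r *\<^sub>R w) \<bullet> (h *\<^sub>R w))) (at r)"
      by (rule has_derivative_compose[where g=s, OF _ has_grad_hessD(1)[OF s]])
         (use that hW in \<open>auto intro!: derivative_eq_intros\<close>)
    then show ?thesis by (simp add: has_field_derivative_def mult_commute_abs)
  qed
  have u_along_ray: "((\<lambda>r. u L (r *\<^sub>R w) - s (r *\<^sub>R w)) has_real_derivative
      (gt ((r *\<^sub>R w) /\<^sub>R L\<^sup>2) - gs (r *\<^sub>R w)) \<bullet> w) (at r)" if "0 \<le> w $ k" "0 \<le> r" "L > 0" for r w L
  proof -
    have "((\<lambda>r. t (r *\<^sub>R (w /\<^sub>R L\<^sup>2))) has_real_derivative gt (r *\<^sub>R (w /\<^sub>R L\<^sup>2)) \<bullet> (w /\<^sub>R L\<^sup>2)) (at r)"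
      using that by (intro t_along_ray) auto
    from DERIV_diff[OF DERIV_cmult[OF this, of "L\<^sup>2"] s_along_ray[OF that(1,2)]] that(3)
    show ?thesis by (simp add: u_def inner_diff_left mult.commute mult.assoc[symmetric] del: mult_scaleR_left)
  qed
  have sphere_eq: "u L y = s y" if "norm y = L" "0 \<le> y $ k" "L > 0" for L y
    using inv[of y] that by (auto simp: u_def)

  \<comment> \<open>large radii are good: near the origin \<open>t(\<rho>w)/\<rho>\<close> decreases in \<open>\<rho>\<close>, which settles the points outside
    radius \<open>1/\<delta>\<close>, and on the ball of that radius \<open>s\<close> is bounded while \<open>L\<^sup>2 t\<close> is large\<close>
  have start: "\<exists>L0>0. \<forall>L\<ge>L0. good L"
  proof -
    have c1: "half_ball k 1 \<noteq> ({} :: (real^'n) set)" by (auto simp: half_ball_def intro!: exI[of _ 0])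
    have sub: "half_ball k R \<subseteq> W" for R using hW by (auto simp: half_ball_def)
    obtain c where c: "c > 0" "\<And>z. z \<in> half_ball k 1 \<Longrightarrow> c \<le> t z"
      using continuous_attains_inf[OF compact_half_ball c1 continuous_on_subset[OF cont(2) sub]] pos(2)
      by (metis (mono_tags, lifting) half_ball_def mem_Collect_eq)
    obtain B where B: "\<And>z. z \<in> half_ball k 1 \<Longrightarrow> norm (gt z) \<le> B"
      using compact_imp_bounded[OF compact_continuous_image[OF continuous_on_subset[OF cont(4) sub[of 1]] compact_half_ball]]
      unfolding bounded_iff by blast
    have B0: "B \<ge> 0" by (rule order_trans[OF norm_ge_zero B[of 0]]) (simp add: half_ball_def)
    define \<delta> where "\<delta> = min 1 (c / (B + 1))"
    have \<delta>: "0 < \<delta>" "\<delta> \<le> 1" "\<delta> * B < c"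
    proof -
      show "0 < \<delta>" "\<delta> \<le> 1" using c B0 by (auto simp: \<delta>_def)
      have "\<delta> \<le> c / (B + 1)" by (simp add: \<delta>_def)
      then have "\<delta> * (B + 1) \<le> c" using B0 by (simp add: pos_le_divide_eq)
      then show "\<delta> * B < c" using \<open>0 < \<delta>\<close> by (simp add: algebra_simps)
    qed
    have mono: "t (r2 *\<^sub>R w) / r2 \<le> t (r1 *\<^sub>R w) / r1"
      if w: "norm w = 1" "0 \<le> w $ k" and r: "0 < r1" "r1 \<le> r2" "r2 \<le> \<delta>" for w r1 r2
    proof (rule DERIV_nonpos_imp_nonincreasing[OF r(2)])
      fix r assume r': "r1 \<le> r" "r \<le> r2"
      then have rp: "0 < r" "r \<le> \<delta>" using r by auto
      have "((\<lambda>r. t (r *\<^sub>R w) / r) has_real_derivative ((gt (r *\<^sub>R w) \<bullet> w) * r - t (r *\<^sub>R w) * 1) / (r * r)) (at r)"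
        using rp w by (intro DERIV_divide t_along_ray DERIV_ident) auto
      moreover have "((gt (r *\<^sub>R w) \<bullet> w) * r - t (r *\<^sub>R w) * 1) / (r * r) \<le> 0"
      proof -
        have rw: "r *\<^sub>R w \<in> half_ball k 1" using rp w \<delta> by (auto simp: half_ball_def)
        have "gt (r *\<^sub>R w) \<bullet> w \<le> B" using norm_cauchy_schwarz[of "gt (r *\<^sub>R w)" w] B[OF rw] w by simp
        then have "(gt (r *\<^sub>R w) \<bullet> w) * r \<le> B * \<delta>" using rp B0 by (meson mult_mono' mult_right_mono mult_left_mono order_trans less_imp_le)
        also have "\<dots> \<le> t (r *\<^sub>R w)" using \<delta>(3) c(2)[OF rw] by (simp add: mult.commute)
        finally show ?thesis using rp by (simp add: divide_le_0_iff)
      qed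
      ultimately show "\<exists>y. ((\<lambda>r. t (r *\<^sub>R w) / r) has_real_derivative y) (at r) \<and> y \<le> 0" by blast
    qed
    obtain S where S: "\<And>y. y \<in> half_ball k (1 / \<delta>) \<Longrightarrow> norm (s y) \<le> S"
      using compact_imp_bounded[OF compact_continuous_image[OF continuous_on_subset[OF cont(1) sub[of "1 / \<delta>"]] compact_half_ball]]
      unfolding bounded_iff by blast
    have S0: "S \<ge> 0" by (rule order_trans[OF norm_ge_zero S[of 0]]) (use \<delta> in \<open>simp add: half_ball_def\<close>)
    define L0 where "L0 = 1 + 1 / \<delta> + S / c"
    have L0: "L0 \<ge> 1" "L0 \<ge> 1 / \<delta>" "L0 \<ge> S / c" using \<delta> S0 c by (auto simp: L0_def)
    have "good L" if L: "L \<ge> L0" for L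
      unfolding good_def
    proof
      fix y assume y: "y \<in> half_ball k L"
      then have yk: "0 \<le> y $ k" and yL: "norm y \<le> L" by (auto simp: half_ball_def)
      have L1: "L \<ge> 1" using L L0 by simp
      have LL: "L \<le> L\<^sup>2" using L1 by (simp add: power2_eq_square)
      show "s y \<le> u L y"
      proof (cases "norm y \<le> 1 / \<delta>")
        case True
        have "norm y \<le> L\<^sup>2" using yL LL by simp
        then have "y /\<^sub>R L\<^sup>2 \<in> half_ball k 1" using yk L1 by (simp add: half_ball_def field_simps)
        then have "c \<le> t (y /\<^sub>R L\<^sup>2)" by (rule c)
        moreover have "S / c \<le> L\<^sup>2" using L0 L LL by linarith
        ultimately have "S \<le> L\<^sup>2 * t (y /\<^sub>R L\<^sup>2)"
          using c(1) by (meson divide_le_eq mult_left_mono order_trans zero_le_power2)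
        moreover have "s y \<le> S" using S[of y] True yk by (simp add: half_ball_def)
        ultimately show ?thesis by (simp add: u_def)
      next
        case False
        then have "1 < \<delta> * norm y" using \<delta>(1) by (simp add: field_simps)
        then have ny: "norm y > 0" "1 / norm y \<le> \<delta>"
          using \<delta>(1) by (auto simp: divide_le_eq)
        define w where "w = y /\<^sub>R norm y"
        have w: "norm w = 1" "0 \<le> w $ k" using ny yk by (auto simp: w_def)
        have "t ((1 / norm y) *\<^sub>R w) / (1 / norm y) \<le> t ((norm y / L\<^sup>2) *\<^sub>R w) / (norm y / L\<^sup>2)"
        proof (rule mono[OF w])
          show "0 < norm y / L\<^sup>2" using ny L1 by simp
          have "norm y * norm y \<le> L * L" using yL L1 by (intro mult_mono) auto
          then show "norm y / L\<^sup>2 \<le> 1 / norm y" using ny L1 by (simp add: field_simps power2_eq_square)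
        qed (rule ny)
        moreover have "(1 / norm y) *\<^sub>R w = y /\<^sub>R (norm y)\<^sup>2" "(norm y / L\<^sup>2) *\<^sub>R w = y /\<^sub>R L\<^sup>2"
          using ny by (auto simp: w_def power2_eq_square divide_simps)
        ultimately have "norm y * t (y /\<^sub>R (norm y)\<^sup>2) \<le> t (y /\<^sub>R L\<^sup>2) * L\<^sup>2 / norm y"
          by (simp add: mult.commute)
        then have "(norm y)\<^sup>2 * t (y /\<^sub>R (norm y)\<^sup>2) \<le> t (y /\<^sub>R L\<^sup>2) * L\<^sup>2"
          using ny by (simp add: field_simps power2_eq_square)
        then show ?thesis using inv[OF yk] ny by (simp add: u_def mult.commute)
      qed
    qed
    then show ?thesis using L0(1) by (intro exI[of _ L0]) auto
  qed

  \<comment> \<open>comparison at the origin keeps good radii away from \<open>0\<close>\<close>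
  have lower: "L\<^sup>2 \<ge> s 0 / t 0" if "good L" "L > 0" for L
  proof -
    have "s 0 \<le> u L 0" using that by (auto simp: good_def half_ball_def)
    then show ?thesis using pos(2)[of 0] by (simp add: u_def divide_le_eq)
  qed

  have closed: "good L" if L: "L > 0" and gt: "\<And>M. M > L \<Longrightarrow> good M" for L
    unfolding good_def
  proof
    fix y assume y: "y \<in> half_ball k L"
    then have yk: "0 \<le> y $ k" by (simp add: half_ball_def)
    define M where "M j = L + 1 / real (Suc j)" for j
    have M: "M \<longlonglongrightarrow> L" unfolding M_def using LIMSEQ_inverse_real_of_nat_add[of L] by (simp add: inverse_eq_divide)
    have ge: "s y \<le> u (M j) y" for j
    proof -
      have "L < M j" by (simp add: M_def)
      then show ?thesis using gt[of "M j"] y by (simp add: good_def half_ball_def)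
    qed
    have "(\<lambda>j. y /\<^sub>R (M j)\<^sup>2) \<longlonglongrightarrow> y /\<^sub>R L\<^sup>2" using L by (intro tendsto_intros M) auto
    from isCont_tendsto_compose[OF isC(2)[OF half_scale[OF yk]] this]
    have "(\<lambda>j. u (M j) y) \<longlonglongrightarrow> u L y"
      unfolding u_def by (intro tendsto_mult tendsto_power M) simp_all
    then show "s y \<le> u L y" using ge by (intro LIMSEQ_le_const) auto
  qed

  \<comment> \<open>otherwise points \<open>z j\<close> violating the inequality for radii \<open>N j\<close> tending to \<open>L\<close> accumulate at a point \<open>l\<close> of the
    sphere; between \<open>z j\<close> and the sphere the difference rises to \<open>0\<close> along a ray, so in the limit its radial
    derivative at \<open>l\<close> is nonnegative, against the growth from the sphere\<close>
  have open_good: "\<exists>\<delta>>0. \<forall>M. \<bar>M - L\<bar> < \<delta> \<longrightarrow> good M" if L: "L > 0" and gL: "good L" for L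
  proof (rule ccontr)
    assume "\<not> ?thesis"
    then have "\<exists>M y. \<bar>M - L\<bar> < 1 / real (Suc j) \<and> y \<in> half_ball k M \<and> u M y < s y" for j
      by (metis good_def not_le of_nat_0_less_iff zero_less_Suc zero_less_divide_1_iff)
    then obtain M y where My: "\<And>j. \<bar>M j - L\<bar> < 1 / real (Suc j)" "\<And>j. y j \<in> half_ball k (M j)"
      "\<And>j. u (M j) (y j) < s (y j)" by metis
    have "(\<lambda>j. M j - L) \<longlonglongrightarrow> 0" by (rule LIMSEQ_norm_0) (use My(1) in simp)
    then have M: "M \<longlonglongrightarrow> L" by (rule LIM_zero_cancel)
    have "y j \<in> half_ball k (L + 1)" for j
    proof -
      have "1 / real (Suc j) \<le> 1" by simp
      then have "M j \<le> L + 1" using My(1)[of j] by linarith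
      then show ?thesis using My(2)[of j] by (auto simp: half_ball_def)
    qed
    then obtain l r where lr: "strict_mono r" "(y \<circ> r) \<longlonglongrightarrow> l"
      using compact_half_ball[of k "L + 1", unfolded compact_def] by metis
    define N where "N j = M (r j)" for j
    define z where "z j = y (r j)" for j
    have N: "N \<longlonglongrightarrow> L" unfolding N_def using LIMSEQ_subseq_LIMSEQ[OF M lr(1)] by (simp add: o_def)
    have z: "z \<longlonglongrightarrow> l" unfolding z_def using lr(2) by (simp add: o_def)
    have zN: "norm (z j) \<le> N j" "0 \<le> z j $ k" "u (N j) (z j) < s (z j)" for j
      using My(2,3)[of "r j"] by (auto simp: half_ball_def z_def N_def)
    have lk: "0 \<le> l $ k" using tendsto_vec_nth[OF z, of k] zN(2) by (intro LIMSEQ_le_const) auto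
    have lL: "norm l \<le> L" using tendsto_norm[OF z] N zN(1) by (intro LIMSEQ_le) auto
    have "(\<lambda>j. z j /\<^sub>R (N j)\<^sup>2) \<longlonglongrightarrow> l /\<^sub>R L\<^sup>2" using L by (intro tendsto_intros N z) auto
    from isCont_tendsto_compose[OF isC(2)[OF half_scale[OF lk]] this]
    have "(\<lambda>j. u (N j) (z j)) \<longlonglongrightarrow> u L l"
      unfolding u_def by (intro tendsto_mult tendsto_power N) simp_all
    moreover have "(\<lambda>j. s (z j)) \<longlonglongrightarrow> s l" using isC(1)[OF lk] z by (rule isCont_tendsto_compose)
    ultimately have ul: "u L l \<le> s l" using zN(3) by (intro LIMSEQ_le) (auto intro: less_imp_le)
    \<comment> \<open>rescaling the matrix does not change it, so the ellipticity bound applies to \<open>u L\<close>\<close>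
    define W' where "W' = W \<inter> {y. y /\<^sub>R L\<^sup>2 \<in> W}"
    have oW': "open W'"
    proof -
      have "open ((\<lambda>y. y /\<^sub>R L\<^sup>2) -` W)" by (intro continuous_open_vimage W continuous_intros)
      then show ?thesis using W(1) unfolding W'_def by (auto simp: vimage_def)
    qed
    have hu: "has_grad_hess W' (u L) (\<lambda>y. gt (y /\<^sub>R L\<^sup>2)) (\<lambda>y. inverse (L\<^sup>2) *\<^sub>R Ht (y /\<^sub>R L\<^sup>2))"
      unfolding u_def by (rule has_grad_hess_subset[OF has_grad_hess_rescale[OF t]]) (use L in \<open>auto simp: W'_def\<close>)
    have hs: "has_grad_hess W' s gs Hs" by (rule has_grad_hess_subset[OF s]) (auto simp: W'_def)
    have hbW': "half_ball k L \<subseteq> W'" unfolding W'_def half_ball_def using hW half_scale[of _ "L\<^sup>2"] by auto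
    have resc: "conformal_hessian (u L y) (gt (y /\<^sub>R L\<^sup>2)) (inverse (L\<^sup>2) *\<^sub>R Ht (y /\<^sub>R L\<^sup>2))
        = conformal_hessian (t (y /\<^sub>R L\<^sup>2)) (gt (y /\<^sub>R L\<^sup>2)) (Ht (y /\<^sub>R L\<^sup>2))" for y
      using L by (simp add: conformal_hessian_def u_def)
    obtain C where C: "C \<ge> 0" "\<And>y. norm y < L \<Longrightarrow> 0 < y $ k \<Longrightarrow>
        ellipticity_bound C (conformal_hessian (s y) (gs y) (Hs y))
          (conformal_hessian (t (y /\<^sub>R L\<^sup>2)) (gt (y /\<^sub>R L\<^sup>2)) (Ht (y /\<^sub>R L\<^sup>2)))" using ell[OF L] by metis
    obtain q where q: "norm q < L" "0 \<le> q $ k" "u L q \<noteq> s q" using rigid[OF L] unfolding u_def by blast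
    note sc = strong_comparison[OF oW' hu hs L hbW' _ _ bd[OF L] C(1) _ q, unfolded resc]
    have spos: "0 < s y" and sgood: "s y \<le> u L y" if "y \<in> half_ball k L" for y
      using that pos(1) gL by (auto simp: half_ball_def good_def)
    have nl: "norm l = L"
    proof (rule ccontr)
      assume "norm l \<noteq> L"
      then have "s l < u L l" using lL lk by (intro sc(1) spos sgood C(2)) auto
      then show False using ul by simp
    qed
    have "\<exists>a>0. \<exists>\<epsilon>>0. \<forall>y\<in>half_ball k L. L / 2 \<le> norm y \<longrightarrow>
           u L y - s y \<ge> \<epsilon> * (exp (- a * (norm y)\<^sup>2) - exp (- a * L\<^sup>2))"
      by (intro sc(2) spos sgood C(2)) auto
    then obtain a \<epsilon> where a: "a > 0" "\<epsilon> > 0" "\<And>y. y \<in> half_ball k L \<Longrightarrow> L / 2 \<le> norm y \<Longrightarrow>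
           u L y - s y \<ge> \<epsilon> * (exp (- a * (norm y)\<^sup>2) - exp (- a * L\<^sup>2))" by auto
    define w where "w = l /\<^sub>R L"
    define v where "v j = z j /\<^sub>R norm (z j)" for j
    have w: "norm w = 1" "0 \<le> w $ k" "L *\<^sub>R w = l" using nl L lk by (auto simp: w_def)
    have v: "v \<longlonglongrightarrow> w"
      unfolding v_def w_def using tendsto_norm[OF z] L unfolding nl by (intro tendsto_intros z) auto
    have "\<exists>\<xi>. z j \<noteq> 0 \<and> N j > 0 \<longrightarrow> norm (z j) \<le> \<xi> \<and> \<xi> \<le> N j \<and>
        0 \<le> (gt ((\<xi> *\<^sub>R v j) /\<^sub>R (N j)\<^sup>2) - gs (\<xi> *\<^sub>R v j)) \<bullet> v j" for j
    proof (cases "z j \<noteq> 0 \<and> N j > 0")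
      case True
      define \<phi> where "\<phi> r = u (N j) (r *\<^sub>R v j) - s (r *\<^sub>R v j)" for r
      have vk: "0 \<le> v j $ k" "norm (v j) = 1" using zN(2)[of j] True by (auto simp: v_def)
      have zv: "norm (z j) *\<^sub>R v j = z j" using True by (simp add: v_def)
      have neg: "\<phi> (norm (z j)) < 0" using zN(3)[of j] by (simp add: \<phi>_def zv)
      have zero: "\<phi> (N j) = 0" unfolding \<phi>_def using sphere_eq[of "N j *\<^sub>R v j" "N j"] vk True by simp
      have lt: "norm (z j) < N j"
        using zN(1)[of j] neg zero by (cases "norm (z j) = N j") auto
      have "(\<phi> has_real_derivative (gt ((r *\<^sub>R v j) /\<^sub>R (N j)\<^sup>2) - gs (r *\<^sub>R v j)) \<bullet> v j) (at r)"
        if "norm (z j) \<le> r" "r \<le> N j" for r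
      proof -
        have "0 \<le> r" using that(1) norm_ge_zero[of "z j"] by linarith
        then show ?thesis unfolding \<phi>_def using u_along_ray[OF vk(1)] True by simp
      qed
      from MVT2[OF lt this] obtain \<xi> where \<xi>: "norm (z j) < \<xi>" "\<xi> < N j"
        "\<phi> (N j) - \<phi> (norm (z j)) = (N j - norm (z j)) * ((gt ((\<xi> *\<^sub>R v j) /\<^sub>R (N j)\<^sup>2) - gs (\<xi> *\<^sub>R v j)) \<bullet> v j)"
        by blast
      then have "0 < (N j - norm (z j)) * ((gt ((\<xi> *\<^sub>R v j) /\<^sub>R (N j)\<^sup>2) - gs (\<xi> *\<^sub>R v j)) \<bullet> v j)"
        using neg zero by simp
      then show ?thesis using \<xi>(1,2) lt by (intro exI[of _ \<xi>]) (auto simp: zero_less_mult_iff)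
    qed auto
    then obtain \<xi> where \<xi>: "\<And>j. z j \<noteq> 0 \<and> N j > 0 \<Longrightarrow> norm (z j) \<le> \<xi> j \<and> \<xi> j \<le> N j \<and>
        0 \<le> (gt ((\<xi> j *\<^sub>R v j) /\<^sub>R (N j)\<^sup>2) - gs (\<xi> j *\<^sub>R v j)) \<bullet> v j" by metis
    have "l \<noteq> 0" using nl L by auto
    then have ev: "\<forall>\<^sub>F j in sequentially. z j \<noteq> 0 \<and> N j > 0"
      using tendsto_imp_eventually_ne[OF z] order_tendstoD(1)[OF N L] by (auto intro: eventually_conj)
    have xi: "\<xi> \<longlonglongrightarrow> L"
      by (rule tendsto_sandwich[OF _ _ tendsto_norm[OF z, unfolded nl] N])
         (use ev \<xi> in \<open>auto elim!: eventually_mono\<close>)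
    have xv: "(\<lambda>j. \<xi> j *\<^sub>R v j) \<longlonglongrightarrow> l" using tendsto_scaleR[OF xi v] by (simp add: w)
    then have xv': "(\<lambda>j. (\<xi> j *\<^sub>R v j) /\<^sub>R (N j)\<^sup>2) \<longlonglongrightarrow> l /\<^sub>R L\<^sup>2" using L by (intro tendsto_intros N) auto
    have "(\<lambda>j. (gt ((\<xi> j *\<^sub>R v j) /\<^sub>R (N j)\<^sup>2) - gs (\<xi> j *\<^sub>R v j)) \<bullet> v j) \<longlonglongrightarrow> (gt (l /\<^sub>R L\<^sup>2) - gs l) \<bullet> w"
      by (intro tendsto_intros v isCont_tendsto_compose[OF isC(4) xv'] isCont_tendsto_compose[OF isC(3) xv])
         (use lk half_scale[OF lk, of "L\<^sup>2"] in auto)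
    then have ge0: "0 \<le> (gt (l /\<^sub>R L\<^sup>2) - gs l) \<bullet> w"
      by (rule tendsto_lowerbound) (use ev \<xi> in \<open>auto elim!: eventually_mono\<close>)
    define \<psi> where "\<psi> r = (u L (r *\<^sub>R w) - s (r *\<^sub>R w)) - \<epsilon> * (exp (- a * r\<^sup>2) - exp (- a * L\<^sup>2))" for r
    have "((\<lambda>r. \<epsilon> * (exp (- a * r\<^sup>2) - exp (- a * L\<^sup>2))) has_real_derivative
        \<epsilon> * (exp (- a * L\<^sup>2) * (- a * (2 * L)))) (at L)"
      by (auto intro!: derivative_eq_intros)
    from DERIV_diff[OF u_along_ray[OF w(2) _ L, of L] this]
    have D: "(\<psi> has_real_derivative (gt (l /\<^sub>R L\<^sup>2) - gs l) \<bullet> w - \<epsilon> * (exp (- a * L\<^sup>2) * (- a * (2 * L)))) (at L)"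
      unfolding \<psi>_def using L by (simp add: w(3))
    have "\<epsilon> * (exp (- a * L\<^sup>2) * (a * (2 * L))) > 0" using a L by simp
    then have "(gt (l /\<^sub>R L\<^sup>2) - gs l) \<bullet> w - \<epsilon> * (exp (- a * L\<^sup>2) * (- a * (2 * L))) > 0" using ge0 by (simp add: ac_simps)
    from DERIV_pos_inc_left[OF D this] obtain d where d: "d > 0" "\<And>h. 0 < h \<Longrightarrow> h < d \<Longrightarrow> \<psi> (L - h) < \<psi> L" by blast
    define h where "h = min d (L / 2) / 2"
    have h: "0 < h" "h < d" "h \<le> L / 2" using d(1) L by (auto simp: h_def min_def)
    have "\<psi> L = 0" using sphere_eq[of l L] nl lk L by (simp add: \<psi>_def w(3))
    moreover have "\<psi> (L - h) \<ge> 0"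
    proof -
      have n: "norm ((L - h) *\<^sub>R w) = L - h" using h L w by simp
      have "(L - h) *\<^sub>R w \<in> half_ball k L" using h L w by (auto simp: half_ball_def)
      then show ?thesis using a(3)[of "(L - h) *\<^sub>R w"] h n by (simp add: \<psi>_def)
    qed
    ultimately show False using d(2)[OF h(1,2)] by simp
  qed

  define S where "S = {L. L > 0 \<and> (\<forall>M\<ge>L. good M)}"
  define L where "L = Inf S"
  define c where "c = sqrt (s 0 / t 0)"
  have c: "c > 0" using pos[of 0] by (simp add: c_def)
  have low: "c \<le> M" if "M \<in> S" for M
  proof -
    have "s 0 / t 0 \<le> M\<^sup>2" using that lower by (auto simp: S_def)
    then show ?thesis using that real_sqrt_le_mono[of "s 0 / t 0" "M\<^sup>2"] by (simp add: c_def S_def)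
  qed
  have Sne: "S \<noteq> {}" using start by (auto simp: S_def)
  have "c \<le> L" unfolding L_def using Sne low by (rule cInf_greatest)
  then have Lpos: "L > 0" using c by simp
  have above: "good M" if M: "M > L" for M
  proof -
    obtain K where "K \<in> S" "K < M" using cInf_lessD[OF Sne] M unfolding L_def by blast
    then show ?thesis by (auto simp: S_def)
  qed
  have "good L" using closed[OF Lpos above] .
  then obtain \<delta> where \<delta>: "\<delta> > 0" "\<And>M. \<bar>M - L\<bar> < \<delta> \<Longrightarrow> good M" using open_good[OF Lpos] by blast
  define K where "K = L - min \<delta> L / 2"
  have K: "0 < K" "K < L" "L - K < \<delta>" using \<delta>(1) Lpos by (auto simp: K_def min_def)
  have "K \<in> S"
    unfolding S_def
  proof (intro CollectI conjI allI impI)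
    fix M assume "K \<le> M"
    then show "good M" using above \<delta>(2) K by (cases "M > L") auto
  qed (rule K)
  then have "L \<le> K" unfolding L_def by (rule cInf_lower) (auto simp: S_def intro: bdd_belowI[of _ 0])
  then show False using K by simp
qed

section \<open>The hemisphere as a ball\<close>

definition stereo_factor :: "real^'n \<Rightarrow> real" where "stereo_factor x = 2 / (1 + x \<bullet> x)"

lemma one_plus_inner_pos: "0 < 1 + (x :: real^'n) \<bullet> x"
  by (simp add: add_pos_nonneg)

lemma stereo_factor_pos: "0 < stereo_factor x"
  using one_plus_inner_pos[of x] by (simp add: stereo_factor_def)

lemma stereo_factor_has_derivative:
  "(stereo_factor has_derivative (\<lambda>h. - (stereo_factor x)\<^sup>2 * (x \<bullet> h))) (at x)"
proof -
  have N: "1 + x \<bullet> x \<noteq> 0" using one_plus_inner_pos[of x] by simp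
  have d: "((\<lambda>x. 1 + x \<bullet> x) has_derivative (\<lambda>h. 2 * (x \<bullet> h))) (at x)"
    by (auto intro!: derivative_eq_intros simp: inner_commute)
  from has_derivative_divide'[OF has_derivative_const[of 2] d N]
  have "((\<lambda>x. 2 / (1 + x \<bullet> x)) has_derivative (\<lambda>h. (0 * (1 + x \<bullet> x) - 2 * (2 * (x \<bullet> h))) / ((1 + x \<bullet> x) * (1 + x \<bullet> x)))) (at x)" .
  then show ?thesis unfolding stereo_factor_def[abs_def]
    by (rule has_derivative_eq_rhs) (simp add: fun_eq_iff power2_eq_square)
qed

lemma chart_inv_eq: "chart_inv x = (-1, 0) + stereo_factor x *\<^sub>R (1, x)"
proof -
  have "1 + x \<bullet> x \<noteq> 0" using one_plus_inner_pos[of x] by simp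
  then show ?thesis by (simp add: chart_inv_def stereo_factor_def power2_norm_eq_inner field_simps)
qed

text \<open>Derivatives of the chart by the product rule, from its form \<open>(-1, 0) + stereo_factor x *\<^sub>R (1, x)\<close>.\<close>

definition chart_inv_d1 :: "real^'n \<Rightarrow> real^'n \<Rightarrow> real \<times> (real^'n)" where
  "chart_inv_d1 x h = (- (stereo_factor x)\<^sup>2 * (x \<bullet> h)) *\<^sub>R (1, x) + stereo_factor x *\<^sub>R (0, h)"

definition chart_inv_d2 :: "real^'n \<Rightarrow> real^'n \<Rightarrow> real^'n \<Rightarrow> real \<times> (real^'n)" where
  "chart_inv_d2 x h k = (2 * (stereo_factor x) ^ 3 * (x \<bullet> k) * (x \<bullet> h) - (stereo_factor x)\<^sup>2 * (k \<bullet> h)) *\<^sub>R (1, x)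
     - ((stereo_factor x)\<^sup>2 * (x \<bullet> h)) *\<^sub>R (0, k) - ((stereo_factor x)\<^sup>2 * (x \<bullet> k)) *\<^sub>R (0, h)"

lemma pair_has_derivative: "((\<lambda>x. (1 :: real, x)) has_derivative (\<lambda>h. (0, h))) (at x)"
  by (intro has_derivative_Pair has_derivative_const has_derivative_ident)

lemma chart_inv_has_derivative: "(chart_inv has_derivative chart_inv_d1 x) (at x)"
proof -
  have "((\<lambda>x. (-1, 0) + stereo_factor x *\<^sub>R (1 :: real, x)) has_derivative
      (\<lambda>h. 0 + (stereo_factor x *\<^sub>R (0, h) + (- (stereo_factor x)\<^sup>2 * (x \<bullet> h)) *\<^sub>R (1, x)))) (at x)"
    by (intro has_derivative_add has_derivative_const has_derivative_scaleR stereo_factor_has_derivative pair_has_derivative)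
  then show ?thesis
    unfolding chart_inv_eq[abs_def] chart_inv_d1_def[abs_def] by (simp add: add.commute)
qed

lemma chart_inv_d1_has_derivative: "((\<lambda>x. chart_inv_d1 x h) has_derivative chart_inv_d2 x h) (at x)"
proof -
  let ?m = "stereo_factor x"
  have a: "((\<lambda>x. - (stereo_factor x)\<^sup>2 * (x \<bullet> h)) has_derivative
      (\<lambda>k. 2 * ?m ^ 3 * (x \<bullet> k) * (x \<bullet> h) - ?m\<^sup>2 * (k \<bullet> h))) (at x)"
    by (rule derivative_eq_intros stereo_factor_has_derivative refl
        | simp add: fun_eq_iff power2_eq_square power3_eq_cube algebra_simps)+
  have "((\<lambda>x. (- (stereo_factor x)\<^sup>2 * (x \<bullet> h)) *\<^sub>R (1 :: real, x) + stereo_factor x *\<^sub>R (0, h)) has_derivative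
     (\<lambda>k. ((- ?m\<^sup>2 * (x \<bullet> h)) *\<^sub>R (0, k) + (2 * ?m ^ 3 * (x \<bullet> k) * (x \<bullet> h) - ?m\<^sup>2 * (k \<bullet> h)) *\<^sub>R (1, x))
        + (?m *\<^sub>R 0 + (- ?m\<^sup>2 * (x \<bullet> k)) *\<^sub>R (0, h)))) (at x)"
    by (intro has_derivative_add has_derivative_const has_derivative_scaleR stereo_factor_has_derivative pair_has_derivative a)
  then show ?thesis
    unfolding chart_inv_d1_def chart_inv_d2_def[abs_def]
    by (rule has_derivative_eq_rhs) (simp add: fun_eq_iff)
qed

lemma continuous_on_stereo_factor: "continuous_on W stereo_factor"
  using has_derivative_continuous[OF stereo_factor_has_derivative]
  by (auto simp: continuous_on_eq_continuous_within intro: continuous_at_imp_continuous_at_within)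

lemma continuous_on_chart_inv_d2: "continuous_on W (\<lambda>x. chart_inv_d2 x h k)"
  unfolding chart_inv_d2_def by (intro continuous_intros continuous_on_stereo_factor)

lemma round_metric_eq: "round_metric x = mat ((stereo_factor x)\<^sup>2)"
proof -
  let ?m = "stereo_factor x"
  note fd = frechet_derivative_at[OF chart_inv_has_derivative, symmetric]
  have m: "?m * (1 + x \<bullet> x) = 2"
    unfolding stereo_factor_def times_divide_eq_left
    by (rule nonzero_mult_div_cancel_right) (use one_plus_inner_pos[of x] in simp)
  have "chart_inv_d1 x h \<bullet> chart_inv_d1 x k = ?m\<^sup>2 * (h \<bullet> k)" for h k
  proof -
    have "chart_inv_d1 x h \<bullet> chart_inv_d1 x k
      = ?m ^ 3 * (x \<bullet> h) * (x \<bullet> k) * (?m * (1 + x \<bullet> x)) - 2 * ?m ^ 3 * (x \<bullet> h) * (x \<bullet> k) + ?m\<^sup>2 * (h \<bullet> k)"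
      by (simp add: chart_inv_d1_def inner_add_left inner_add_right inner_commute power2_eq_square power3_eq_cube algebra_simps)
    then show ?thesis unfolding m by simp
  qed
  then show ?thesis unfolding round_metric_def fd by (simp add: vec_eq_iff mat_def inner_axis_axis)
qed

text \<open>The function \<open>r\<close> for which the metric of the problem is \<open>r\<^sup>-\<^sup>2 |dx|\<^sup>2\<close> in the ball chart.\<close>

definition ball_factor :: "(real \<times> (real^'n) \<Rightarrow> real) \<Rightarrow> real^'n \<Rightarrow> real" where
  "ball_factor v x = (1 + x \<bullet> x) / 2 * v (chart_inv x) powr (- (2 / (real CARD('n) - 2)))"

lemma conformal_metric_ball_factor:
  fixes v :: "real \<times> (real^'n) \<Rightarrow> real"
  assumes "v (chart_inv x) > 0"
  shows "conformal_metric v x = mat (1 / (ball_factor v x)\<^sup>2)"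
proof -
  let ?b = "2 / (real CARD('n) - 2)"
  have "(v (chart_inv x) powr (- ?b))\<^sup>2 = v (chart_inv x) powr (- (4 / (real CARD('n) - 2)))"
    by (simp add: powr_powr[symmetric] powr_realpow[symmetric] powr_add[symmetric] power2_eq_square)
  then have "1 / (ball_factor v x)\<^sup>2 = v (chart_inv x) powr (4 / (real CARD('n) - 2)) * (stereo_factor x)\<^sup>2"
    using assms one_plus_inner_pos[of x]
    by (simp add: ball_factor_def stereo_factor_def power_mult_distrib power_divide powr_minus field_simps)
  then show ?thesis
    unfolding conformal_metric_def round_metric_eq by (simp add: vec_eq_iff mat_def)
qed

lemma chart_inv_in_hemisphere: "x \<in> cball 0 1 \<Longrightarrow> chart_inv x \<in> (hemisphere :: (real \<times> (real^'n)) set)"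
  using bij_betw_chart(2) by blast

text \<open>The open set \<open>W\<close> goes beyond the closed ball because \<open>F\<close> extends \<open>v\<close> beyond the hemisphere; this is what gives
  derivatives at boundary points.\<close>

lemma ball_factor_smooth:
  fixes v :: "real \<times> (real^'n) \<Rightarrow> real"
  assumes v: "C2_on hemisphere v" "\<And>\<theta>. \<theta> \<in> hemisphere \<Longrightarrow> v \<theta> > 0"
  obtains W F q A where "open W" "cball 0 1 \<subseteq> W" "has_grad_hess W (ball_factor F) q A"
    "\<And>\<theta>. \<theta> \<in> hemisphere \<Longrightarrow> F \<theta> = v \<theta> \<and> F differentiable (at \<theta>)"
proof -
  obtain U F where U: "open U" "hemisphere \<subseteq> U" "C2_open U F" "\<And>\<theta>. \<theta> \<in> hemisphere \<Longrightarrow> F \<theta> = v \<theta>"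
    using v(1) unfolding C2_on_def by blast
  have dF: "F differentiable (at \<theta>)" if "\<theta> \<in> U" for \<theta>
    using U(3) that unfolding C2_open_def differentiable_def by blast
  define W where "W = {x. chart_inv x \<in> U \<and> F (chart_inv x) > 0}"
  have W: "open W"
  proof -
    have "continuous_on U F"
      by (intro continuous_at_imp_continuous_on ballI differentiable_imp_continuous_within dF)
    then have "open (U \<inter> F -` {0<..})" using U(1) open_greaterThan continuous_open_preimage by blast
    then have "open (chart_inv -` (U \<inter> F -` {0<..}))"
      by (rule continuous_open_vimage) (rule has_derivative_continuous[OF chart_inv_has_derivative])
    then show ?thesis by (simp add: W_def vimage_def Int_def)
  qed
  have sub: "cball 0 1 \<subseteq> W"
  proof
    fix x :: "real^'n" assume "x \<in> cball 0 1"
    then have h: "chart_inv x \<in> hemisphere" by (rule chart_inv_in_hemisphere)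
    then show "x \<in> W" using U(2) U(4)[OF h] v(2)[OF h] by (auto simp: W_def)
  qed
  have "\<exists>g H. has_grad_hess W (\<lambda>x. F (chart_inv x)) g H"
    by (rule C2_open_compose_grad_hess[OF U(3) W _ chart_inv_has_derivative chart_inv_d1_has_derivative continuous_on_chart_inv_d2])
       (simp add: W_def)
  then obtain g H where gH: "has_grad_hess W (\<lambda>x. F (chart_inv x)) g H" by blast
  let ?b = "- (2 / (real CARD('n) - 2))"
  have powr2: "((\<lambda>s. b * s powr (b - 1)) has_real_derivative b * (b - 1) * z powr (b - 2)) (at z)"
    if "z > 0" for b z :: real
    using DERIV_cmult[OF has_real_derivative_powr[OF that, of "b - 1"], of b] by (simp add: mult.assoc diff_diff_eq)
  have 1: "has_grad_hess W (\<lambda>x. F (chart_inv x) powr ?b) (\<lambda>y. (?b * F (chart_inv y) powr (?b - 1)) *\<^sub>R g y)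
     (\<lambda>y. (?b * F (chart_inv y) powr (?b - 1)) *\<^sub>R H y + (?b * (?b - 1) * F (chart_inv y) powr (?b - 2)) *\<^sub>R outer (g y) (g y))"
  proof (rule has_grad_hess_compose_real[OF gH, where p = "\<lambda>s. s powr ?b" and p' = "\<lambda>s. ?b * s powr (?b - 1)"
        and p'' = "\<lambda>s. ?b * (?b - 1) * s powr (?b - 2)"])
    fix y assume "y \<in> W"
    then have p: "F (chart_inv y) > 0" by (simp add: W_def)
    show "((\<lambda>s. s powr ?b) has_real_derivative ?b * F (chart_inv y) powr (?b - 1)) (at (F (chart_inv y)))"
      using has_real_derivative_powr[OF p, of ?b] by simp
    show "((\<lambda>s. ?b * s powr (?b - 1)) has_real_derivative ?b * (?b - 1) * F (chart_inv y) powr (?b - 2)) (at (F (chart_inv y)))"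
      by (rule powr2[OF p])
  next
    show "continuous_on ((\<lambda>x. F (chart_inv x)) ` W) (\<lambda>s. ?b * (?b - 1) * s powr (?b - 2))"
      by (intro continuous_intros) (auto simp: W_def)
  qed
  have 2: "has_grad_hess W (\<lambda>x. (1 + x \<bullet> x) / 2) (\<lambda>x. x) (\<lambda>x. mat 1)"
    unfolding has_grad_hess_def
    by (auto intro!: derivative_eq_intros simp: inner_commute transpose_mat)
  from has_grad_hess_mult[OF 2 1] obtain q A where "has_grad_hess W (ball_factor F) q A"
    unfolding ball_factor_def[abs_def] by blast
  then show ?thesis using that[OF W sub] U dF by blast
qed

lemma schouten_eigenvalues_ball:
  fixes v :: "real \<times> (real^'n) \<Rightarrow> real"
  assumes n: "CARD('n) \<ge> 3" and W: "cball 0 1 \<subseteq> W" and h: "has_grad_hess W (ball_factor F) q A"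
    and F: "\<And>\<theta>. \<theta> \<in> hemisphere \<Longrightarrow> F \<theta> = v \<theta>" and v: "\<And>\<theta>. \<theta> \<in> hemisphere \<Longrightarrow> v \<theta> > 0"
    and \<theta>: "\<theta> \<in> hemisphere" and l: "schouten_eigenvalues v \<theta> l"
  shows "\<exists>u. eigenbasis (conformal_hessian (ball_factor F (chart \<theta>)) (q (chart \<theta>)) (A (chart \<theta>))) u l"
proof -
  define x where "x = chart \<theta>"
  have x: "x \<in> cball 0 1" unfolding x_def using bij_betw_chart(1) \<theta> by (auto simp: bij_betw_def)
  have bf: "ball_factor F y = ball_factor v y" "ball_factor v y > 0" "v (chart_inv y) > 0" if "y \<in> cball 0 1" for y
    using F[OF chart_inv_in_hemisphere[OF that]] v[OF chart_inv_in_hemisphere[OF that]] one_plus_inner_pos[of y]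
    by (auto simp: ball_factor_def)
  have S: "matrix_inv (conformal_metric v x) ** schouten (cball 0 1) (conformal_metric v) x
      = conformal_hessian (ball_factor F x) (q x) (A x)"
    by (rule conformally_flat_schouten[OF W h _ _ x n]) (auto simp: bf conformal_metric_ball_factor)
  have "eigenvalues_wrt (mat 1) (conformal_hessian (ball_factor F x) (q x) (A x)) l"
    using l unfolding schouten_eigenvalues_def Let_def eigenvalues_wrt_def x_def[symmetric] S
    by (simp add: matrix_inv_mat_1)
  moreover have "transpose (A x) = A x" using has_grad_hessD(3)[OF h] W x by blast
  ultimately show ?thesis
    unfolding x_def[symmetric] using eigenvalues_wrt_identity_iff transpose_conformal_hessian by blast
qed

section \<open>Meridians and the half space picture\<close>

text \<open>The meridian through the direction \<open>w\<close>, parametrised by height, where the direction \<open>k\<close> of the half space stands for the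
  first coordinate of the sphere.\<close>

definition meridian_curve :: "'n \<Rightarrow> real^'n \<Rightarrow> real \<Rightarrow> real \<times> (real^'n)" where
  "meridian_curve k w s =
     (sqrt (1 - s\<^sup>2) * w $ k, sqrt (1 - s\<^sup>2) *\<^sub>R (w - (w $ k) *\<^sub>R axis k 1) + s *\<^sub>R axis k 1)"

lemma split_inner:
  fixes w :: "real^'n"
  shows "(w - (w $ k) *\<^sub>R axis k 1) \<bullet> axis k 1 = 0"
    "(w - (w $ k) *\<^sub>R axis k 1) \<bullet> (w - (w $ k) *\<^sub>R axis k 1) = w \<bullet> w - (w $ k)\<^sup>2"
  by (simp_all add: inner_diff_left inner_diff_right inner_axis inner_axis' power2_eq_square)

lemma meridian_curve_in_sphere:
  fixes w :: "real^'n" and k :: 'n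
  assumes "norm w = 1" "\<bar>s\<bar> \<le> 1"
  shows "meridian_curve k w s \<in> sphere 0 1"
proof -
  have s: "0 \<le> 1 - s\<^sup>2" using assms(2) by (simp add: abs_square_le_1)
  have ww: "w \<bullet> w = 1" using assms(1) by (simp add: dot_square_norm)
  let ?z = "w - (w $ k) *\<^sub>R axis k 1"
  have zz: "?z \<bullet> ?z = 1 - (w $ k)\<^sup>2" unfolding split_inner(2) ww ..
  define z where "z = w - (w $ k) *\<^sub>R axis k 1"
  define e where "e = (axis k 1 :: real^'n)"
  define c where "c = sqrt (1 - s\<^sup>2)"
  have ze: "z \<bullet> e = 0" "e \<bullet> e = 1" "z \<bullet> z = 1 - (w $ k)\<^sup>2" "c\<^sup>2 = 1 - s\<^sup>2"
    using split_inner(1)[of w k] zz s by (simp_all only: z_def e_def c_def inner_axis_axis real_sqrt_pow2 if_True refl inner_real_def mult_1)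
  have "meridian_curve k w s = (c * w $ k, c *\<^sub>R z + s *\<^sub>R e)"
    by (simp only: meridian_curve_def z_def e_def c_def)
  then have "meridian_curve k w s \<bullet> meridian_curve k w s = c\<^sup>2 * (w $ k)\<^sup>2 + c\<^sup>2 * (z \<bullet> z) + 2 * s * c * (z \<bullet> e) + s\<^sup>2 * (e \<bullet> e)"
    by (simp add: inner_add_left inner_add_right inner_commute[of e z] power2_eq_square algebra_simps)
  also have "\<dots> = 1" unfolding ze by (simp add: algebra_simps)
  finally show ?thesis by (simp add: norm_eq_sqrt_inner)
qed

lemma meridian_curve_components:
  "snd (meridian_curve k w s) $ k = s" "fst (meridian_curve k w s) = sqrt (1 - s\<^sup>2) * w $ k"
  by (simp_all add: meridian_curve_def)

lemma meridian_meridian_curve: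
  fixes w :: "real^'n" and k :: 'n
  assumes "norm w = 1" "\<bar>s\<bar> < 1"
  shows "meridian k (meridian_curve k w s) = meridian_curve k w"
proof
  fix t
  have s: "0 < sqrt (1 - s\<^sup>2)" using assms(2) by (simp add: abs_square_less_1)
  let ?z = "(w $ k, w - (w $ k) *\<^sub>R axis k 1) :: real \<times> (real^'n)"
  have "?z \<bullet> ?z = 1"
    unfolding inner_Pair split_inner(2) using assms(1) by (simp add: dot_square_norm power2_eq_square)
  then have "norm ?z = 1" by (simp add: norm_eq_sqrt_inner)
  have gen: "sgn (c *\<^sub>R x) = x" if "c > 0" "norm x = 1" for c and x :: "real \<times> (real^'n)"
    using that by (simp add: sgn_scaleR sgn_div_norm)
  have "sgn (sqrt (1 - s\<^sup>2) *\<^sub>R ?z) = ?z" by (rule gen[OF s \<open>norm ?z = 1\<close>])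
  moreover have "meridian_curve k w s - s *\<^sub>R north k = sqrt (1 - s\<^sup>2) *\<^sub>R ?z"
    by (simp add: meridian_curve_def north_def)
  ultimately show "meridian k (meridian_curve k w s) t = meridian_curve k w t"
    unfolding meridian_def meridian_curve_components by (simp add: meridian_curve_def north_def)
qed

lemma meridian_curve_not_pole:
  assumes "\<bar>s\<bar> < 1"
  shows "meridian_curve k w s \<notin> poles k"
proof
  assume "meridian_curve k w s \<in> poles k"
  then have "s = 1 \<or> s = -1"
    using meridian_curve_components(1)[of k w s] by (auto simp: poles_def north_def axis_def)
  then show False using assms by auto
qed

lemma on_meridian_curve:
  fixes \<theta> :: "real \<times> (real^'n)"
  assumes "\<theta> \<in> sphere 0 1" "\<theta> \<notin> poles k"
  obtains w s where "norm w = 1" "\<bar>s\<bar> < 1" "\<theta> = meridian_curve k w s" "fst \<theta> = sqrt (1 - s\<^sup>2) * w $ k"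
proof -
  obtain a b where \<theta>: "\<theta> = (a, b)" by (cases \<theta>)
  define s where "s = b $ k"
  define z where "z = a *\<^sub>R axis k 1 + (b - s *\<^sub>R axis k 1)"
  have ab: "a\<^sup>2 + b \<bullet> b = 1"
    using assms(1) by (simp add: \<theta> norm_eq_sqrt_inner inner_Pair power2_eq_square)
  have zz: "z \<bullet> z = 1 - s\<^sup>2"
  proof -
    have "z \<bullet> z = a\<^sup>2 + (b \<bullet> b - s\<^sup>2)"
      using split_inner[of b k] unfolding z_def s_def
      by (simp add: inner_add_left inner_add_right inner_commute inner_axis_axis power2_eq_square
          del: inner_diff_left inner_diff_right)
    then show ?thesis using ab by simp
  qed
  have "z \<noteq> 0"
  proof
    assume z0: "z = 0"
    have "z $ k = a" by (simp add: z_def s_def)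
    then have a: "a = 0" using z0 by simp
    then have b: "b = s *\<^sub>R axis k 1" using z0 by (simp add: z_def)
    have "s\<^sup>2 = 1" using zz z0 by simp
    then have "s = 1 \<or> s = -1" by (simp add: power2_eq_1_iff)
    then have "\<theta> \<in> poles k" using a b by (auto simp: \<theta> poles_def north_def)
    then show False using assms(2) by simp
  qed
  then have "0 < z \<bullet> z" by simp
  then have s1: "s\<^sup>2 < 1" using zz by simp
  define w where "w = z /\<^sub>R sqrt (1 - s\<^sup>2)"
  have nz: "norm z = sqrt (1 - s\<^sup>2)" by (simp add: norm_eq_sqrt_inner zz)
  have c: "sqrt (1 - s\<^sup>2) > 0" using s1 by simp
  have wz: "sqrt (1 - s\<^sup>2) *\<^sub>R w = z" using c by (simp add: w_def)
  have wk: "sqrt (1 - s\<^sup>2) * w $ k = a"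
  proof -
    have "sqrt (1 - s\<^sup>2) * w $ k = (sqrt (1 - s\<^sup>2) *\<^sub>R w) $ k" by simp
    also have "\<dots> = a" unfolding wz by (simp add: z_def s_def)
    finally show ?thesis .
  qed
  have "meridian_curve k w s = (a, z - a *\<^sub>R axis k 1 + s *\<^sub>R axis k 1)"
    unfolding meridian_curve_def scaleR_diff_right wz scaleR_scaleR wk ..
  then have \<theta>m: "\<theta> = meridian_curve k w s" by (simp add: \<theta> z_def)
  show ?thesis
  proof (rule that[OF _ _ \<theta>m])
    show "norm w = 1" using nz c by (simp add: w_def)
    show "\<bar>s\<bar> < 1" using s1 by (simp add: abs_square_less_1)
    show "fst \<theta> = sqrt (1 - s\<^sup>2) * w $ k" using wk by (simp add: \<theta>)
  qed
qed

lemma meridian_curve_differentiable: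
  assumes "\<bar>s\<bar> < 1"
  shows "meridian_curve k w differentiable (at s)"
proof -
  have "1 - s\<^sup>2 > 0" using assms by (simp add: abs_square_less_1)
  then have "((\<lambda>s. sqrt (1 - s\<^sup>2)) has_real_derivative (inverse (sqrt (1 - s\<^sup>2)) / 2) * (- 2 * s)) (at s)"
    by (auto intro!: derivative_eq_intros simp: field_simps)
  then have d: "(\<lambda>s. sqrt (1 - s\<^sup>2)) differentiable (at s)"
    using real_differentiable_def by blast
  show ?thesis
    unfolding meridian_curve_def[abs_def] by (intro differentiable_Pair derivative_intros d)
qed

text \<open>Along the meridian \<open>u\<close> agrees with a \<open>C\<^sup>1\<close> function defined near \<open>S\<close>, so the derivative in the
  definition of \<^const>\<open>meridian_deriv\<close> exists.\<close>

lemma derivative_along_meridian: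
  assumes u: "C1_on S u" and w: "norm w = 1" and S: "\<And>s. \<bar>s\<bar> < 1 \<Longrightarrow> meridian_curve k w s \<in> S" and s: "\<bar>s\<bar> < 1"
  shows "((\<lambda>s. u (meridian_curve k w s)) has_real_derivative meridian_deriv k u (meridian_curve k w s)) (at s)"
proof -
  obtain U F where U: "open U" "S \<subseteq> U" "C1_open U F" "\<And>x. x \<in> S \<Longrightarrow> F x = u x"
    using u unfolding C1_on_def by blast
  have "F differentiable (at (meridian_curve k w s))"
    using U(2,3) S[OF s] unfolding C1_open_def differentiable_def by blast
  then have "(F \<circ> meridian_curve k w) differentiable (at s)"
    using meridian_curve_differentiable[OF s] by (intro differentiable_chain_at)
  then obtain D where "((\<lambda>s. F (meridian_curve k w s)) has_real_derivative D) (at s)"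
    by (auto simp: real_differentiable_def o_def)
  then have D: "((\<lambda>s. u (meridian_curve k w s)) has_real_derivative D) (at s)"
  proof (rule has_field_derivative_transform_within_open[where S = "{-1<..<1}"])
    show "F (meridian_curve k w r) = u (meridian_curve k w r)" if "r \<in> {-1<..<1}" for r
      by (rule U(4)[OF S]) (use that in auto)
  qed (use s in auto)
  then have "D = meridian_deriv k u (meridian_curve k w s)"
    unfolding meridian_deriv_def meridian_meridian_curve[OF w s] meridian_curve_components
    by (rule DERIV_imp_deriv[symmetric])
  then show ?thesis using D by simp
qed

lemma mono_along_meridian:
  assumes u: "C1_on S u" and w: "norm w = 1" and S: "\<And>s. \<bar>s\<bar> < 1 \<Longrightarrow> meridian_curve k w s \<in> S"
    and mono: "\<And>\<theta>. \<theta> \<in> S - poles k \<Longrightarrow> meridian_deriv k u \<theta> \<ge> 0"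
    and st: "s \<le> t" "-1 < s" "t < 1"
  shows "u (meridian_curve k w s) \<le> u (meridian_curve k w t)"
proof (rule DERIV_nonneg_imp_nondecreasing[OF st(1)])
  fix r assume "s \<le> r" "r \<le> t"
  then have r: "\<bar>r\<bar> < 1" using st by auto
  then have "meridian_deriv k u (meridian_curve k w r) \<ge> 0"
    by (intro mono) (auto simp: S meridian_curve_not_pole)
  then show "\<exists>y. ((\<lambda>s. u (meridian_curve k w s)) has_real_derivative y) (at r) \<and> 0 \<le> y"
    using derivative_along_meridian[OF u w S r] by blast
qed

text \<open>The height on the sphere of a point at distance \<open>\<rho>\<close> from the origin of the half space.\<close>

definition height :: "real \<Rightarrow> real" where "height \<rho> = (1 - \<rho>\<^sup>2) / (1 + \<rho>\<^sup>2)"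

lemma height_bounds: "\<rho> \<noteq> 0 \<Longrightarrow> \<bar>height \<rho>\<bar> < 1"
proof -
  assume "\<rho> \<noteq> 0"
  then have "0 < \<rho>\<^sup>2" by simp
  then show ?thesis unfolding height_def abs_less_iff by (simp add: field_simps add_pos_pos)
qed

text \<open>Reflection in the sphere of radius \<open>L\<close> moves the points inside it southwards.\<close>

lemma height_reflected_le:
  assumes "0 < L" "0 \<le> \<rho>" "\<rho> \<le> L"
  shows "- height (\<rho> / L\<^sup>2) \<le> height \<rho>"
proof -
  define a where "a = \<rho> / L\<^sup>2"
  have "a * \<rho> \<le> 1"
  proof -
    have "\<rho> * \<rho> \<le> L * L" using assms by (intro mult_mono) auto
    then show ?thesis using assms by (simp add: a_def power2_eq_square field_simps)
  qed
  moreover have "0 \<le> a * \<rho>" using assms by (simp add: a_def)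
  ultimately have "a\<^sup>2 * \<rho>\<^sup>2 \<le> 1" using power_mono[of "a * \<rho>" 1 2] by (simp add: power_mult_distrib)
  moreover have p: "0 < 1 + a\<^sup>2" "0 < 1 + \<rho>\<^sup>2" by (simp_all add: add_pos_nonneg)
  moreover have "height \<rho> + height a = (2 - 2 * (a\<^sup>2 * \<rho>\<^sup>2)) / ((1 + \<rho>\<^sup>2) * (1 + a\<^sup>2))"
    unfolding height_def using p by (simp add: add_frac_eq) (simp add: algebra_simps)
  ultimately have "0 \<le> height \<rho> + height a" by simp
  then show ?thesis by (simp add: a_def)
qed

text \<open>For small \<open>\<rho>\<close> the two heights are close to \<open>1\<close> and \<open>- 1\<close>, so a monotone function that agrees at them is constant in between.\<close>

lemma constant_if_reflection_invariant:
  fixes \<phi> :: "real \<Rightarrow> real"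
  assumes L: "L > 0" and mono: "\<And>s t. s \<le> t \<Longrightarrow> -1 < s \<Longrightarrow> t < 1 \<Longrightarrow> \<phi> s \<le> \<phi> t"
    and eq: "\<And>\<rho>. 0 < \<rho> \<Longrightarrow> \<rho> < L \<Longrightarrow> \<phi> (height \<rho>) = \<phi> (- height (\<rho> / L\<^sup>2))"
    and ab: "\<bar>a\<bar> < 1" "\<bar>b\<bar> < 1"
  shows "\<phi> a = \<phi> b"
proof -
  have n0: "1 + r\<^sup>2 \<noteq> (0::real)" for r by (metis add_pos_nonneg less_irrefl zero_le_power2 zero_less_one)
  have "(height \<longlongrightarrow> (1 - 0\<^sup>2) / (1 + 0\<^sup>2)) (at_right 0)"
    unfolding height_def[abs_def] by (intro tendsto_intros) simp
  then have l1: "(height \<longlongrightarrow> 1) (at_right 0)" by simp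
  have "((\<lambda>\<rho>. - height (\<rho> / L\<^sup>2)) \<longlongrightarrow> - ((1 - (0 / L\<^sup>2)\<^sup>2) / (1 + (0 / L\<^sup>2)\<^sup>2))) (at_right 0)"
    unfolding height_def using L by (intro tendsto_intros) auto
  then have l2: "((\<lambda>\<rho>. - height (\<rho> / L\<^sup>2)) \<longlongrightarrow> - 1) (at_right 0)" by simp
  have "\<forall>\<^sub>F \<rho> in at_right 0. max a b < height \<rho>" by (rule order_tendstoD(1)[OF l1]) (use ab in auto)
  moreover have "\<forall>\<^sub>F \<rho> in at_right 0. - height (\<rho> / L\<^sup>2) < min a b" by (rule order_tendstoD(2)[OF l2]) (use ab in auto)
  moreover have "\<forall>\<^sub>F \<rho> in at_right 0. \<rho> \<in> {0<..<L}" by (rule eventually_at_right_real[OF L])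
  ultimately have "\<forall>\<^sub>F \<rho> in at_right 0. max a b < height \<rho> \<and> - height (\<rho> / L\<^sup>2) < min a b \<and> \<rho> \<in> {0<..<L}"
    by (intro eventually_conj)
  then obtain \<rho> where \<rho>: "max a b < height \<rho>" "- height (\<rho> / L\<^sup>2) < min a b" "0 < \<rho>" "\<rho> < L"
    using eventually_happens[of _ "at_right (0::real)"] by force
  have h: "\<bar>height \<rho>\<bar> < 1" "\<bar>height (\<rho> / L\<^sup>2)\<bar> < 1" using \<rho> L by (intro height_bounds; simp)+
  have "\<phi> c = \<phi> (height \<rho>)" if "c = a \<or> c = b" for c
  proof (rule antisym)
    show "\<phi> c \<le> \<phi> (height \<rho>)" using that \<rho> h ab by (intro mono) auto
    have "\<phi> (- height (\<rho> / L\<^sup>2)) \<le> \<phi> c" using that \<rho> h ab by (intro mono) auto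
    then show "\<phi> (height \<rho>) \<le> \<phi> c" using eq[OF \<rho>(3,4)] by simp
  qed
  then show ?thesis by metis
qed

text \<open>Inverse stereographic projection from the south pole for \<open>\<epsilon> = 1\<close> and from the north pole for \<open>\<epsilon> = - 1\<close>.\<close>

definition stereo :: "'n \<Rightarrow> real \<Rightarrow> real^'n \<Rightarrow> real \<times> (real^'n)" where
  "stereo k \<epsilon> y = (2 * y $ k / (1 + y \<bullet> y),
     (1 / (1 + y \<bullet> y)) *\<^sub>R (2 *\<^sub>R (y - (y $ k) *\<^sub>R axis k 1) + (\<epsilon> * (1 - y \<bullet> y)) *\<^sub>R axis k 1))"

lemma stereo_polar:
  assumes w: "norm w = 1" and \<rho>: "\<rho> \<ge> 0" and \<epsilon>: "\<epsilon>\<^sup>2 = 1"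
  shows "stereo k \<epsilon> (\<rho> *\<^sub>R w) = meridian_curve k w (\<epsilon> * height \<rho>)"
proof -
  have N: "(\<rho> *\<^sub>R w) \<bullet> (\<rho> *\<^sub>R w) = \<rho>\<^sup>2" using w by (simp add: dot_square_norm power2_eq_square)
  have p: "0 < 1 + \<rho>\<^sup>2" by (simp add: add_pos_nonneg)
  have "1 - (\<epsilon> * height \<rho>)\<^sup>2 = (2 * \<rho> / (1 + \<rho>\<^sup>2))\<^sup>2"
  proof -
    have gen: "1 - (a / b)\<^sup>2 = (b\<^sup>2 - a\<^sup>2) / b\<^sup>2" if "b \<noteq> 0" for a b :: real
      using that by (simp add: power_divide field_simps)
    have "1 - (height \<rho>)\<^sup>2 = ((1 + \<rho>\<^sup>2)\<^sup>2 - (1 - \<rho>\<^sup>2)\<^sup>2) / (1 + \<rho>\<^sup>2)\<^sup>2"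
      unfolding height_def by (rule gen) (use p in simp)
    also have "(1 + \<rho>\<^sup>2)\<^sup>2 - (1 - \<rho>\<^sup>2)\<^sup>2 = (2 * \<rho>)\<^sup>2" by (simp add: power2_eq_square algebra_simps)
    finally show ?thesis using \<epsilon> by (simp add: power_mult_distrib power_divide)
  qed
  then have sq: "sqrt (1 - (\<epsilon> * height \<rho>)\<^sup>2) = 2 * \<rho> / (1 + \<rho>\<^sup>2)" using \<rho> p by simp
  show ?thesis
    unfolding stereo_def meridian_curve_def sq N
    by (simp add: height_def scaleR_add_right scaleR_diff_right)
qed

lemma polar_decomposition:
  fixes y :: "real^'n"
  assumes "y \<noteq> 0"
  shows "norm (y /\<^sub>R norm y) = 1" "y = norm y *\<^sub>R (y /\<^sub>R norm y)"
  using assms by simp_all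

lemma stereo_in_hemisphere:
  fixes y :: "real^'n"
  assumes "\<epsilon>\<^sup>2 = 1" "0 \<le> y $ k"
  shows "stereo k \<epsilon> y \<in> hemisphere"
    "y $ k = 0 \<Longrightarrow> stereo k \<epsilon> y \<in> hemisphere_bd"
proof -
  obtain w \<rho> where w: "norm w = 1" "\<rho> \<ge> 0" "y = \<rho> *\<^sub>R w"
    using polar_decomposition[of y] by (cases "y = 0") (force intro: that[of "axis k 1" 0], metis norm_ge_zero that)
  have "\<bar>\<epsilon> * height \<rho>\<bar> \<le> 1"
  proof -
    have "\<bar>\<epsilon>\<bar> = 1" using assms(1) by (metis abs_1 power2_eq_1_iff abs_minus_cancel)
    moreover have "\<bar>height \<rho>\<bar> \<le> 1"
      using height_bounds[of \<rho>] by (cases "\<rho> = 0") (auto simp: height_def)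
    ultimately show ?thesis by (simp add: abs_mult)
  qed
  then have S: "stereo k \<epsilon> y \<in> sphere 0 1"
    unfolding w(3) stereo_polar[OF w(1,2) assms(1)] by (rule meridian_curve_in_sphere[OF w(1)])
  have f: "fst (stereo k \<epsilon> y) = 2 * y $ k / (1 + y \<bullet> y)" by (simp add: stereo_def)
  show "stereo k \<epsilon> y \<in> hemisphere"
    using S one_plus_inner_pos[of y] assms(2) unfolding hemisphere_def by (simp add: f)
  show "stereo k \<epsilon> y \<in> hemisphere_bd" if "y $ k = 0"
    using S that unfolding hemisphere_bd_def by (simp add: f)
qed

text \<open>The two projections differ by the inversion in the unit sphere.\<close>

lemma stereo_inverted:
  assumes "y \<noteq> 0"
  shows "stereo k (-1) (y /\<^sub>R (norm y)\<^sup>2) = stereo k 1 y"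
proof -
  define w where "w = y /\<^sub>R norm y"
  have w: "norm w = 1" "y = norm y *\<^sub>R w" using polar_decomposition[OF assms] by (simp_all add: w_def)
  have n: "norm y > 0" using assms by simp
  have "y /\<^sub>R (norm y)\<^sup>2 = (1 / norm y) *\<^sub>R w" by (simp add: w_def power2_eq_square divide_inverse)
  then have "stereo k (-1) (y /\<^sub>R (norm y)\<^sup>2) = meridian_curve k w (- 1 * height (1 / norm y))"
    using stereo_polar[OF w(1), of "1 / norm y" "-1" k] n by simp
  also have "- 1 * height (1 / norm y) = 1 * height (norm y)"
    using n by (simp add: height_def power_divide divide_simps)
  also have "meridian_curve k w (1 * height (norm y)) = stereo k 1 y"
    using stereo_polar[OF w(1), of "norm y" 1 k] w(2) by simp
  finally show ?thesis .
qed

text \<open>The identity for \<open>\<epsilon> = 1\<close> and the reflection of the coordinate \<open>k\<close> for \<open>\<epsilon> = - 1\<close>.\<close>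

definition flip_matrix :: "'n \<Rightarrow> real \<Rightarrow> real^'n^'n" where
  "flip_matrix k \<epsilon> = mat 1 + (\<epsilon> - 1) *\<^sub>R outer (axis k 1) (axis k 1)"

lemma flip_matrix_mult: "flip_matrix k \<epsilon> *v x = x + ((\<epsilon> - 1) * x $ k) *\<^sub>R axis k 1"
  by (simp add: flip_matrix_def matrix_vector_mult_add_rdistrib scaleR_matrix_vector_assoc[symmetric]
      outer_mult inner_axis')

lemma orthogonal_flip_matrix:
  assumes "\<epsilon>\<^sup>2 = 1"
  shows "orthogonal_matrix (flip_matrix k \<epsilon>)"
proof -
  have "transpose (flip_matrix k \<epsilon>) = flip_matrix k \<epsilon>"
    by (simp add: flip_matrix_def transpose_add transpose_scaleR transpose_outer transpose_mat)
  moreover have "flip_matrix k \<epsilon> ** flip_matrix k \<epsilon> = mat 1"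
  proof (rule matrix_eq[THEN iffD2], rule allI)
    fix x
    have "(\<epsilon> - 1) * x $ k + (\<epsilon> - 1) * (x $ k + (\<epsilon> - 1) * x $ k) = (\<epsilon>\<^sup>2 - 1) * x $ k"
      by (simp add: power2_eq_square algebra_simps)
    then have "(\<epsilon> - 1) * x $ k + (\<epsilon> - 1) * (x $ k + (\<epsilon> - 1) * x $ k) = 0" using assms by simp
    then show "(flip_matrix k \<epsilon> ** flip_matrix k \<epsilon>) *v x = mat 1 *v x"
      by (simp add: matrix_vector_mul_assoc[symmetric] flip_matrix_mult add.assoc scaleR_left_distrib[symmetric])
  qed
  ultimately show ?thesis by (simp add: orthogonal_matrix_def)
qed

text \<open>The half space is mapped to the ball by the inversion of power \<open>2\<close> centred at \<open>- axis k 1\<close>, followed by the flip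
  when \<open>\<epsilon> = - 1\<close>.  The second equation is the corresponding relation between the two conformal factors.\<close>

lemma chart_inv_inversion:
  fixes y :: "real^'n" and k :: 'n
  assumes \<epsilon>: "\<epsilon>\<^sup>2 = 1" and y: "y \<noteq> - axis k 1"
  defines "x \<equiv> flip_matrix k \<epsilon> *v inversion (- axis k 1) 2 y"
  shows "chart_inv x = stereo k \<epsilon> y"
    "((y + axis k 1) \<bullet> (y + axis k 1)) / 2 * ((1 + x \<bullet> x) / 2) = (1 + y \<bullet> y) / 2"
proof -
  let ?e = "axis k 1 :: real^'n"
  define D where "D = (y + ?e) \<bullet> (y + ?e)"
  define N where "N = y \<bullet> y"
  define X where "X = inversion (- ?e) 2 y"
  have D: "D = N + 2 * y $ k + 1"
    by (simp add: D_def N_def inner_add_left inner_add_right inner_axis inner_axis' inner_axis_axis)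
  have D0: "D \<noteq> 0" using y unfolding D_def by (simp add: add_eq_0_iff2)
  have N0: "1 + N \<noteq> 0" using one_plus_inner_pos[of y] by (simp add: N_def)
  have X: "X = - ?e + (2 / D) *\<^sub>R (y + ?e)" by (simp add: X_def inversion_def D_def)
  have "X $ k = - 1 + 2 / D * (y $ k + 1)" unfolding X by simp
  then have "D * X $ k = - D + 2 * (y $ k + 1)" using D0 by (simp add: field_simps)
  then have Xk: "D * X $ k = 1 - N" by (simp add: D)
  have XX: "X \<bullet> X = 1 - 4 * y $ k / D"
  proof -
    have gen: "(- e + c *\<^sub>R u) \<bullet> (- e + c *\<^sub>R u) = e \<bullet> e - 2 * c * (e \<bullet> u) + c\<^sup>2 * (u \<bullet> u)" for e u :: "real^'n" and c
      by (simp add: inner_diff_left inner_diff_right inner_commute[of u e] power2_eq_square algebra_simps)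
    have "?e \<bullet> ?e = 1" "?e \<bullet> (y + ?e) = y $ k + 1" by (simp_all add: inner_axis_axis inner_add_right inner_axis')
    then have "X \<bullet> X = 1 - 2 * (2 / D) * (y $ k + 1) + (2 / D)\<^sup>2 * D"
      unfolding X gen D_def[symmetric] by simp
    also have "(2 / D)\<^sup>2 * D = 4 / D" using D0 by (simp add: power2_eq_square)
    finally have "X \<bullet> X = 1 - 2 * (2 / D) * (y $ k + 1) + 4 / D" .
    then show ?thesis by (simp add: add_divide_distrib distrib_left)
  qed
  have xx: "x \<bullet> x = 1 - 4 * y $ k / D"
    unfolding x_def X_def[symmetric] orthogonal_matrix_inner[OF orthogonal_flip_matrix[OF \<epsilon>]] XX ..
  have xx1: "1 + x \<bullet> x = 2 * (1 + N) / D" unfolding xx using D0 D by (simp add: field_simps)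
  show "((y + axis k 1) \<bullet> (y + axis k 1)) / 2 * ((1 + x \<bullet> x) / 2) = (1 + y \<bullet> y) / 2"
    unfolding xx1 D_def[symmetric] N_def[symmetric] using D0 by simp
  have gen: "2 / (2 * a / b) = b / a" for a b :: real by simp
  have m: "stereo_factor x = D / (1 + N)" unfolding stereo_factor_def xx1 by (rule gen)
  have DX: "D *\<^sub>R X = 2 *\<^sub>R y + (1 - N - 2 * y $ k) *\<^sub>R ?e"
  proof -
    have "D *\<^sub>R X = - (D *\<^sub>R ?e) + 2 *\<^sub>R (y + ?e)" unfolding X scaleR_add_right using D0 by simp
    also have "\<dots> = 2 *\<^sub>R y + (1 - N - 2 * y $ k) *\<^sub>R ?e" unfolding D by (simp add: vec_eq_iff algebra_simps)
    finally show ?thesis .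
  qed
  have x': "D *\<^sub>R x = 2 *\<^sub>R (y - (y $ k) *\<^sub>R ?e) + (\<epsilon> * (1 - N)) *\<^sub>R ?e"
  proof -
    have "D *\<^sub>R x = D *\<^sub>R X + ((\<epsilon> - 1) * (D * X $ k)) *\<^sub>R ?e"
      unfolding x_def X_def[symmetric] flip_matrix_mult by (simp add: scaleR_add_right mult.left_commute)
    then show ?thesis unfolding DX Xk by (simp add: algebra_simps)
  qed
  have "D / (1 + N) = 2 * y $ k / (1 + N) + 1" unfolding D using N0 by (simp add: field_simps)
  moreover have "(D / (1 + N)) *\<^sub>R x = (1 / (1 + N)) *\<^sub>R (D *\<^sub>R x)" by simp
  ultimately show "chart_inv x = stereo k \<epsilon> y"
    unfolding chart_inv_eq m stereo_def N_def[symmetric] x'[symmetric] by simp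
qed

lemma chart_chart_inv: "chart (chart_inv x) = x"
  using stereo_factor_pos[of x] by (simp add: chart_def chart_inv_eq)

text \<open>The analogue of \<^const>\<open>ball_factor\<close> for the half space; \<open>\<epsilon> = 1\<close> gives the function \<open>s\<close> and
  \<open>\<epsilon> = - 1\<close> the function \<open>t\<close> of the moving spheres.\<close>

definition half_space_factor ::
  "(real \<times> (real^'n) \<Rightarrow> real) \<Rightarrow> 'n \<Rightarrow> real \<Rightarrow> real^'n \<Rightarrow> real" where
  "half_space_factor v k \<epsilon> y = (1 + y \<bullet> y) / 2 * v (stereo k \<epsilon> y) powr (- (2 / (real CARD('n) - 2)))"

lemma has_grad_hess_cong:
  assumes W: "open W" and h: "has_grad_hess W s g H" and eq: "\<And>y. y \<in> W \<Longrightarrow> s y = t y"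
  shows "has_grad_hess W t g H"
  unfolding has_grad_hess_def
proof (intro conjI ballI)
  fix y assume y: "y \<in> W"
  show "(t has_derivative (\<lambda>h. g y \<bullet> h)) (at y)"
    by (rule has_derivative_transform_within_open[OF has_grad_hessD(1)[OF h y] W y eq])
qed (use h in \<open>auto simp: has_grad_hess_def\<close>)

text \<open>Smoothness and eigenvalues are inherited from the ball by conformal covariance.\<close>

lemma half_space_factor_smooth:
  fixes F :: "real \<times> (real^'n) \<Rightarrow> real" and k :: 'n
  assumes \<epsilon>: "\<epsilon>\<^sup>2 = 1" and W: "open W" "cball 0 1 \<subseteq> W" and h: "has_grad_hess W (ball_factor F) q A"
  obtains V g H where "open V" "{y. 0 \<le> y $ k} \<subseteq> V" "has_grad_hess V (half_space_factor F k \<epsilon>) g H"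
    "\<And>y u l. 0 \<le> y $ k \<Longrightarrow>
       eigenbasis (conformal_hessian (ball_factor F (chart (stereo k \<epsilon> y))) (q (chart (stereo k \<epsilon> y))) (A (chart (stereo k \<epsilon> y)))) u l \<Longrightarrow>
       \<exists>u. eigenbasis (conformal_hessian (half_space_factor F k \<epsilon> y) (g y) (H y)) u l"
proof -
  let ?e = "axis k 1 :: real^'n"
  let ?Q = "flip_matrix k \<epsilon>"
  have Q: "orthogonal_matrix ?Q" by (rule orthogonal_flip_matrix[OF \<epsilon>])
  note hQ = has_grad_hess_orthogonal[OF h, of ?Q]
  have oQ: "open {x. ?Q *v x \<in> W}"
  proof -
    have "open ((*v) ?Q -` W)" by (intro continuous_open_vimage W(1) matrix_vector_mult_linear_continuous_at)
    then show ?thesis by (simp add: vimage_def)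
  qed
  note I = has_grad_hess_inversion[OF oQ hQ, where c = 2 and a = "- ?e"]
  let ?x = "\<lambda>y. ?Q *v inversion (- ?e) 2 y"
  define V where "V = {y. y \<noteq> - ?e \<and> inversion (- ?e) 2 y \<in> {x. ?Q *v x \<in> W}}"
  have V: "open V" unfolding V_def by (rule I(2)) simp
  have eq: "((y - - ?e) \<bullet> (y - - ?e)) / 2 * ball_factor F (?x y) = half_space_factor F k \<epsilon> y"
    if "y \<in> V" for y
  proof -
    have y: "y \<noteq> - ?e" using that by (simp add: V_def)
    show ?thesis
      unfolding ball_factor_def half_space_factor_def chart_inv_inversion(1)[OF \<epsilon> y]
        chart_inv_inversion(2)[OF \<epsilon> y, symmetric] by (simp add: mult.assoc)
  qed
  define g where "g = (\<lambda>y. (2 * ball_factor F (?x y) / 2) *\<^sub>R (y - - ?e)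
      + reflection_matrix (y - - ?e) *v (transpose ?Q *v q (?x y)))"
  define H where "H = (\<lambda>y. mat (2 * ball_factor F (?x y) / 2
        - 2 * ((y - - ?e) \<bullet> (transpose ?Q *v q (?x y))) / ((y - - ?e) \<bullet> (y - - ?e)))
      + (2 / ((y - - ?e) \<bullet> (y - - ?e))) *\<^sub>R
        (reflection_matrix (y - - ?e) ** (transpose ?Q ** A (?x y) ** ?Q) ** reflection_matrix (y - - ?e)))"
  have two: "(2::real) \<noteq> 0" by simp
  have gH: "has_grad_hess V (\<lambda>y. ((y - - ?e) \<bullet> (y - - ?e)) / 2 * ball_factor F (?x y)) g H"
    using I(1)[OF two] unfolding V_def g_def H_def .
  have cH: "conformal_hessian (((y - - ?e) \<bullet> (y - - ?e)) / 2 * ball_factor F (?x y)) (g y) (H y)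
        = reflection_matrix (y - - ?e) **
        conformal_hessian (ball_factor F (?x y)) (transpose ?Q *v q (?x y)) (transpose ?Q ** A (?x y) ** ?Q)
          ** reflection_matrix (y - - ?e)" if "y \<in> V" for y
    using I(3)[OF two, where y = y] that unfolding V_def g_def H_def by blast
  have ne: "y \<noteq> - ?e" if "0 \<le> y $ k" for y :: "real^'n"
    using that by (auto simp: axis_def)
  have x: "?x y = chart (stereo k \<epsilon> y)" if "0 \<le> y $ k" for y :: "real^'n"
    using chart_chart_inv[of "?x y"] unfolding chart_inv_inversion(1)[OF \<epsilon> ne[OF that]] by simp
  have sub: "{y. 0 \<le> y $ k} \<subseteq> V"
  proof
    fix y :: "real^'n" assume "y \<in> {y. 0 \<le> y $ k}"
    then have y: "0 \<le> y $ k" by simp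
    have "?x y \<in> cball 0 1"
      unfolding x[OF y] using bij_betw_chart(1) stereo_in_hemisphere(1)[where \<epsilon> = \<epsilon>, OF \<epsilon> y]
      by (auto simp: bij_betw_def)
    then show "y \<in> V" using ne[OF y] W(2) by (auto simp: V_def)
  qed
  show ?thesis
  proof (rule that[OF V sub has_grad_hess_cong[OF V gH eq]])
    fix y :: "real^'n" and u l assume y: "0 \<le> y $ k"
      and u: "eigenbasis (conformal_hessian (ball_factor F (chart (stereo k \<epsilon> y))) (q (chart (stereo k \<epsilon> y))) (A (chart (stereo k \<epsilon> y)))) u l"
    have yV: "y \<in> V" using y sub by auto
    have z: "y - - ?e \<noteq> 0" using ne[OF y] by (simp add: eq_neg_iff_add_eq_0)
    have "eigenbasis (transpose ?Q ** conformal_hessian (ball_factor F (?x y)) (q (?x y)) (A (?x y)) ** ?Q) (\<lambda>i. transpose ?Q *v u i) l"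
      using eigenbasis_conjugate[OF Q u] unfolding x[OF y] .
    then have "eigenbasis (conformal_hessian (ball_factor F (?x y)) (transpose ?Q *v q (?x y)) (transpose ?Q ** A (?x y) ** ?Q))
       (\<lambda>i. transpose ?Q *v u i) l"
      unfolding conformal_hessian_conjugate[OF Q] .
    from eigenbasis_conjugate[OF orthogonal_reflection_matrix[OF z] this]
    show "\<exists>u. eigenbasis (conformal_hessian (half_space_factor F k \<epsilon> y) (g y) (H y)) u l"
      unfolding transpose_reflection_matrix cH[OF yV, symmetric] eq[OF yV] by blast
  qed
qed

text \<open>The exponents of \<open>v\<close> cancel: differentiating \<open>v powr (- 2/(n-2))\<close> produces \<open>v powr (- n/(n-2))\<close>, the inverse of
  the power in the boundary condition.  The first factor of \<^const>\<open>half_space_factor\<close> does not contribute, as its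
  derivative in the direction \<open>k\<close> vanishes on the boundary.\<close>

lemma half_space_factor_boundary_gradient:
  fixes F v :: "real \<times> (real^'n) \<Rightarrow> real" and k :: 'n
  assumes n: "CARD('n) \<ge> 3" and \<epsilon>: "\<epsilon>\<^sup>2 = 1" and y: "y $ k = 0"
    and F: "\<And>\<theta>. \<theta> \<in> hemisphere \<Longrightarrow> F \<theta> = v \<theta> \<and> F differentiable (at \<theta>)"
    and v: "v (stereo k \<epsilon> y) > 0"
    and nd: "has_normal_deriv v (c * v (stereo k \<epsilon> y) powr (real CARD('n) / (real CARD('n) - 2))) (stereo k \<epsilon> y)"
    and g: "(half_space_factor F k \<epsilon> has_derivative (\<lambda>h. g \<bullet> h)) (at y)"
  shows "g $ k = 2 / (real CARD('n) - 2) * c"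
proof -
  let ?b = "2 / (real CARD('n) - 2)"
  let ?e = "axis k 1 :: real^'n"
  define \<theta> where "\<theta> = stereo k \<epsilon> y"
  define N where "N = y \<bullet> y"
  have N0: "1 + N > 0" using one_plus_inner_pos[of y] by (simp add: N_def)
  have \<theta>: "\<theta> \<in> hemisphere_bd" "\<theta> \<in> hemisphere"
    using stereo_in_hemisphere[OF \<epsilon>, of y k] y by (auto simp: \<theta>_def)
  obtain F' where F': "(F has_derivative F') (at \<theta>)" using F[OF \<theta>(2)] unfolding differentiable_def by blast
  have lin: "linear F'" using F' by (rule has_derivative_linear)
  define d where "d = c * v \<theta> powr (real CARD('n) / (real CARD('n) - 2))"
  \<comment> \<open>the geodesic normal derivative is the directional derivative of the extension\<close>
  have dF: "F' (-1, 0) = d"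
  proof -
    let ?\<gamma> = "\<lambda>t. cos t *\<^sub>R \<theta> + sin t *\<^sub>R outer_normal"
    have th: "fst \<theta> = 0" "norm \<theta> = 1" using \<theta>(1) by (auto simp: hemisphere_bd_def)
    have onb: "\<theta> \<bullet> outer_normal = 0" "outer_normal \<bullet> outer_normal = 1" "\<theta> \<bullet> \<theta> = 1"
      using th by (auto simp: outer_normal_def inner_prod_def dot_square_norm norm_eq_1)
    have hemi: "?\<gamma> t \<in> hemisphere" if "t \<in> {-1..0}" for t
    proof -
      have "?\<gamma> t \<bullet> ?\<gamma> t = (cos t)\<^sup>2 + (sin t)\<^sup>2"
        by (simp add: inner_add_left inner_add_right onb inner_commute[of outer_normal \<theta>] power2_eq_square)
      then have "norm (?\<gamma> t) = 1" by (simp add: norm_eq_1)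
      moreover have "sin (- t) \<ge> 0" by (rule sin_ge_zero) (use that pi_gt3 in auto)
      then have "fst (?\<gamma> t) \<ge> 0" using th by (simp add: outer_normal_def)
      ultimately show ?thesis by (simp add: hemisphere_def)
    qed
    have cd: "(?\<gamma> has_derivative (\<lambda>t. t *\<^sub>R outer_normal)) (at 0 within {-1..0})"
      by (auto intro!: derivative_eq_intros simp: fun_eq_iff)
    have F'': "(F has_derivative F') (at (?\<gamma> 0))" using F' by simp
    have "((\<lambda>t. F (?\<gamma> t)) has_derivative (\<lambda>t. F' (t *\<^sub>R outer_normal))) (at 0 within {-1..0})"
      by (rule has_derivative_compose[OF cd F''])
    then have "((\<lambda>t. v (?\<gamma> t)) has_derivative (\<lambda>t. F' (t *\<^sub>R outer_normal))) (at 0 within {-1..0})"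
      by (rule has_derivative_transform[rotated 2]) (use F hemi in auto)
    then have 1: "((\<lambda>t. v (?\<gamma> t)) has_vector_derivative F' outer_normal) (at 0 within {-1..0})"
      by (simp add: has_vector_derivative_def linear_cmul[OF lin])
    have "((\<lambda>t. v (?\<gamma> t)) has_real_derivative d) (at 0 within {..0})"
      using nd unfolding has_normal_deriv_def d_def \<theta>_def .
    then have "((\<lambda>t. v (?\<gamma> t)) has_real_derivative d) (at 0 within {-1..0})"
      by (rule DERIV_subset) auto
    then have 2: "((\<lambda>t. v (?\<gamma> t)) has_vector_derivative d) (at 0 within {-1..0})"
      by (simp add: has_real_derivative_iff_has_vector_derivative)
    have "F' outer_normal = d"
      by (rule vector_derivative_unique_within[OF _ 1 2]) (simp add: trivial_limit_within islimpt_Icc)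
    then show ?thesis by (simp add: outer_normal_def)
  qed
  have dF': "F' (r, 0) = - r * d" for r
  proof -
    have "F' (r, 0) = F' ((- r) *\<^sub>R (-1, 0))" by simp
    then show ?thesis unfolding linear_cmul[OF lin] dF by simp
  qed
  have st: "stereo k \<epsilon> (y + t *\<^sub>R ?e) = (2 * t / (1 + (N + t\<^sup>2)),
     (1 / (1 + (N + t\<^sup>2))) *\<^sub>R (2 *\<^sub>R y + (\<epsilon> * (1 - (N + t\<^sup>2))) *\<^sub>R ?e))" for t
  proof -
    have "(y + t *\<^sub>R ?e) \<bullet> (y + t *\<^sub>R ?e) = N + t\<^sup>2"
      using y by (simp add: N_def inner_add_left inner_add_right inner_axis inner_axis' inner_axis_axis power2_eq_square)
    then show ?thesis using y by (simp add: stereo_def)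
  qed
  have dst: "((\<lambda>t. stereo k \<epsilon> (y + t *\<^sub>R ?e)) has_derivative (\<lambda>h. (2 * h / (1 + N), 0))) (at 0)"
    unfolding st
  proof (rule has_derivative_Pair)
    have "((\<lambda>t. 2 * t / (M + t\<^sup>2)) has_real_derivative 2 / M) (at 0)" if "M > 0" for M :: real
      using that by (auto intro!: derivative_eq_intros)
    from this[OF N0] have "((\<lambda>t. 2 * t / (1 + (N + t\<^sup>2))) has_real_derivative 2 / (1 + N)) (at 0)"
      by (simp add: add.assoc)
    then show "((\<lambda>t. 2 * t / (1 + (N + t\<^sup>2))) has_derivative (\<lambda>h. 2 * h / (1 + N))) (at 0)"
      by (rule has_derivative_eq_rhs[OF has_field_derivative_imp_has_derivative]) (simp add: fun_eq_iff)
    have a: "((\<lambda>t. 1 / (1 + (N + t\<^sup>2))) has_derivative (\<lambda>h. 0)) (at 0)"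
      using N0 by (auto intro!: derivative_eq_intros simp: field_simps)
    have b: "((\<lambda>t. 2 *\<^sub>R y + (\<epsilon> * (1 - (N + t\<^sup>2))) *\<^sub>R ?e) has_derivative (\<lambda>h. 0)) (at 0)"
      by (auto intro!: derivative_eq_intros)
    show "((\<lambda>t. (1 / (1 + (N + t\<^sup>2))) *\<^sub>R (2 *\<^sub>R y + (\<epsilon> * (1 - (N + t\<^sup>2))) *\<^sub>R ?e)) has_derivative (\<lambda>h. 0)) (at 0)"
      using has_derivative_scaleR[OF a b] by simp
  qed
  have F0: "(F has_derivative F') (at (stereo k \<epsilon> (y + 0 *\<^sub>R ?e)))" using F' by (simp add: \<theta>_def)
  have "((\<lambda>t. F (stereo k \<epsilon> (y + t *\<^sub>R ?e))) has_derivative (\<lambda>h. F' (2 * h / (1 + N), 0))) (at 0)"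
    by (rule has_derivative_compose[OF dst F0])
  then have "((\<lambda>t. F (stereo k \<epsilon> (y + t *\<^sub>R ?e))) has_real_derivative (- (2 / (1 + N)) * d)) (at 0)"
    unfolding has_field_derivative_def by (rule has_derivative_eq_rhs) (simp add: fun_eq_iff dF')
  note DF = this
  have Fv: "F (stereo k \<epsilon> (y + 0 *\<^sub>R ?e)) = v \<theta>" using F[OF \<theta>(2)] by (simp add: \<theta>_def)
  have vpos: "v \<theta> > 0" using v by (simp add: \<theta>_def)
  have "((\<lambda>t. F (stereo k \<epsilon> (y + t *\<^sub>R ?e)) powr (- ?b)) has_real_derivative
      (- ?b * v \<theta> powr (- ?b - 1)) * (- (2 / (1 + N)) * d)) (at 0)"
  proof (rule DERIV_chain2[where f = "\<lambda>s. s powr (- ?b)", OF _ DF])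
    show "((\<lambda>s. s powr (- ?b)) has_real_derivative - ?b * v \<theta> powr (- ?b - 1)) (at (F (stereo k \<epsilon> (y + 0 *\<^sub>R ?e))))"
      unfolding Fv using has_real_derivative_powr[OF vpos, of "- ?b"] by simp
  qed
  moreover have "((\<lambda>t. (1 + (N + t\<^sup>2)) / 2) has_real_derivative 0) (at 0)"
    by (auto intro!: derivative_eq_intros)
  ultimately have "((\<lambda>t. (1 + (N + t\<^sup>2)) / 2 * F (stereo k \<epsilon> (y + t *\<^sub>R ?e)) powr (- ?b)) has_real_derivative
      (1 + (N + 0\<^sup>2)) / 2 * ((- ?b * v \<theta> powr (- ?b - 1)) * (- (2 / (1 + N)) * d))
        + 0 * F (stereo k \<epsilon> (y + 0 *\<^sub>R ?e)) powr (- ?b)) (at 0)"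
    by (rule DERIV_mult'[rotated])
  moreover have "(1 + (N + 0\<^sup>2)) / 2 * ((- ?b * v \<theta> powr (- ?b - 1)) * (- (2 / (1 + N)) * d))
        + 0 * F (stereo k \<epsilon> (y + 0 *\<^sub>R ?e)) powr (- ?b) = ?b * (v \<theta> powr (- ?b - 1) * d)"
  proof -
    have gen: "M / 2 * ((- b * P) * (- (2 / M) * d)) + 0 * Z = b * (P * d)" if "M \<noteq> 0" for M b P d Z :: real
      using that by simp
    have "1 + N \<noteq> 0" using N0 by simp
    from gen[OF this] show ?thesis by (simp only: zero_power2 add_0_right)
  qed
  moreover have "v \<theta> powr (- ?b - 1) * d = c"
  proof -
    have "real CARD('n) - 2 \<noteq> 0" using n by simp
    then have "real CARD('n) / (real CARD('n) - 2) = 1 + ?b" by (simp add: field_simps)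
    then have "v \<theta> powr (- ?b - 1) * v \<theta> powr (real CARD('n) / (real CARD('n) - 2)) = 1"
      using vpos by (simp add: powr_add[symmetric])
    then show ?thesis by (simp add: d_def mult.left_commute)
  qed
  ultimately have 1: "((\<lambda>t. (1 + (N + t\<^sup>2)) / 2 * F (stereo k \<epsilon> (y + t *\<^sub>R ?e)) powr (- ?b)) has_real_derivative ?b * c) (at 0)"
    by simp
  have hs: "half_space_factor F k \<epsilon> (y + t *\<^sub>R ?e) = (1 + (N + t\<^sup>2)) / 2 * F (stereo k \<epsilon> (y + t *\<^sub>R ?e)) powr (- ?b)" for t
  proof -
    have "(y + t *\<^sub>R ?e) \<bullet> (y + t *\<^sub>R ?e) = N + t\<^sup>2"
      using y by (simp add: N_def inner_add_left inner_add_right inner_axis inner_axis' inner_axis_axis power2_eq_square)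
    then show ?thesis by (simp only: half_space_factor_def)
  qed
  have line: "((\<lambda>t. y + t *\<^sub>R ?e) has_derivative (\<lambda>t. t *\<^sub>R ?e)) (at 0)" by (auto intro!: derivative_eq_intros)
  have g0: "(half_space_factor F k \<epsilon> has_derivative (\<lambda>h. g \<bullet> h)) (at (y + 0 *\<^sub>R ?e))" using g by simp
  from has_derivative_compose[OF line g0]
  have 2: "((\<lambda>t. half_space_factor F k \<epsilon> (y + t *\<^sub>R ?e)) has_real_derivative g $ k) (at 0)"
    by (simp add: has_field_derivative_def inner_axis mult_commute_abs)
  show ?thesis using DERIV_unique[OF 2[unfolded hs] 1] .
qed

section \<open>Nonexistence\<close>

text \<open>Inside, derivatives are determined by the function; on the face they follow by continuity.\<close>

lemma grad_hess_determined_on_half_ball: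
  fixes s t :: "real^'n \<Rightarrow> real" and k :: 'n
  assumes W: "{y. norm y < L \<and> 0 \<le> y $ k} \<subseteq> W"
    and s: "has_grad_hess W s gs Hs" and t: "has_grad_hess W t gt Ht"
    and eq: "\<And>y. norm y < L \<Longrightarrow> 0 \<le> y $ k \<Longrightarrow> s y = t y"
    and y: "norm y < L" "0 \<le> y $ k"
  shows "gs y = gt y" "Hs y = Ht y"
proof -
  define V where "V = {y :: real^'n. norm y < L \<and> 0 < y $ k}"
  have V: "open V" unfolding V_def by (intro open_Collect_conj open_Collect_less continuous_intros)
  have VW: "V \<subseteq> W" using W by (auto simp: V_def)
  have g: "gs z = gt z" if z: "z \<in> V" for z
  proof -
    have "(t has_derivative (\<lambda>h. gs z \<bullet> h)) (at z)"
      by (rule has_derivative_transform_within_open[OF has_grad_hessD(1)[OF s] V z])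
         (use z VW eq in \<open>auto simp: V_def\<close>)
    then have "(\<lambda>h. gs z \<bullet> h) = (\<lambda>h. gt z \<bullet> h)"
      using has_derivative_unique has_grad_hessD(1)[OF t] z VW by blast
    then have "gs z \<bullet> h = gt z \<bullet> h" for h by (rule fun_cong)
    then show ?thesis by (metis vector_eq_rdot)
  qed
  have H: "Hs z = Ht z" if z: "z \<in> V" for z
  proof -
    have "(gt has_derivative (\<lambda>h. Hs z *v h)) (at z)"
      by (rule has_derivative_transform_within_open[OF has_grad_hessD(2)[OF s] V z g]) (use z VW in auto)
    then have "(\<lambda>h. Hs z *v h) = (\<lambda>h. Ht z *v h)"
      using has_derivative_unique has_grad_hessD(2)[OF t] z VW by blast
    then have "Hs z *v h = Ht z *v h" for h by (rule fun_cong)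
    then show ?thesis by (metis matrix_eq)
  qed
  define z where "z j = y + ((L - norm y) / real (j + 2)) *\<^sub>R axis k 1" for j
  have zV: "z j \<in> V" for j
  proof -
    have p: "0 < (L - norm y) / real (j + 2)" using y by simp
    have "(L - norm y) / real (j + 2) < L - norm y" using y by (simp add: divide_less_eq)
    moreover have "norm (z j) \<le> norm y + (L - norm y) / real (j + 2)"
      unfolding z_def using norm_triangle_ineq[of y "((L - norm y) / real (j + 2)) *\<^sub>R axis k 1"] p by simp
    moreover have "0 < z j $ k" unfolding z_def using y by (simp add: add_nonneg_pos)
    ultimately show ?thesis using y by (simp add: V_def)
  qed
  have "(\<lambda>j. (L - norm y) * (1 / real (j + 2))) \<longlonglongrightarrow> (L - norm y) * 0"
    by (intro tendsto_mult tendsto_const LIMSEQ_ignore_initial_segment[OF lim_1_over_n])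
  then have "(\<lambda>j. (L - norm y) / real (j + 2)) \<longlonglongrightarrow> 0" by simp
  then have "(\<lambda>j. y + ((L - norm y) / real (j + 2)) *\<^sub>R axis k 1) \<longlonglongrightarrow> y + 0 *\<^sub>R axis k 1"
    by (intro tendsto_add tendsto_scaleR tendsto_const)
  then have zy: "z \<longlonglongrightarrow> y" by (simp add: z_def[abs_def])
  have yW: "y \<in> W" using y W by auto
  have lim: "(\<lambda>j. f (z j)) \<longlonglongrightarrow> f y" if "continuous_on W f" for f :: "real^'n \<Rightarrow> 'x::real_normed_vector"
    using that zy yW zV VW by (auto simp: continuous_on_sequentially o_def)
  show "gs y = gt y"
    using lim[OF has_grad_hess_continuous(2)[OF s]] lim[OF has_grad_hess_continuous(2)[OF t]] g[OF zV]
    by (simp add: LIMSEQ_unique)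
  show "Hs y = Ht y"
    using lim[OF has_grad_hess_continuous(3)[OF s]] lim[OF has_grad_hess_continuous(3)[OF t]] H[OF zV]
    by (simp add: LIMSEQ_unique)
qed

text \<open>Here \<open>s\<close> and \<open>t\<close> are the half space factors for \<open>\<epsilon> = 1\<close> and \<open>\<epsilon> = - 1\<close>, with conformal Hessians \<open>Ms\<close> and \<open>Mt\<close>.
  It remains to supply the hypotheses of \<open>moving_spheres\<close>: monotonicity of \<open>K\<close> gives the ellipticity bound,
  monotonicity of \<open>H\<close> the boundary inequality, and strictness somewhere excludes that \<open>s\<close> equals one of its reflections.\<close>

theorem theorem1p10:
  fixes G :: "(real^'n) set"
    and f :: "real^'n \<Rightarrow> real"
    and K H :: "real \<times> (real^'n) \<Rightarrow> real"
    and k :: 'n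
  assumes "CARD('n) \<ge> 3"
    and "open G" and "convex G" and "cone_at_origin G" and "symmetric_set G"
    and "Gamma_n \<subseteq> G" and "G \<subseteq> Gamma_1"
    and "C1_open G f" and "symmetric_fun_on G f"
    and "\<And>l. l \<in> G \<Longrightarrow> f l > 0"
    and "\<And>l i. l \<in> G \<Longrightarrow> partial i f l > 0"
    and "\<And>\<theta>. \<theta> \<in> hemisphere \<Longrightarrow> K \<theta> > 0"
    and "C1_on hemisphere K" and "C1_on hemisphere_bd H"
    and "\<And>\<theta>. \<theta> \<in> hemisphere - poles k \<Longrightarrow> meridian_deriv k K \<theta> \<ge> 0"
    and "\<And>\<theta>. \<theta> \<in> hemisphere_bd - poles k \<Longrightarrow> meridian_deriv k H \<theta> \<ge> 0"
    and "(\<exists>\<theta>\<in>hemisphere - poles k. meridian_deriv k K \<theta> > 0) \<or>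
         (\<exists>\<theta>\<in>hemisphere_bd - poles k. meridian_deriv k H \<theta> > 0)"
  shows "\<not> (\<exists>v. C2_on hemisphere v \<and> is_solution G f K H v)"
proof
  note n = assms(1) and G = assms(2,3,5) and f = assms(8,9,11)
    and KC = assms(13) and HC = assms(14) and Kmono = assms(15) and Hmono = assms(16)
  assume "\<exists>v. C2_on hemisphere v \<and> is_solution G f K H v"
  then obtain v where v: "C2_on hemisphere v" "is_solution G f K H v" by blast
  have vpos: "v \<theta> > 0" and veq: "\<exists>l. schouten_eigenvalues v \<theta> l \<and> l \<in> G \<and> f l = K \<theta>" if "\<theta> \<in> hemisphere" for \<theta>
    using v(2) that unfolding is_solution_def by auto
  have vbd: "has_normal_deriv v (H \<theta> * v \<theta> powr (real CARD('n) / (real CARD('n) - 2))) \<theta>" if "\<theta> \<in> hemisphere_bd" for \<theta>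
    using v(2) that unfolding is_solution_def by auto
  obtain W F q A where W: "open W" "cball 0 1 \<subseteq> W" and h: "has_grad_hess W (ball_factor F) q A"
    and F: "\<And>\<theta>. \<theta> \<in> hemisphere \<Longrightarrow> F \<theta> = v \<theta> \<and> F differentiable (at \<theta>)"
    using ball_factor_smooth[OF v(1) vpos] by blast
  have e1: "(1::real)\<^sup>2 = 1" "(-1::real)\<^sup>2 = 1" by simp_all
  obtain V1 g1 H1 where V1: "open V1" "{y. 0 \<le> y $ k} \<subseteq> V1" and h1: "has_grad_hess V1 (half_space_factor F k 1) g1 H1"
    and m1: "\<And>y u l. 0 \<le> y $ k \<Longrightarrow>
       eigenbasis (conformal_hessian (ball_factor F (chart (stereo k 1 y))) (q (chart (stereo k 1 y))) (A (chart (stereo k 1 y)))) u l \<Longrightarrow>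
       \<exists>u. eigenbasis (conformal_hessian (half_space_factor F k 1 y) (g1 y) (H1 y)) u l"
    using half_space_factor_smooth[OF e1(1) W h] by blast
  obtain V2 g2 H2 where V2: "open V2" "{y. 0 \<le> y $ k} \<subseteq> V2" and h2: "has_grad_hess V2 (half_space_factor F k (-1)) g2 H2"
    and m2: "\<And>y u l. 0 \<le> y $ k \<Longrightarrow>
       eigenbasis (conformal_hessian (ball_factor F (chart (stereo k (-1) y))) (q (chart (stereo k (-1) y))) (A (chart (stereo k (-1) y)))) u l \<Longrightarrow>
       \<exists>u. eigenbasis (conformal_hessian (half_space_factor F k (-1) y) (g2 y) (H2 y)) u l"
    using half_space_factor_smooth[OF e1(2) W h] by blast
  let ?s = "half_space_factor F k 1" and ?t = "half_space_factor F k (-1)"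
  define Ms where "Ms y = conformal_hessian (?s y) (g1 y) (H1 y)" for y
  define Mt where "Mt y = conformal_hessian (?t y) (g2 y) (H2 y)" for y
  have eqs: "\<exists>u l. eigenbasis (Ms y) u l \<and> l \<in> G \<and> f l = K (stereo k 1 y)" if y: "0 \<le> y $ k" for y :: "real^'n"
  proof -
    have \<theta>: "stereo k 1 y \<in> hemisphere" using stereo_in_hemisphere(1)[OF e1(1) y] .
    obtain l where l: "schouten_eigenvalues v (stereo k 1 y) l" "l \<in> G" "f l = K (stereo k 1 y)" using veq[OF \<theta>] by blast
    then show ?thesis
      using schouten_eigenvalues_ball[OF n W(2) h _ vpos \<theta> l(1)] F m1[OF y] unfolding Ms_def by blast
  qed
  have eqt: "\<exists>u l. eigenbasis (Mt y) u l \<and> l \<in> G \<and> f l = K (stereo k (-1) y)" if y: "0 \<le> y $ k" for y :: "real^'n"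
  proof -
    have \<theta>: "stereo k (-1) y \<in> hemisphere" using stereo_in_hemisphere(1)[OF e1(2) y] .
    obtain l where l: "schouten_eigenvalues v (stereo k (-1) y) l" "l \<in> G" "f l = K (stereo k (-1) y)" using veq[OF \<theta>] by blast
    then show ?thesis
      using schouten_eigenvalues_ball[OF n W(2) h _ vpos \<theta> l(1)] F m2[OF y] unfolding Mt_def by blast
  qed
  let ?b = "2 / (real CARD('n) - 2)"
  have b: "?b > 0" using n by simp
  have Fpos: "F \<theta> > 0" if "\<theta> \<in> hemisphere" for \<theta> using F[OF that] vpos[OF that] by simp
  have pos: "0 < half_space_factor F k \<epsilon> y" if "\<epsilon>\<^sup>2 = 1" "0 \<le> y $ k" for \<epsilon> y
    using Fpos[OF stereo_in_hemisphere(1)[OF that]] one_plus_inner_pos[of y] by (simp add: half_space_factor_def)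
  have bd: "g1 y $ k = ?b * H (stereo k 1 y)" "g2 y $ k = ?b * H (stereo k (-1) y)" if y: "y $ k = 0" for y :: "real^'n"
  proof -
    have y0: "0 \<le> y $ k" using y by simp
    note S1 = stereo_in_hemisphere[OF e1(1) y0] and S2 = stereo_in_hemisphere[OF e1(2) y0]
    show "g1 y $ k = ?b * H (stereo k 1 y)"
      by (rule half_space_factor_boundary_gradient[OF n e1(1) y F vpos[OF S1(1)] vbd[OF S1(2)[OF y]]])
         (use has_grad_hessD(1)[OF h1] y0 V1(2) in auto)
    show "g2 y $ k = ?b * H (stereo k (-1) y)"
      by (rule half_space_factor_boundary_gradient[OF n e1(2) y F vpos[OF S2(1)] vbd[OF S2(2)[OF y]]])
         (use has_grad_hessD(1)[OF h2] y0 V2(2) in auto)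
  qed
  \<comment> \<open>in polar coordinates both charts run along meridians\<close>
  have polar1: "stereo k 1 (\<rho> *\<^sub>R w) = meridian_curve k w (height \<rho>)" if "norm w = 1" "0 \<le> \<rho>" for \<rho> w
    using stereo_polar[OF that e1(1)] by simp
  have polar2: "stereo k (-1) ((\<rho> *\<^sub>R w) /\<^sub>R L\<^sup>2) = meridian_curve k w (- height (\<rho> / L\<^sup>2))"
    if "norm w = 1" "0 \<le> \<rho>" for \<rho> w L
  proof -
    have eq: "(\<rho> *\<^sub>R w) /\<^sub>R L\<^sup>2 = (\<rho> / L\<^sup>2) *\<^sub>R w" by (simp add: divide_inverse mult.commute)
    show ?thesis unfolding eq using stereo_polar[OF that(1) _ e1(2), of "\<rho> / L\<^sup>2" k] that by simp
  qed
  have hemi: "meridian_curve k w s \<in> hemisphere" "w $ k = 0 \<Longrightarrow> meridian_curve k w s \<in> hemisphere_bd"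
    if "norm w = 1" "0 \<le> w $ k" "\<bar>s\<bar> < 1" for w s
    using meridian_curve_in_sphere[OF that(1), of s k] that meridian_curve_components(2)[of k w s]
    by (auto simp: hemisphere_def hemisphere_bd_def abs_square_le_1)
  have Kle: "K (meridian_curve k w s) \<le> K (meridian_curve k w t)"
    if "norm w = 1" "0 \<le> w $ k" "s \<le> t" "-1 < s" "t < 1" for w s t
    by (rule mono_along_meridian[OF KC that(1) _ Kmono that(3-5)]) (use hemi(1) that in auto)
  have Hle: "H (meridian_curve k w s) \<le> H (meridian_curve k w t)"
    if "norm w = 1" "w $ k = 0" "s \<le> t" "-1 < s" "t < 1" for w s t
    by (rule mono_along_meridian[OF HC that(1) _ Hmono that(3-5)]) (use hemi(2) that in auto)
  have K_refl: "K (stereo k (-1) (y /\<^sub>R L\<^sup>2)) \<le> K (stereo k 1 y)"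
    and H_refl: "y $ k = 0 \<Longrightarrow> H (stereo k (-1) (y /\<^sub>R L\<^sup>2)) \<le> H (stereo k 1 y)"
    if L: "L > 0" and y: "norm y < L" "0 \<le> y $ k" "y \<noteq> 0" for L y
  proof -
    define w where "w = y /\<^sub>R norm y"
    define \<rho> where "\<rho> = norm y"
    have w: "norm w = 1" "y = \<rho> *\<^sub>R w" "0 \<le> w $ k" using polar_decomposition[OF y(3)] y(2) by (simp_all add: w_def \<rho>_def)
    have \<rho>: "0 < \<rho>" "\<rho> < L" using y by (simp_all add: \<rho>_def)
    have hb: "\<bar>height \<rho>\<bar> < 1" "\<bar>height (\<rho> / L\<^sup>2)\<bar> < 1" using \<rho> L by (auto intro!: height_bounds)
    have le: "- height (\<rho> / L\<^sup>2) \<le> height \<rho>" using height_reflected_le[OF L] \<rho> by simp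
    have p: "stereo k 1 y = meridian_curve k w (height \<rho>)" "stereo k (-1) (y /\<^sub>R L\<^sup>2) = meridian_curve k w (- height (\<rho> / L\<^sup>2))"
      unfolding w(2) using polar1[OF w(1)] polar2[OF w(1)] \<rho> by auto
    show "K (stereo k (-1) (y /\<^sub>R L\<^sup>2)) \<le> K (stereo k 1 y)"
      unfolding p by (rule Kle[OF w(1,3) le]) (use hb in auto)
    show "H (stereo k (-1) (y /\<^sub>R L\<^sup>2)) \<le> H (stereo k 1 y)" if "y $ k = 0"
    proof -
      have "w $ k = 0" using that by (simp add: w_def)
      then show ?thesis unfolding p by (rule Hle[OF w(1) _ le]) (use hb in auto)
    qed
  qed
  \<comment> \<open>at the origin the boundary inequality follows by continuity\<close>
  have bd_le: "g2 (y /\<^sub>R L\<^sup>2) $ k \<le> g1 y $ k" if L: "L > 0" and y: "norm y < L" "y $ k = 0" for L y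
  proof -
    have off: "g2 (z /\<^sub>R L\<^sup>2) $ k \<le> g1 z $ k" if z: "norm z < L" "z $ k = 0" "z \<noteq> 0" for z
    proof -
      have "H (stereo k (-1) (z /\<^sub>R L\<^sup>2)) \<le> H (stereo k 1 z)" using H_refl[OF L z(1) _ z(3,2)] z(2) by simp
      then have "?b * H (stereo k (-1) (z /\<^sub>R L\<^sup>2)) \<le> ?b * H (stereo k 1 z)"
        using b by (intro mult_left_mono) auto
      then show ?thesis using bd(1)[OF z(2)] bd(2)[of "z /\<^sub>R L\<^sup>2"] z(2) by simp
    qed
    show ?thesis
    proof (cases "y = 0")
      case True
      have "\<exists>j. j \<noteq> k"
      proof (rule ccontr)
        assume "\<not> ?thesis"
        then have "(UNIV :: 'n set) = {k}" by auto
        then have "CARD('n) = 1" by (metis card_1_singleton_iff One_nat_def)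
        then show False using n by simp
      qed
      then obtain j where j: "j \<noteq> k" by blast
      define z where "z i = (L * (1 / real (i + 2))) *\<^sub>R (axis j 1 :: real^'n)" for i
      have z: "norm (z i) < L" "z i $ k = 0" "z i \<noteq> 0" for i
      proof -
        show "norm (z i) < L" using L by (simp add: z_def field_simps add_pos_nonneg)
        show "z i $ k = 0" using j by (simp add: z_def axis_def)
        show "z i \<noteq> 0" using L by (simp add: z_def axis_eq_0_iff)
      qed
      have z0: "z \<longlonglongrightarrow> 0"
      proof -
        have "(\<lambda>i. L * (1 / real (i + 2))) \<longlonglongrightarrow> L * 0"
          by (intro tendsto_mult tendsto_const LIMSEQ_ignore_initial_segment[OF lim_1_over_n])
        then have "(\<lambda>i. (L * (1 / real (i + 2))) *\<^sub>R (axis j 1 :: real^'n)) \<longlonglongrightarrow> (L * 0) *\<^sub>R axis j 1"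
          by (rule tendsto_scaleR[OF _ tendsto_const])
        then show ?thesis by (simp add: z_def[abs_def])
      qed
      then have z0': "(\<lambda>i. z i /\<^sub>R L\<^sup>2) \<longlonglongrightarrow> 0" using tendsto_scaleR[OF tendsto_const z0, of "inverse (L\<^sup>2)"] by simp
      have "0 \<in> V1" "0 \<in> V2" using V1(2) V2(2) by auto
      then have "isCont g1 0" "isCont g2 0"
        using has_grad_hess_continuous(2)[OF h1] has_grad_hess_continuous(2)[OF h2] V1(1) V2(1)
        by (simp_all add: continuous_on_eq_continuous_at)
      then have "(\<lambda>i. g1 (z i) $ k) \<longlonglongrightarrow> g1 0 $ k" "(\<lambda>i. g2 (z i /\<^sub>R L\<^sup>2) $ k) \<longlonglongrightarrow> g2 0 $ k"
        by (auto intro!: tendsto_vec_nth isCont_tendsto_compose[where g = g1] isCont_tendsto_compose[where g = g2] z0 z0')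
      then have "g2 0 $ k \<le> g1 0 $ k" using off[OF z] by (intro LIMSEQ_le[of "\<lambda>i. g2 (z i /\<^sub>R L\<^sup>2) $ k"]) auto
      then show ?thesis using True by simp
    qed (use off y in auto)
  qed
  \<comment> \<open>the value of \<open>f\<close> depends on the matrix only, not on the order of its eigenvalues\<close>
  have det_f: "f l = f m" if l: "eigenbasis M u l" and m: "eigenbasis M u' m" "m \<in> G" for M u l u' m
  proof -
    obtain p where "p permutes UNIV" "l = permute_coords p m" using eigenvalues_permute[OF l m(1)] .
    then show ?thesis using f(2) m(2) unfolding symmetric_fun_on_def by auto
  qed
  have half_scale: "0 \<le> (y /\<^sub>R c) $ k" if "0 \<le> y $ k" "0 \<le> c" for y :: "real^'n" and c
    unfolding vector_scaleR_component using that by (intro scaleR_nonneg_nonneg) auto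
  \<comment> \<open>both families of matrices are compact up to the boundary of the half ball, where the equation still holds\<close>
  have ell: "\<exists>C\<ge>0. \<forall>y. norm y < L \<longrightarrow> 0 < y $ k \<longrightarrow> ellipticity_bound C (Ms y) (Mt (y /\<^sub>R L\<^sup>2))"
    if L: "L > 0" for L
  proof -
    define X where "X = Ms ` half_ball k L \<union> (\<lambda>y. Mt (y /\<^sub>R L\<^sup>2)) ` half_ball k L"
    have sub: "half_ball k L \<subseteq> V1" "(\<lambda>y. y /\<^sub>R L\<^sup>2) ` half_ball k L \<subseteq> V2"
      using V1(2) V2(2) half_scale[of _ "L\<^sup>2"] by (auto simp: half_ball_def)
    have cMs: "continuous_on V1 Ms" and cMt: "continuous_on V2 Mt"
      unfolding Ms_def Mt_def using has_grad_hess_continuous[OF h1] has_grad_hess_continuous[OF h2]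
      by (auto intro!: continuous_intros)
    have X: "compact X"
      unfolding X_def
    proof (intro compact_Un compact_continuous_image compact_half_ball)
      show "continuous_on (half_ball k L) Ms" using cMs sub(1) by (rule continuous_on_subset)
      show "continuous_on (half_ball k L) (\<lambda>y. Mt (y /\<^sub>R L\<^sup>2))"
        by (rule continuous_on_compose2[OF cMt _ sub(2)]) (intro continuous_intros)
    qed
    have Xsym: "transpose M = M" if "M \<in> X" for M
    proof -
      have "transpose (H1 y) = H1 y" if "y \<in> half_ball k L" for y using has_grad_hessD(3)[OF h1] sub(1) that by blast
      moreover have "transpose (H2 (y /\<^sub>R L\<^sup>2)) = H2 (y /\<^sub>R L\<^sup>2)" if "y \<in> half_ball k L" for y
        using has_grad_hessD(3)[OF h2] sub(2) that by blast
      ultimately show ?thesis using that by (auto simp: X_def Ms_def Mt_def transpose_conformal_hessian)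
    qed
    have Xadm: "\<exists>u l. eigenbasis M u l \<and> l \<in> G" if M: "M \<in> X" for M
    proof -
      from M consider y where "y \<in> half_ball k L" "M = Ms y"
        | y where "y \<in> half_ball k L" "M = Mt (y /\<^sub>R L\<^sup>2)"
        unfolding X_def by blast
      then show ?thesis
      proof cases
        case (1 y)
        then show ?thesis using eqs[of y] unfolding half_ball_def by blast
      next
        case (2 y)
        then have "0 \<le> (y /\<^sub>R L\<^sup>2) $ k" by (intro half_scale) (auto simp: half_ball_def)
        then show ?thesis using eqt 2(2) by blast
      qed
    qed
    obtain C where C: "C \<ge> 0"
      "\<And>A B u v l m. A \<in> X \<Longrightarrow> B \<in> X \<Longrightarrow> eigenbasis A u l \<Longrightarrow> eigenbasis B v m \<Longrightarrow> f m \<le> f l \<Longrightarrow>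
       ellipticity_bound C A B"
      using uniform_ellipticity[OF G f X Xsym Xadm] by metis
    have "ellipticity_bound C (Ms y) (Mt (y /\<^sub>R L\<^sup>2))" if y: "norm y < L" "0 < y $ k" for y
    proof -
      have yk: "0 \<le> y $ k" using y by simp
      have ne: "y \<noteq> 0" using y by auto
      obtain u l where l: "eigenbasis (Ms y) u l" "l \<in> G" "f l = K (stereo k 1 y)" using eqs[OF yk] by blast
      obtain u' m where m: "eigenbasis (Mt (y /\<^sub>R L\<^sup>2)) u' m" "m \<in> G" "f m = K (stereo k (-1) (y /\<^sub>R L\<^sup>2))"
        using eqt[OF half_scale[OF yk, of "L\<^sup>2"]] by auto
      have "y \<in> half_ball k L" using y by (simp add: half_ball_def)
      then have "Ms y \<in> X" "Mt (y /\<^sub>R L\<^sup>2) \<in> X" by (auto simp: X_def)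
      from C(2)[OF this l(1) m(1)] show ?thesis using K_refl[OF L y(1) yk ne] l(3) m(3) by simp
    qed
    then show ?thesis using C(1) by blast
  qed
  \<comment> \<open>equality would force \<open>K\<close> and \<open>H\<close> to be constant along meridians\<close>
  have rigid: "\<exists>y. norm y < L \<and> 0 \<le> y $ k \<and> L\<^sup>2 * ?t (y /\<^sub>R L\<^sup>2) \<noteq> ?s y" if L: "L > 0" for L
  proof (rule ccontr)
    assume "\<not> ?thesis"
    then have eq: "?s y = L\<^sup>2 * ?t (y /\<^sub>R L\<^sup>2)" if "norm y < L" "0 \<le> y $ k" for y using that by force
    have L2: "L\<^sup>2 > 0" using L by simp
    let ?V = "V1 \<inter> {y. y /\<^sub>R L\<^sup>2 \<in> V2}"
    have sub: "{y. norm y < L \<and> 0 \<le> y $ k} \<subseteq> ?V"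
      using V1(2) V2(2) half_scale[of _ "L\<^sup>2"] by auto
    have gH: "g1 y = g2 (y /\<^sub>R L\<^sup>2)" "H1 y = inverse (L\<^sup>2) *\<^sub>R H2 (y /\<^sub>R L\<^sup>2)" if "norm y < L" "0 \<le> y $ k" for y
    proof -
      have a: "has_grad_hess ?V ?s g1 H1" using h1 by (rule has_grad_hess_subset) auto
      have b: "has_grad_hess ?V (\<lambda>y. L\<^sup>2 * ?t (y /\<^sub>R L\<^sup>2)) (\<lambda>y. g2 (y /\<^sub>R L\<^sup>2)) (\<lambda>y. inverse (L\<^sup>2) *\<^sub>R H2 (y /\<^sub>R L\<^sup>2))"
        using has_grad_hess_rescale[OF h2 L2] by (rule has_grad_hess_subset) auto
      show "g1 y = g2 (y /\<^sub>R L\<^sup>2)" "H1 y = inverse (L\<^sup>2) *\<^sub>R H2 (y /\<^sub>R L\<^sup>2)"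
        using grad_hess_determined_on_half_ball[OF sub a b eq that] by auto
    qed
    have Keq: "K (stereo k 1 y) = K (stereo k (-1) (y /\<^sub>R L\<^sup>2))" if y: "norm y < L" "0 \<le> y $ k" for y
    proof -
      have M: "Ms y = Mt (y /\<^sub>R L\<^sup>2)"
        unfolding Ms_def Mt_def gH[OF y] eq[OF y] using L by (simp add: conformal_hessian_def)
      obtain u l where l: "eigenbasis (Ms y) u l" "l \<in> G" "f l = K (stereo k 1 y)" using eqs[OF y(2)] by blast
      obtain u' m where m: "eigenbasis (Mt (y /\<^sub>R L\<^sup>2)) u' m" "m \<in> G" "f m = K (stereo k (-1) (y /\<^sub>R L\<^sup>2))"
        using eqt[OF half_scale[OF y(2), of "L\<^sup>2"]] by auto
      show ?thesis using det_f[OF l(1)[unfolded M] m(1,2)] l(3) m(3) by simp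
    qed
    have Heq: "H (stereo k 1 y) = H (stereo k (-1) (y /\<^sub>R L\<^sup>2))" if y: "norm y < L" "y $ k = 0" for y
      using bd(1)[of y] bd(2)[of "y /\<^sub>R L\<^sup>2"] gH(1)[of y] y b by simp
    have deriv0: "meridian_deriv k u (meridian_curve k w s) = 0"
      if u: "C1_on S u" and w: "norm w = 1" "0 \<le> w $ k" and S: "\<And>s. \<bar>s\<bar> < 1 \<Longrightarrow> meridian_curve k w s \<in> S"
        and mono: "\<And>\<theta>. \<theta> \<in> S - poles k \<Longrightarrow> meridian_deriv k u \<theta> \<ge> 0"
        and ueq: "\<And>\<rho>. 0 < \<rho> \<Longrightarrow> \<rho> < L \<Longrightarrow> u (stereo k 1 (\<rho> *\<^sub>R w)) = u (stereo k (-1) ((\<rho> *\<^sub>R w) /\<^sub>R L\<^sup>2))"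
        and s: "\<bar>s\<bar> < 1" for S u w s
    proof -
      have const: "u (meridian_curve k w a) = u (meridian_curve k w b)" if "\<bar>a\<bar> < 1" "\<bar>b\<bar> < 1" for a b
      proof (rule constant_if_reflection_invariant[OF L _ _ that])
        show "u (meridian_curve k w s) \<le> u (meridian_curve k w t)" if "s \<le> t" "-1 < s" "t < 1" for s t
          by (rule mono_along_meridian[OF u w(1) S mono that])
        show "u (meridian_curve k w (height \<rho>)) = u (meridian_curve k w (- height (\<rho> / L\<^sup>2)))" if "0 < \<rho>" "\<rho> < L" for \<rho>
          using ueq[OF that] polar1[OF w(1)] polar2[OF w(1)] that by simp
      qed
      have "((\<lambda>s. u (meridian_curve k w s)) has_real_derivative 0) (at s)"
      proof (rule has_field_derivative_transform_within_open[where S = "{-1<..<1}" and f = "\<lambda>_. u (meridian_curve k w s)"])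
        show "u (meridian_curve k w s) = u (meridian_curve k w r)" if "r \<in> {-1<..<1}" for r
          using that s by (intro const) auto
      qed (use s in auto)
      then show ?thesis using derivative_along_meridian[OF u w(1) S s] DERIV_unique by blast
    qed
    from assms(17) show False
    proof
      assume "\<exists>\<theta>\<in>hemisphere - poles k. meridian_deriv k K \<theta> > 0"
      then obtain \<theta> where \<theta>: "\<theta> \<in> hemisphere" "\<theta> \<notin> poles k" "meridian_deriv k K \<theta> > 0" by blast
      then obtain w s where w: "norm w = 1" "\<bar>s\<bar> < 1" "\<theta> = meridian_curve k w s" "fst \<theta> = sqrt (1 - s\<^sup>2) * w $ k"
        using on_meridian_curve[of \<theta> k] by (auto simp: hemisphere_def)
      have "0 < sqrt (1 - s\<^sup>2)" using w(2) by (simp add: abs_square_less_1)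
      then have wk: "0 \<le> w $ k" using \<theta>(1) w(4) by (simp add: hemisphere_def zero_le_mult_iff)
      have "meridian_deriv k K (meridian_curve k w s) = 0"
        by (rule deriv0[OF KC w(1) wk hemi(1)[OF w(1) wk] Kmono _ w(2)])
           (use Keq w(1) wk in \<open>auto\<close>)
      then show False using \<theta>(3) w(3) by simp
    next
      assume "\<exists>\<theta>\<in>hemisphere_bd - poles k. meridian_deriv k H \<theta> > 0"
      then obtain \<theta> where \<theta>: "\<theta> \<in> hemisphere_bd" "\<theta> \<notin> poles k" "meridian_deriv k H \<theta> > 0" by blast
      then obtain w s where w: "norm w = 1" "\<bar>s\<bar> < 1" "\<theta> = meridian_curve k w s" "fst \<theta> = sqrt (1 - s\<^sup>2) * w $ k"
        using on_meridian_curve[of \<theta> k] by (auto simp: hemisphere_bd_def)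
      have "0 < sqrt (1 - s\<^sup>2)" using w(2) by (simp add: abs_square_less_1)
      then have wk: "w $ k = 0" using \<theta>(1) w(4) by (simp add: hemisphere_bd_def)
      then have wk': "0 \<le> w $ k" by simp
      have "meridian_deriv k H (meridian_curve k w s) = 0"
        by (rule deriv0[OF HC w(1) wk' hemi(2)[OF w(1) wk' _ wk] Hmono _ w(2)])
           (use Heq w(1) wk in \<open>auto\<close>)
      then show False using \<theta>(3) w(3) by simp
    qed
  qed
  let ?V = "V1 \<inter> V2"
  have inv: "?s y = (norm y)\<^sup>2 * ?t (y /\<^sub>R (norm y)\<^sup>2)" if "y \<noteq> 0" for y
  proof -
    have n0: "(norm y)\<^sup>2 > 0" using that by simp
    have "(y /\<^sub>R m) \<bullet> (y /\<^sub>R m) = inverse m" if "y \<bullet> y = m" "m > 0" for m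
      using that by simp
    then have "(y /\<^sub>R (norm y)\<^sup>2) \<bullet> (y /\<^sub>R (norm y)\<^sup>2) = inverse ((norm y)\<^sup>2)"
      using n0 by (simp add: power2_norm_eq_inner)
    then show ?thesis
      unfolding half_space_factor_def stereo_inverted[OF that]
      using n0 by (simp add: dot_square_norm field_simps)
  qed
  show False
  proof (rule moving_spheres[of ?V k ?s g1 H1 ?t g2 H2])
    show "open ?V" using V1(1) V2(1) by blast
    show "{y. 0 \<le> y $ k} \<subseteq> ?V" using V1(2) V2(2) by blast
    show "has_grad_hess ?V ?s g1 H1" using h1 by (rule has_grad_hess_subset) auto
    show "has_grad_hess ?V ?t g2 H2" using h2 by (rule has_grad_hess_subset) auto
    show "0 < ?s y" "0 < ?t y" if "0 \<le> y $ k" for y using pos that by auto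
    show "?s y = (norm y)\<^sup>2 * ?t (y /\<^sub>R (norm y)\<^sup>2)" if "y \<noteq> 0" for y by (rule inv[OF that])
  qed (use ell[unfolded Ms_def Mt_def] bd_le rigid in blast)+
qed

end
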